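(* There exist uncountably many pairwise non-isomorphic $4$-generated locally Hilbert--Schmidt stable groups which are not Hilbert--Schmidt stable.
   Context: For $d\in\mathbb{N}$ the unitary group $U(d)$ carries the normalized Hilbert--Schmidt distance $d_{\mathrm{HS}}(A,B)=\sqrt{\tfrac1d \mathrm{Tr}((A-B)^*(A-B))}$. Let $G$ be a group with finite generating set $S$ and let $B_S(n)$ be the ball of radius $n$ around the identity in the word metric. An $(n,\delta)$-almost representation is a map $\varphi:B_S(n)\to U(d)$, for some $d\in\mathbb{N}$, with $d_{\mathrm{HS}}(\varphi(gh),\varphi(g)\varphi(h))\le\delta$ whenever $g,h,gh\in B_S(n)$. $G$ is Hilbert--Schmidt stable if for every $\varepsilon>0$ there are $\delta>0$, $n\in\mathbb{N}$ such that for every $d\in\mathbb{N}$ and every $(n,\delta)$-almost representation $\varphi:B_S(n)\to U(d)$ there is a unitary representation $\pi:G\to U(d)$ with $d_{\mathrm{HS}}(\varphi(s),\pi(s))<\varepsilon$ for all $s\in S$. $G$ is locally Hilbert--Schmidt stable if for every $\varepsilon>0$ and $r\in\mathbb{N}$ there are $\delta>0$, $n\in\mathbb{N}$ such that for every $d\in\mathbb{N}$ and every $(n,\delta)$-almost representation $\varphi:B_S(n)\to U(d)$ there is a map $f:B_S(r)\to U(d)$ with $d_{\mathrm{HS}}(\varphi(s),f(s))<\varepsilon$ for all $s\in S$ and $f(gh)=f(g)f(h)$ for all $g,h\in B_S(r)$ with $gh\in B_S(r)$. Both notions are independent of the finite generating set $S$. *)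

theory Defs
  imports
    "HOL-Algebra.Algebra"
    "HOL-Library.Countable_Set"
    "Jordan_Normal_Form.Schur_Decomposition"
begin

definition unitary_group :: "nat \<Rightarrow> complex mat monoid" where
  "unitary_group d =
     \<lparr>carrier = {A \<in> carrier_mat d d. mat_adjoint A * A = 1\<^sub>m d \<and> A * mat_adjoint A = 1\<^sub>m d},
      monoid.mult = (*), one = 1\<^sub>m d\<rparr>"

definition mat_trace :: "'a :: comm_monoid_add mat \<Rightarrow> 'a" where
  "mat_trace A = (\<Sum>i<dim_row A. A $$ (i, i))"

text \<open>The trace of \<open>(A - B)\<^sup>* (A - B)\<close> is a nonnegative real number; \<open>Re\<close> only casts it to type
  \<^typ>\<open>real\<close>.\<close>

definition hs_dist :: "nat \<Rightarrow> complex mat \<Rightarrow> complex mat \<Rightarrow> real" where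
  "hs_dist d A B = sqrt (1 / real d * Re (mat_trace (mat_adjoint (A - B) * (A - B))))"

definition finite_generating_set :: "('a, 'b) monoid_scheme \<Rightarrow> 'a set \<Rightarrow> bool" where
  "finite_generating_set G S \<longleftrightarrow> finite S \<and> S \<subseteq> carrier G \<and> generate G S = carrier G"

definition generated_by_at_most :: "nat \<Rightarrow> ('a, 'b) monoid_scheme \<Rightarrow> bool" where
  "generated_by_at_most k G \<longleftrightarrow> (\<exists>S. finite_generating_set G S \<and> card S \<le> k)"

text \<open>The elements at word distance at most \<open>n\<close> from the identity: the products of at most \<open>n\<close>
  letters, each a generator or the inverse of one.\<close>

definition word_ball :: "('a, 'b) monoid_scheme \<Rightarrow> 'a set \<Rightarrow> nat \<Rightarrow> 'a set" where
  "word_ball G S n =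
     {foldr (\<otimes>\<^bsub>G\<^esub>) ws \<one>\<^bsub>G\<^esub> | ws. set ws \<subseteq> S \<union> m_inv G ` S \<and> length ws \<le> n}"

text \<open>Maps defined on a ball are total functions whose values outside the ball are unconstrained.\<close>

definition almost_rep ::
    "('a, 'b) monoid_scheme \<Rightarrow> 'a set \<Rightarrow> nat \<Rightarrow> real \<Rightarrow> nat \<Rightarrow> ('a \<Rightarrow> complex mat) \<Rightarrow> bool" where
  "almost_rep G S n \<delta> d \<phi> \<longleftrightarrow>
     \<phi> \<in> word_ball G S n \<rightarrow> carrier (unitary_group d) \<and>
     (\<forall>g \<in> word_ball G S n. \<forall>h \<in> word_ball G S n. g \<otimes>\<^bsub>G\<^esub> h \<in> word_ball G S n \<longrightarrow>
        hs_dist d (\<phi> (g \<otimes>\<^bsub>G\<^esub> h)) (\<phi> g * \<phi> h) \<le> \<delta>)"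

definition local_rep ::
    "('a, 'b) monoid_scheme \<Rightarrow> 'a set \<Rightarrow> nat \<Rightarrow> nat \<Rightarrow> ('a \<Rightarrow> complex mat) \<Rightarrow> bool" where
  "local_rep G S r d f \<longleftrightarrow>
     f \<in> word_ball G S r \<rightarrow> carrier (unitary_group d) \<and>
     (\<forall>g \<in> word_ball G S r. \<forall>h \<in> word_ball G S r. g \<otimes>\<^bsub>G\<^esub> h \<in> word_ball G S r \<longrightarrow>
        f (g \<otimes>\<^bsub>G\<^esub> h) = f g * f h)"

text \<open>The radii are positive so that the ball contains the generators, at which the maps are
  compared. Dimensions are positive so that the normalization \<open>1 / d\<close> makes sense.\<close>

definition hs_stable_wrt :: "('a, 'b) monoid_scheme \<Rightarrow> 'a set \<Rightarrow> bool" where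
  "hs_stable_wrt G S \<longleftrightarrow>
     (\<forall>\<epsilon>>0. \<exists>\<delta>>0. \<exists>n\<ge>1. \<forall>d\<ge>1. \<forall>\<phi>. almost_rep G S n \<delta> d \<phi> \<longrightarrow>
        (\<exists>\<pi> \<in> hom G (unitary_group d). \<forall>s\<in>S. hs_dist d (\<phi> s) (\<pi> s) < \<epsilon>))"

definition locally_hs_stable_wrt :: "('a, 'b) monoid_scheme \<Rightarrow> 'a set \<Rightarrow> bool" where
  "locally_hs_stable_wrt G S \<longleftrightarrow>
     (\<forall>\<epsilon>>0. \<forall>r\<ge>1. \<exists>\<delta>>0. \<exists>n\<ge>1. \<forall>d\<ge>1. \<forall>\<phi>. almost_rep G S n \<delta> d \<phi> \<longrightarrow>
        (\<exists>f. local_rep G S r d f \<and> (\<forall>s\<in>S. hs_dist d (\<phi> s) (f s) < \<epsilon>)))"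

text \<open>Neither notion depends on the choice of the finite generating set, so existentially
  quantifying over it is no restriction.\<close>

definition hs_stable :: "('a, 'b) monoid_scheme \<Rightarrow> bool" where
  "hs_stable G \<longleftrightarrow> (\<exists>S. finite_generating_set G S \<and> hs_stable_wrt G S)"

definition locally_hs_stable :: "('a, 'b) monoid_scheme \<Rightarrow> bool" where
  "locally_hs_stable G \<longleftrightarrow> (\<exists>S. finite_generating_set G S \<and> locally_hs_stable_wrt G S)"

end

(* For a permutation tau of the integers with |tau x - x| <= 1, let the free group on s and t act on
   the integers through the shift x |-> x + 1 and tau, and let G be the semidirect product of the
   resulting direct sum of copies of Z/2 (the "lamps") with this free group; it is generated by
   the lamp a at 0, s and t.

   G is locally stable: in an almost representation the lamps in a finite window almost are
   commuting involutions, hence are close to exact ones, that is, to a labelling of an orthonormal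
   basis by subsets of the window. The images of s and t almost intertwine two coarsenings of
   the labelling, so the multiplicities of the labels almost satisfy a system of integral linear
   equations. Simultaneous Diophantine approximation yields a nearby integral solution; relabelling
   few basis vectors accordingly makes the coarsenings equivalent, and a polar decomposition turns
   the images of s and t into nearby exact intertwiners. As s and t are free, nothing else is needed
   for a representation of a ball.

   G is not stable if tau fixes the negative integers and swaps 0 and 1: then every
   finite-dimensional unitary representation identifies the lamps at 0 and 1, whereas finite
   permutation models of large windows keep them far apart.

   The isomorphism type together with a choice of generators determines tau, so every isomorphism
   class arises from only countably many of the uncountably many tau. *)

theory Submission
  imports Defs "HOL-Analysis.L2_Norm" "Jordan_Normal_Form.Spectral_Radius"
begin

section \<open>Unitary matrices and the Hilbert-Schmidt distance\<close>

text \<open>Uniformity in the dimension shapes the proof: the tolerance may depend on the window and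
  on \<epsilon>, never on \<open>d\<close>. Equations that the multiplicities satisfy up to a small
  multiple of \<open>d\<close> have to be solved exactly, and in integers. A rational approximation
  whose denominator is bounded independently of \<open>d\<close> can be scaled up to size almost
  \<open>d\<close>, losing only a bounded number plus a small fraction of the basis vectors. If
  \<open>d\<close> is too small for the bounded loss to be a small fraction, each error is an
  integer of modulus below 1, hence zero. One relabelling must serve \<open>s\<close> and
  \<open>t\<close>, which move the same lamps. Hence their equations are solved simultaneously; the
  two unitaries are then corrected independently, since no relation links them. Stability is an
  existential statement over generating sets, so its failure has to be proved for all of them. It is
  therefore expressed by one group element that every finite-dimensional representation sends near
  1, while models of arbitrary finite subsets send it far from 1.\<close>

abbreviation MM :: "nat \<Rightarrow> complex mat set" where "MM d \<equiv> carrier_mat d d"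
abbreviation UU :: "nat \<Rightarrow> complex mat set" where "UU d \<equiv> carrier (unitary_group d)"
abbreviation adj :: "complex mat \<Rightarrow> complex mat" where "adj \<equiv> mat_adjoint"

lemma MM_closed [simp]:
  "A \<in> MM d \<Longrightarrow> B \<in> MM d \<Longrightarrow> A * B \<in> MM d"
  "A \<in> MM d \<Longrightarrow> B \<in> MM d \<Longrightarrow> A - B \<in> MM d"
  "A \<in> MM d \<Longrightarrow> B \<in> MM d \<Longrightarrow> A + B \<in> MM d"
  by auto

lemma MM_one [simp]: "A \<in> MM d \<Longrightarrow> A * 1\<^sub>m d = A" "A \<in> MM d \<Longrightarrow> 1\<^sub>m d * A = A"
  by auto

lemma MM_assoc: "A \<in> MM d \<Longrightarrow> B \<in> MM d \<Longrightarrow> C \<in> MM d \<Longrightarrow> A * B * C = A * (B * C)"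
  by (rule assoc_mult_mat)

lemma adj_dim [simp]: "dim_row (adj A) = dim_col A" "dim_col (adj A) = dim_row A"
  by (auto simp: mat_adjoint_def)

lemma adj_carrier [simp, intro]: "A \<in> carrier_mat m n \<Longrightarrow> adj A \<in> carrier_mat n m"
  by (rule carrier_matI) simp_all

lemma adj_index [simp]: "i < dim_col A \<Longrightarrow> j < dim_row A \<Longrightarrow> adj A $$ (i, j) = cnj (A $$ (j, i))"
  by (auto simp: mat_adjoint_def mat_of_rows_def)

lemma adj_adj [simp]: "adj (adj A) = A"
  by (rule eq_matI) auto

lemma mult_index:
  assumes "A \<in> carrier_mat m n" "B \<in> carrier_mat n l" "i < m" "j < l"
  shows "(A * B) $$ (i, j) = (\<Sum>k<n. A $$ (i, k) * B $$ (k, j))"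
  using assms by (simp add: scalar_prod_def atLeast0LessThan)

lemma adj_mult: "A \<in> carrier_mat m n \<Longrightarrow> B \<in> carrier_mat n l \<Longrightarrow> adj (A * B) = adj B * adj A"
  by (rule eq_matI) (auto simp: scalar_prod_def mult.commute)

lemma MM_adj_mult: "A \<in> MM d \<Longrightarrow> B \<in> MM d \<Longrightarrow> adj (A * B) = adj B * adj A"
  by (rule adj_mult)

lemma adj_add: "A \<in> carrier_mat m n \<Longrightarrow> B \<in> carrier_mat m n \<Longrightarrow> adj (A + B) = adj A + adj B"
  by (rule eq_matI) auto

lemma adj_one [simp]: "adj (1\<^sub>m d) = 1\<^sub>m d"
  by (rule eq_matI) auto

lemma UU_iff: "A \<in> UU d \<longleftrightarrow> A \<in> MM d \<and> adj A * A = 1\<^sub>m d \<and> A * adj A = 1\<^sub>m d"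
  by (auto simp: unitary_group_def)

text \<open>A left inverse of a square matrix is also a right inverse.\<close>

lemma UU_I: "A \<in> MM d \<Longrightarrow> adj A * A = 1\<^sub>m d \<Longrightarrow> A \<in> UU d"
  unfolding UU_iff using mat_mult_left_right_inverse[of "adj A" d A] by auto

lemma UU_MM [simp, dest]: "A \<in> UU d \<Longrightarrow> A \<in> MM d"
  by (simp add: UU_iff)

lemma UU_one [simp]: "1\<^sub>m d \<in> UU d"
  by (simp add: UU_iff)

lemma UU_adj [simp]: "A \<in> UU d \<Longrightarrow> adj A \<in> UU d"
  by (auto simp: UU_iff)

lemma UU_cancel:
  assumes "A \<in> UU d" "B \<in> MM d"
  shows "adj A * (A * B) = B" "A * (adj A * B) = B" "B * A * adj A = B" "B * adj A * A = B"
proof -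
  have A: "A \<in> MM d" "adj A \<in> MM d" "adj A * A = 1\<^sub>m d" "A * adj A = 1\<^sub>m d"
    using assms by (auto simp: UU_iff)
  show "adj A * (A * B) = B" "A * (adj A * B) = B"
    using MM_assoc[OF A(2,1) assms(2)] MM_assoc[OF A(1,2) assms(2)] A assms(2) by auto
  show "B * A * adj A = B" "B * adj A * A = B"
    unfolding MM_assoc[OF assms(2) A(1,2)] MM_assoc[OF assms(2) A(2,1)] A(3,4)
    using assms(2) by simp_all
qed

lemma UU_mult [simp]:
  assumes "A \<in> UU d" "B \<in> UU d" shows "A * B \<in> UU d"
proof (rule UU_I)
  have M: "A \<in> MM d" "B \<in> MM d" "adj A \<in> MM d" "adj B \<in> MM d" using assms by auto
  show "A * B \<in> MM d" using M by auto
  have "adj (A * B) * (A * B) = adj B * (adj A * (A * B))"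
    using M by (simp add: MM_adj_mult[of _ d] MM_assoc[of _ d])
  then show "adj (A * B) * (A * B) = 1\<^sub>m d"
    using assms M UU_cancel(1)[OF assms(1) M(2)] by (simp add: UU_iff)
qed

lemma unitary_group_sel [simp]:
  "A \<otimes>\<^bsub>unitary_group d\<^esub> B = A * B" "\<one>\<^bsub>unitary_group d\<^esub> = 1\<^sub>m d"
  by (simp_all only: unitary_group_def monoid.select_convs)

lemma group_unitary_group: "group (unitary_group d)"
proof (rule groupI)
  fix x y z assume "x \<in> UU d" "y \<in> UU d" "z \<in> UU d"
  then show "x \<otimes>\<^bsub>unitary_group d\<^esub> y \<otimes>\<^bsub>unitary_group d\<^esub> z =
       x \<otimes>\<^bsub>unitary_group d\<^esub> (y \<otimes>\<^bsub>unitary_group d\<^esub> z)"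
    by (simp add: MM_assoc[of _ d])
next
  fix x assume "x \<in> UU d"
  then show "\<exists>y\<in>UU d. y \<otimes>\<^bsub>unitary_group d\<^esub> x = \<one>\<^bsub>unitary_group d\<^esub>"
    by (intro bexI[of _ "adj x"]) (auto simp: UU_iff)
qed auto

lemma inv_unitary_group: "A \<in> UU d \<Longrightarrow> inv\<^bsub>unitary_group d\<^esub> A = adj A"
  by (rule group.inv_equality[OF group_unitary_group]) (auto simp: UU_iff)

section \<open>The Hilbert-Schmidt distance as a normalised Euclidean distance of entries\<close>

abbreviation sqdist :: "nat \<Rightarrow> complex mat \<Rightarrow> complex mat \<Rightarrow> real" where
  "sqdist d A B \<equiv> \<Sum>i<d. \<Sum>j<d. (cmod (A $$ (i,j) - B $$ (i,j)))\<^sup>2"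

lemma hs_dist_sqrt:
  assumes "A \<in> MM d" "B \<in> MM d"
  shows "hs_dist d A B = sqrt (sqdist d A B / d)"
proof -
  have C: "A - B \<in> MM d" using assms by auto
  have "Re (mat_trace (adj (A - B) * (A - B))) = (\<Sum>j<d. \<Sum>i<d. (cmod (A $$ (i,j) - B $$ (i,j)))\<^sup>2)"
  proof -
    have "Re ((adj (A - B) * (A - B)) $$ (j, j)) = (\<Sum>i<d. (cmod (A $$ (i,j) - B $$ (i,j)))\<^sup>2)"
      if "j < d" for j
    proof -
      have "(adj (A - B) * (A - B)) $$ (j, j) = (\<Sum>i<d. adj (A - B) $$ (j, i) * (A - B) $$ (i, j))"
        using C that by (intro mult_index) auto
      also have "\<dots> = (\<Sum>i<d. complex_of_real ((cmod (A $$ (i,j) - B $$ (i,j)))\<^sup>2))"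
        using assms that by (intro sum.cong refl) (simp add: complex_norm_square mult.commute del: of_real_power)
      finally show ?thesis by simp
    qed
    then show ?thesis using C by (auto simp: mat_trace_def)
  qed
  also have "\<dots> = sqdist d A B"
    by (rule sum.swap)
  finally show ?thesis by (simp add: hs_dist_def)
qed

lemma hs_dist_sq:
  assumes "A \<in> MM d" "B \<in> MM d"
  shows "(hs_dist d A B)\<^sup>2 = sqdist d A B / d"
  unfolding hs_dist_sqrt[OF assms] by (simp add: sum_nonneg)

lemma hs_dist_nonneg: "A \<in> MM d \<Longrightarrow> B \<in> MM d \<Longrightarrow> 0 \<le> hs_dist d A B"
  by (simp add: hs_dist_sqrt sum_nonneg)

lemma hs_dist_refl [simp]: "A \<in> MM d \<Longrightarrow> hs_dist d A A = 0"
  by (simp add: hs_dist_sqrt)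

lemma hs_dist_commute: "A \<in> MM d \<Longrightarrow> B \<in> MM d \<Longrightarrow> hs_dist d A B = hs_dist d B A"
  by (simp add: hs_dist_sqrt norm_minus_commute)

lemma hs_dist_L2:
  assumes "A \<in> MM d" "B \<in> MM d"
  shows "hs_dist d A B = L2_set (\<lambda>(i,j). cmod (A $$ (i,j) - B $$ (i,j))) ({..<d} \<times> {..<d}) / sqrt d"
  unfolding hs_dist_sqrt[OF assms] L2_set_def
  by (simp add: real_sqrt_divide sum.cartesian_product case_prod_unfold)

lemma hs_dist_triangle:
  assumes "A \<in> MM d" "B \<in> MM d" "C \<in> MM d"
  shows "hs_dist d A C \<le> hs_dist d A B + hs_dist d B C"
proof -
  let ?I = "{..<d} \<times> {..<d}"
  have "L2_set (\<lambda>(i,j). cmod (A $$ (i,j) - C $$ (i,j))) ?I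
     \<le> L2_set (\<lambda>x. (\<lambda>(i,j). cmod (A $$ (i,j) - B $$ (i,j))) x + (\<lambda>(i,j). cmod (B $$ (i,j) - C $$ (i,j))) x) ?I"
    by (rule L2_set_mono) (auto simp: dist_triangle simp flip: dist_norm)
  also have "\<dots> \<le> L2_set (\<lambda>(i,j). cmod (A $$ (i,j) - B $$ (i,j))) ?I +
                L2_set (\<lambda>(i,j). cmod (B $$ (i,j) - C $$ (i,j))) ?I"
    by (rule L2_set_triangle_ineq)
  finally show ?thesis
    using assms by (simp add: hs_dist_L2 add_divide_distrib[symmetric] divide_right_mono)
qed

lemma hs_dist_left:
  assumes "U \<in> UU d" "A \<in> MM d" "B \<in> MM d"
  shows "hs_dist d (U * A) (U * B) = hs_dist d A B"
proof -
  have M: "U \<in> MM d" "A - B \<in> MM d" using assms by auto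
  have "U * A - U * B = U * (A - B)" using assms M by (simp add: mult_minus_distrib_mat[of _ d d])
  moreover have "adj (U * (A - B)) * (U * (A - B)) = adj (A - B) * (adj U * (U * (A - B)))"
    using M by (simp add: MM_adj_mult[of _ d] MM_assoc[of _ d])
  ultimately show ?thesis using UU_cancel(1)[OF assms(1) M(2)] by (simp add: hs_dist_def)
qed

lemma hs_dist_adj:
  assumes "A \<in> MM d" "B \<in> MM d"
  shows "hs_dist d (adj A) (adj B) = hs_dist d A B"
proof -
  have "sqdist d (adj A) (adj B) =
        (\<Sum>i<d. \<Sum>j<d. (cmod (A $$ (j,i) - B $$ (j,i)))\<^sup>2)"
    using assms by (intro sum.cong refl) (auto simp flip: complex_cnj_diff)
  also have "\<dots> = (\<Sum>j<d. \<Sum>i<d. (cmod (A $$ (j,i) - B $$ (j,i)))\<^sup>2)" by (rule sum.swap)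
  finally show ?thesis using assms by (simp add: hs_dist_sqrt)
qed

lemma hs_dist_right:
  assumes "U \<in> UU d" "A \<in> MM d" "B \<in> MM d"
  shows "hs_dist d (A * U) (B * U) = hs_dist d A B"
proof -
  have "hs_dist d (A * U) (B * U) = hs_dist d (adj U * adj A) (adj U * adj B)"
    using assms hs_dist_adj[of "A * U" d "B * U"] by (simp add: MM_adj_mult[of _ d])
  then show ?thesis using assms by (simp add: hs_dist_left hs_dist_adj)
qed

text \<open>Insert \<open>A' * B\<close> and use invariance under multiplication by the unitaries
  \<open>B\<close> on the right and \<open>A'\<close> on the left.\<close>

lemma hs_dist_mult:
  assumes "A \<in> MM d" "A' \<in> UU d" "B \<in> UU d" "B' \<in> MM d"
  shows "hs_dist d (A * B) (A' * B') \<le> hs_dist d A A' + hs_dist d B B'"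
proof -
  have "hs_dist d (A * B) (A' * B') \<le> hs_dist d (A * B) (A' * B) + hs_dist d (A' * B) (A' * B')"
    using assms by (intro hs_dist_triangle) auto
  then show ?thesis using assms by (simp add: hs_dist_left hs_dist_right)
qed

section \<open>Change of orthonormal basis\<close>

definition uconj :: "complex mat \<Rightarrow> complex mat \<Rightarrow> complex mat" where
  "uconj V A = V * A * adj V"

lemma uconj_MM [simp]: "V \<in> MM d \<Longrightarrow> A \<in> MM d \<Longrightarrow> uconj V A \<in> MM d"
  by (auto simp: uconj_def)

lemma uconj_UU [simp]: "V \<in> UU d \<Longrightarrow> A \<in> UU d \<Longrightarrow> uconj V A \<in> UU d"
  by (auto simp: uconj_def)

lemma hs_dist_uconj: "V \<in> UU d \<Longrightarrow> A \<in> MM d \<Longrightarrow> B \<in> MM d \<Longrightarrow>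
    hs_dist d (uconj V A) (uconj V B) = hs_dist d A B"
  by (simp add: uconj_def hs_dist_left hs_dist_right mult_carrier_mat[of _ d d])

lemma uconj_mult:
  assumes "V \<in> UU d" "A \<in> MM d" "B \<in> MM d"
  shows "uconj V (A * B) = uconj V A * uconj V B"
proof -
  have M: "V \<in> MM d" "adj V \<in> MM d" using assms by auto
  have "uconj V A * uconj V B = V * A * (adj V * (V * (B * adj V)))"
    using M assms by (simp add: uconj_def MM_assoc[of _ d])
  then show ?thesis using M assms UU_cancel(1)[OF assms(1), of "B * adj V"]
    by (simp add: uconj_def MM_assoc[of _ d])
qed

lemma uconj_uconj: "V \<in> MM d \<Longrightarrow> W \<in> MM d \<Longrightarrow> A \<in> MM d \<Longrightarrow> uconj (V * W) A = uconj V (uconj W A)"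
  by (simp add: uconj_def MM_assoc[of _ d] MM_adj_mult[of _ d])

lemma uconj_one [simp]: "A \<in> MM d \<Longrightarrow> uconj (1\<^sub>m d) A = A"
  by (simp add: uconj_def)

lemma uconj_adj_cancel:
  assumes "V \<in> UU d" "A \<in> MM d"
  shows "uconj V (uconj (adj V) A) = A" "uconj (adj V) (uconj V A) = A"
proof -
  have M: "V \<in> MM d" "adj V \<in> MM d" "V * adj V = 1\<^sub>m d" "adj V * V = 1\<^sub>m d"
    using assms by (auto simp: UU_iff)
  show "uconj V (uconj (adj V) A) = A" "uconj (adj V) (uconj V A) = A"
    using uconj_uconj[OF M(1,2) assms(2)] uconj_uconj[OF M(2,1) assms(2)] M(3,4) assms(2) by simp_all
qed

lemma uconj_adjoint: "V \<in> MM d \<Longrightarrow> A \<in> MM d \<Longrightarrow> uconj V (adj A) = adj (uconj V A)"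
  by (simp add: uconj_def MM_adj_mult[of _ d] MM_assoc[of _ d])

section \<open>Diagonal matrices; rows and columns of unitaries\<close>

definition dg :: "nat \<Rightarrow> (nat \<Rightarrow> complex) \<Rightarrow> complex mat" where
  "dg d f = mat d d (\<lambda>(i, j). if i = j then f i else 0)"

lemma dg_MM [simp]: "dg d f \<in> MM d"
  by (simp add: dg_def)

lemma dg_dim [simp]: "dim_row (dg d f) = d" "dim_col (dg d f) = d"
  by (simp_all add: dg_def)

lemma dg_index [simp]: "i < d \<Longrightarrow> j < d \<Longrightarrow> dg d f $$ (i, j) = (if i = j then f i else 0)"
  by (simp add: dg_def)

lemma dg_cong: "(\<And>i. i < d \<Longrightarrow> f i = g i) \<Longrightarrow> dg d f = dg d g"
  by (rule eq_matI) auto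

lemma dg_mult_left: "A \<in> MM d \<Longrightarrow> i < d \<Longrightarrow> j < d \<Longrightarrow> (dg d f * A) $$ (i, j) = f i * A $$ (i, j)"
  by (subst mult_index[of _ d d _ d]) (auto simp: if_distrib[of "\<lambda>x. x * _"] sum.delta cong: if_cong)

lemma dg_mult_right: "A \<in> MM d \<Longrightarrow> i < d \<Longrightarrow> j < d \<Longrightarrow> (A * dg d f) $$ (i, j) = A $$ (i, j) * f j"
  by (subst mult_index[of _ d d _ d]) (auto simp: if_distrib[of "\<lambda>x. _ * x"] sum.delta' cong: if_cong)

lemma dg_mult: "dg d f * dg d g = dg d (\<lambda>i. f i * g i)"
  by (rule eq_matI) (auto simp: dg_mult_left simp del: index_mult_mat(1))

lemma adj_dg: "adj (dg d f) = dg d (\<lambda>i. cnj (f i))"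
  by (rule eq_matI) auto

lemma dg_one: "dg d (\<lambda>_. 1) = 1\<^sub>m d"
  by (rule eq_matI) auto

lemma dg_UU: "(\<And>i. i < d \<Longrightarrow> cmod (f i) = 1) \<Longrightarrow> dg d f \<in> UU d"
proof (rule UU_I)
  assume *: "\<And>i. i < d \<Longrightarrow> cmod (f i) = 1"
  have "cnj (f i) * f i = 1" if "i < d" for i
    using *[OF that] complex_norm_square[of "f i"] by (simp add: mult.commute)
  then show "adj (dg d f) * dg d f = 1\<^sub>m d"
    by (auto simp: adj_dg dg_mult dg_one[symmetric] intro!: dg_cong)
qed auto

lemma uconj_dg_eq_iff:
  assumes "V \<in> UU d" "A \<in> MM d"
  shows "A = uconj V (dg d f) \<longleftrightarrow> A * V = V * dg d f"
proof
  assume "A = uconj V (dg d f)"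
  then show "A * V = V * dg d f"
    using assms UU_cancel(4)[OF assms(1), of "V * dg d f"] by (simp add: uconj_def)
next
  assume "A * V = V * dg d f"
  then have "A * V * adj V = uconj V (dg d f)" by (simp add: uconj_def)
  then show "A = uconj V (dg d f)" using UU_cancel(3)[OF assms] by simp
qed

lemma UU_col_norm:
  assumes "U \<in> UU d" "k < d"
  shows "(\<Sum>j<d. (cmod (U $$ (j, k)))\<^sup>2) = 1"
proof -
  have "(adj U * U) $$ (k, k) = (\<Sum>j<d. adj U $$ (k, j) * U $$ (j, k))"
    using assms by (intro mult_index[of _ d d _ d]) auto
  also have "\<dots> = (\<Sum>j<d. complex_of_real ((cmod (U $$ (j, k)))\<^sup>2))"
    using assms UU_MM[OF assms(1)] by (intro sum.cong refl) (auto simp: complex_norm_square mult.commute simp del: of_real_power)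
  finally have "complex_of_real (\<Sum>j<d. (cmod (U $$ (j, k)))\<^sup>2) = complex_of_real 1"
    using assms by (simp add: UU_iff)
  then show ?thesis by (simp only: of_real_eq_iff)
qed

lemma UU_row_norm:
  assumes "U \<in> UU d" "j < d"
  shows "(\<Sum>k<d. (cmod (U $$ (j, k)))\<^sup>2) = 1"
  using UU_col_norm[OF UU_adj[OF assms(1)] assms(2)] assms UU_MM[OF assms(1)] by simp

lemma UU_entry_le:
  assumes "U \<in> UU d" "j < d" "k < d"
  shows "cmod (U $$ (j, k)) \<le> 1"
proof -
  have "(cmod (U $$ (j, k)))\<^sup>2 \<le> (\<Sum>j<d. (cmod (U $$ (j, k)))\<^sup>2)"
    using assms by (intro member_le_sum) auto
  then have "(cmod (U $$ (j, k)))\<^sup>2 \<le> 1\<^sup>2" using UU_col_norm assms by simp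
  then show ?thesis by (rule power2_le_imp_le) simp
qed

section \<open>Spectral theorem and polar decomposition\<close>

text \<open>Complete \<open>v\<close> to a basis, orthogonalise by Gram-Schmidt, which keeps the
  first vector, and normalise the columns. The factor \<open>c\<close> is the reciprocal of the
  length of \<open>v\<close>.\<close>

lemma unitary_completion:
  fixes v :: "complex vec"
  assumes v: "v \<in> carrier_vec n" "v \<noteq> 0\<^sub>v n"
  obtains W c where "W \<in> UU n" "\<And>i. i < n \<Longrightarrow> W $$ (i, 0) = c * v $ i"
proof -
  interpret cof_vec_space n "TYPE(complex)" .
  have n: "n > 0" using v by (cases n) auto
  define b where "b = basis_completion v"
  note bc = basis_completion[OF v, folded b_def]
  define ws where "ws = gram_schmidt n b"
  note gs = gram_schmidt_result[OF bc(2,4,5) ws_def]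
  have len: "length ws = n" using gs(4) bc(6) by simp
  obtain bs where b: "b = v # bs" using bc(6,7) n by (cases b) auto
  have ws0: "ws ! 0 = v"
    using gram_schmidt_hd[OF v(1), of bs] len n unfolding ws_def b
    by (cases "gram_schmidt n (v # bs)") auto
  define w where "w k = ws ! k" for k
  have w: "w k \<in> carrier_vec n" if "k < n" for k
    using gs(3) len that by (auto simp: w_def)
  have sp: "(\<Sum>k<n. cnj (w i $ k) * w j $ k) = 0 \<longleftrightarrow> i \<noteq> j" if "i < n" "j < n" for i j
  proof -
    have "w j \<bullet>c w i = (\<Sum>k<n. cnj (w i $ k) * w j $ k)"
      using w[OF that(1)] w[OF that(2)] by (simp add: scalar_prod_def atLeast0LessThan mult.commute)
    then show ?thesis using corthogonalD[OF gs(2), of j i] that len by (auto simp: w_def)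
  qed
  define r where "r j = (\<Sum>k<n. (cmod (w j $ k))\<^sup>2)" for j
  have r: "complex_of_real (r j) = (\<Sum>k<n. cnj (w j $ k) * w j $ k)" for j
    unfolding r_def of_real_sum
    by (intro sum.cong refl) (simp add: complex_norm_square mult.commute del: of_real_power)
  have rpos: "r j > 0" if "j < n" for j
  proof -
    have "r j \<noteq> 0" using r[of j] sp[OF that that] by auto
    then show ?thesis unfolding r_def by (simp add: less_le sum_nonneg)
  qed
  define W where "W = mat n n (\<lambda>(i, j). w j $ i / sqrt (r j))"
  have "W \<in> UU n"
  proof (rule UU_I)
    show WM: "W \<in> MM n" by (simp add: W_def)
    show "adj W * W = 1\<^sub>m n"
    proof (rule eq_matI)
      fix i j assume "i < dim_row (1\<^sub>m n :: complex mat)" "j < dim_col (1\<^sub>m n :: complex mat)"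
      then have ij: "i < n" "j < n" by auto
      have "(adj W * W) $$ (i, j) = (\<Sum>k<n. adj W $$ (i, k) * W $$ (k, j))"
        using WM ij by (intro mult_index[of _ n n _ n]) auto
      also have "\<dots> = (\<Sum>k<n. cnj (w i $ k) * w j $ k / (sqrt (r i) * sqrt (r j)))"
        using ij WM by (intro sum.cong refl) (auto simp: W_def)
      also have "\<dots> = (\<Sum>k<n. cnj (w i $ k) * w j $ k) / (sqrt (r i) * sqrt (r j))"
        by (simp add: sum_divide_distrib)
      also have "\<dots> = (if i = j then 1 else 0)"
        using sp[OF ij] rpos[OF ij(1)] r[of i, symmetric] by (auto simp flip: of_real_mult)
      finally show "(adj W * W) $$ (i, j) = 1\<^sub>m n $$ (i, j)" using ij by simp
    qed (use WM in auto)
  qed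
  moreover have "W $$ (i, 0) = 1 / sqrt (r 0) * v $ i" if "i < n" for i
    using that n ws0 by (simp add: W_def w_def)
  ultimately show ?thesis using that by blast
qed

text \<open>Deflation: in a basis that starts with an eigenvector, the first column of the Hermitian
  matrix \<open>B\<close> is a multiple of the first unit vector, so by symmetry its first row is
  too and the eigenvalue is real. The induction hypothesis treats the remaining block
  \<open>B3\<close>.\<close>

lemma spectral_theorem:
  assumes "A \<in> MM d" "adj A = A"
  shows "\<exists>V\<in>UU d. \<exists>h :: nat \<Rightarrow> real. A * V = V * dg d (\<lambda>i. of_real (h i))"
  using assms
proof (induction d arbitrary: A)
  case 0
  then show ?case by (intro bexI[of _ "1\<^sub>m 0"] exI[of _ "\<lambda>_. 0"]) (auto intro!: eq_matI)
next
  case (Suc n)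
  note A = Suc.prems(1)
  obtain e where "e \<in> spectrum A" using spectrum_non_empty[OF A] by auto
  then obtain v where v: "v \<in> carrier_vec (Suc n)" "v \<noteq> 0\<^sub>v (Suc n)" "A *\<^sub>v v = e \<cdot>\<^sub>v v"
    using A by (auto simp: spectrum_def eigenvalue_def eigenvector_def)
  obtain W c where W: "W \<in> UU (Suc n)" and Wc: "\<And>i. i < Suc n \<Longrightarrow> W $$ (i, 0) = c * v $ i"
    using unitary_completion[OF v(1,2)] by metis
  have WM: "W \<in> MM (Suc n)" using W by simp
  define B where "B = adj W * (A * W)"
  have BM: "B \<in> MM (Suc n)" using A WM by (simp add: B_def)
  have Bh: "adj B = B"
    unfolding B_def using A WM Suc.prems(2) by (simp add: MM_adj_mult[of _ "Suc n"] MM_assoc[of _ "Suc n"])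
  have Bherm: "B $$ (i, j) = cnj (B $$ (j, i))" if "i < Suc n" "j < Suc n" for i j
    using adj_index[of i B j] Bh BM that by auto
  have AW: "A * W = W * B" using UU_cancel(2)[OF W, of "A * W"] A WM by (simp add: B_def)
  have AW0: "(A * W) $$ (k, 0) = e * W $$ (k, 0)" if "k < Suc n" for k
  proof -
    have "(A * W) $$ (k, 0) = (\<Sum>l<Suc n. A $$ (k, l) * W $$ (l, 0))"
      using A WM that by (intro mult_index[of _ "Suc n" "Suc n" _ "Suc n"]) auto
    also have "\<dots> = (\<Sum>l<Suc n. c * (A $$ (k, l) * v $ l))"
      by (intro sum.cong refl) (simp add: Wc)
    also have "\<dots> = c * (A *\<^sub>v v) $ k"
    proof -
      have "(A *\<^sub>v v) $ k = (\<Sum>l<Suc n. A $$ (k, l) * v $ l)"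
        using A v(1) that by (simp add: scalar_prod_def atLeast0LessThan del: sum.lessThan_Suc sum.op_ivl_Suc)
      then show ?thesis by (simp only: sum_distrib_left)
    qed
    finally show ?thesis using v that by (simp add: Wc)
  qed
  have B0: "B $$ (i, 0) = (if i = 0 then e else 0)" if "i < Suc n" for i
  proof -
    have "B $$ (i, 0) = (\<Sum>k<Suc n. adj W $$ (i, k) * (A * W) $$ (k, 0))"
      unfolding B_def using A WM that by (intro mult_index[of _ "Suc n" "Suc n" _ "Suc n"]) auto
    also have "\<dots> = e * (\<Sum>k<Suc n. adj W $$ (i, k) * W $$ (k, 0))"
      unfolding sum_distrib_left by (intro sum.cong refl) (simp only: AW0 lessThan_iff mult_ac)
    also have "(\<Sum>k<Suc n. adj W $$ (i, k) * W $$ (k, 0)) = (adj W * W) $$ (i, 0)"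
      using WM that by (intro mult_index[of _ "Suc n" "Suc n" _ "Suc n", symmetric]) auto
    finally show ?thesis using W that by (simp add: UU_iff)
  qed
  have B0': "B $$ (0, i) = (if i = 0 then e else 0)" if "i < Suc n" for i
    using Bherm[of 0 i] B0[OF that] Bherm[of 0 0] B0[of 0] that by (auto split: if_splits)
  have e: "e = of_real (Re e)"
    using Bherm[of 0 0] B0[of 0] by (simp add: complex_eq_iff)
  define B3 where "B3 = mat n n (\<lambda>(i, j). B $$ (Suc i, Suc j))"
  have B3: "B3 \<in> MM n" "adj B3 = B3"
  proof -
    show "B3 \<in> MM n" by (simp add: B3_def)
    show "adj B3 = B3"
    proof (rule eq_matI)
      fix i j assume "i < dim_row B3" "j < dim_col B3"
      then show "adj B3 $$ (i, j) = B3 $$ (i, j)"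
        using Bherm[of "Suc i" "Suc j"] by (simp add: B3_def)
    qed (simp_all add: B3_def)
  qed
  obtain V3 h3 where V3: "V3 \<in> UU n" and h3: "B3 * V3 = V3 * dg n (\<lambda>i. of_real (h3 i))"
    using Suc.IH[OF B3] by blast
  have V3M: "V3 \<in> MM n" using V3 by simp
  define V2 where "V2 = mat (Suc n) (Suc n) (\<lambda>(i, j). case i of 0 \<Rightarrow> (if j = 0 then 1 else 0)
      | Suc i' \<Rightarrow> (case j of 0 \<Rightarrow> 0 | Suc j' \<Rightarrow> V3 $$ (i', j')))"
  have V2M: "V2 \<in> MM (Suc n)" by (simp add: V2_def)
  have V2i: "V2 $$ (0, 0) = 1" "j < n \<Longrightarrow> V2 $$ (0, Suc j) = 0" "j < n \<Longrightarrow> V2 $$ (Suc j, 0) = 0"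
      "i < n \<Longrightarrow> j < n \<Longrightarrow> V2 $$ (Suc i, Suc j) = V3 $$ (i, j)" for i j
    by (auto simp: V2_def)
  define h where "h i = (case i of 0 \<Rightarrow> Re e | Suc i' \<Rightarrow> h3 i')" for i
  have V2: "V2 \<in> UU (Suc n)"
  proof (rule UU_I[OF V2M])
    show "adj V2 * V2 = 1\<^sub>m (Suc n)"
    proof (rule eq_matI)
      fix i j assume "i < dim_row (1\<^sub>m (Suc n) :: complex mat)" "j < dim_col (1\<^sub>m (Suc n) :: complex mat)"
      then have ij: "i < Suc n" "j < Suc n" by auto
      have "(adj V2 * V2) $$ (i, j) = (\<Sum>k<Suc n. adj V2 $$ (i, k) * V2 $$ (k, j))"
        using V2M ij by (intro mult_index[of _ "Suc n" "Suc n" _ "Suc n"]) auto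
      also have "\<dots> = (\<Sum>k<Suc n. cnj (V2 $$ (k, i)) * V2 $$ (k, j))"
        using V2M ij by (intro sum.cong refl) auto
      also have "\<dots> = cnj (V2 $$ (0, i)) * V2 $$ (0, j) + (\<Sum>k<n. cnj (V2 $$ (Suc k, i)) * V2 $$ (Suc k, j))"
        by (rule sum.lessThan_Suc_shift)
      also have "\<dots> = (if i = j then 1 else 0)"
      proof (cases i; cases j)
        fix i' j' assume [simp]: "i = Suc i'" "j = Suc j'"
        have ij': "i' < n" "j' < n" using ij by auto
        have "(\<Sum>k<n. cnj (V2 $$ (Suc k, i)) * V2 $$ (Suc k, j)) = (\<Sum>k<n. adj V3 $$ (i', k) * V3 $$ (k, j'))"
          using ij' V3M by (intro sum.cong refl) (auto simp: V2i)
        also have "\<dots> = (adj V3 * V3) $$ (i', j')"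
          using ij' V3M by (intro mult_index[of _ n n _ n, symmetric]) auto
        finally show ?thesis using V3 ij' by (auto simp: V2i UU_iff)
      qed (use ij in \<open>auto simp: V2i\<close>)
      finally show "(adj V2 * V2) $$ (i, j) = 1\<^sub>m (Suc n) $$ (i, j)" using ij by simp
    qed (use V2M in auto)
  qed
  have BV: "B * V2 = V2 * dg (Suc n) (\<lambda>i. of_real (h i))"
  proof (rule eq_matI)
    fix i j assume "i < dim_row (V2 * dg (Suc n) (\<lambda>i. of_real (h i)))"
        "j < dim_col (V2 * dg (Suc n) (\<lambda>i. of_real (h i)))"
    then have ij: "i < Suc n" "j < Suc n" using V2M by auto
    have "(B * V2) $$ (i, j) = (\<Sum>k<Suc n. B $$ (i, k) * V2 $$ (k, j))"
      using V2M BM ij by (intro mult_index[of _ "Suc n" "Suc n" _ "Suc n"]) auto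
    also have "\<dots> = B $$ (i, 0) * V2 $$ (0, j) + (\<Sum>k<n. B $$ (i, Suc k) * V2 $$ (Suc k, j))"
      by (rule sum.lessThan_Suc_shift)
    also have "\<dots> = V2 $$ (i, j) * of_real (h j)"
    proof (cases i; cases j)
      fix i' j' assume [simp]: "i = Suc i'" "j = Suc j'"
      have ij': "i' < n" "j' < n" using ij by auto
      have "(\<Sum>k<n. B $$ (i, Suc k) * V2 $$ (Suc k, j)) = (\<Sum>k<n. B3 $$ (i', k) * V3 $$ (k, j'))"
        using ij' V3M by (intro sum.cong refl) (auto simp: V2i B3_def)
      also have "\<dots> = (B3 * V3) $$ (i', j')"
        using ij' V3M B3 by (intro mult_index[of _ n n _ n, symmetric]) auto
      also have "\<dots> = V3 $$ (i', j') * of_real (h3 j')"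
        unfolding h3 using ij' V3M by (intro dg_mult_right) auto
      finally show ?thesis using ij' by (simp add: V2i h_def)
    qed (use ij e B0 B0' in \<open>auto simp: V2i h_def\<close>)
    also have "\<dots> = (V2 * dg (Suc n) (\<lambda>i. of_real (h i))) $$ (i, j)"
      using ij V2M by (intro dg_mult_right[symmetric]) auto
    finally show "(B * V2) $$ (i, j) = (V2 * dg (Suc n) (\<lambda>i. of_real (h i))) $$ (i, j)" .
  qed (use BM V2M in auto)
  have "A * (W * V2) = W * (B * V2)"
    using MM_assoc[OF A WM V2M] MM_assoc[OF WM BM V2M] AW by simp
  also have "\<dots> = (W * V2) * dg (Suc n) (\<lambda>i. of_real (h i))"
    unfolding BV by (rule MM_assoc[OF WM V2M, symmetric]) simp
  finally show ?case using W V2 UU_mult by blast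
qed

text \<open>A row of a unitary has norm 1 and its diagonal entry has modulus at most 1, so its
  squared distance from \<open>h i\<close> times a unit vector is at least
  \<open>1 - 2 * \<bar>h i\<bar> + (h i)\<^sup>2\<close>. The sign \<open>s i\<close> attains this
  in every row.\<close>

lemma hs_dist_dg_best:
  fixes s h :: "nat \<Rightarrow> real"
  assumes W: "W \<in> UU d" and s: "\<And>i. i < d \<Longrightarrow> \<bar>s i\<bar> = 1 \<and> s i * h i \<ge> 0"
  shows "hs_dist d (dg d (\<lambda>i. of_real (s i))) (dg d (\<lambda>i. of_real (h i))) \<le>
         hs_dist d W (dg d (\<lambda>i. of_real (h i)))"
proof -
  have row: "(\<Sum>j<d. (cmod (dg d (\<lambda>i. of_real (s i)) $$ (i,j) - dg d (\<lambda>i. of_real (h i)) $$ (i,j)))\<^sup>2) \<le>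
        (\<Sum>j<d. (cmod (W $$ (i,j) - dg d (\<lambda>i. of_real (h i)) $$ (i,j)))\<^sup>2)" (is "?L \<le> ?R") if i: "i < d" for i
  proof -
    have "?L = (\<Sum>j<d. if j = i then (s i - h i)\<^sup>2 else 0)"
      using i by (intro sum.cong refl) (auto simp flip: of_real_diff)
    also have "\<dots> = (s i - h i)\<^sup>2" using i by simp
    also have "\<dots> = 1 - 2 * \<bar>h i\<bar> + (h i)\<^sup>2"
    proof -
      have "\<bar>h i\<bar> = s i * h i" using s[OF i] by (metis abs_mult abs_of_nonneg mult_1)
      moreover have "(s i)\<^sup>2 = 1" using s[OF i] by (metis power2_abs one_power2)
      ultimately show ?thesis by (simp add: power2_diff)
    qed
    finally have L: "?L = 1 - 2 * \<bar>h i\<bar> + (h i)\<^sup>2" .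
    have "?R = (\<Sum>j<d. (cmod (W $$ (i,j)))\<^sup>2 + (if j = i then - 2 * h i * Re (W $$ (i,i)) + (h i)\<^sup>2 else 0))"
      using i by (intro sum.cong refl) (auto simp: cmod_power2 power2_diff algebra_simps)
    also have "\<dots> = 1 + (- 2 * h i * Re (W $$ (i,i)) + (h i)\<^sup>2)"
      using i by (simp add: sum.distrib UU_row_norm[OF W i])
    finally have R: "?R = 1 + (- 2 * h i * Re (W $$ (i,i)) + (h i)\<^sup>2)" .
    have "\<bar>Re (W $$ (i,i))\<bar> \<le> 1" using abs_Re_le_cmod UU_entry_le[OF W i i] order_trans by blast
    then have "\<bar>h i * Re (W $$ (i,i))\<bar> \<le> \<bar>h i\<bar>"
      unfolding abs_mult by (intro mult_left_le) auto
    then show ?thesis unfolding L R by (auto simp: abs_le_iff)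
  qed
  have "sqdist d (dg d (\<lambda>i. of_real (s i))) (dg d (\<lambda>i. of_real (h i))) \<le>
        sqdist d W (dg d (\<lambda>i. of_real (h i)))"
    by (rule sum_mono) (rule row, simp)
  then show ?thesis
    unfolding hs_dist_sqrt[OF dg_MM dg_MM] hs_dist_sqrt[OF UU_MM[OF W] dg_MM]
    by (intro real_sqrt_le_mono divide_right_mono) auto
qed

text \<open>\<open>F\<close> is the inverse square root of \<open>adj Z * Z\<close>, which is
  positive definite because \<open>Z\<close> is invertible. Being a function of that matrix,
  \<open>F\<close> inherits its commutant; this is how block structures survive. The unitary factor
  \<open>Z * F\<close> is the best unitary approximation of \<open>Z\<close>.\<close>

lemma polar_decomposition:
  assumes Z: "Z \<in> MM d" and Y: "Y \<in> MM d" "Y * Z = 1\<^sub>m d"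
  obtains F where "F \<in> MM d" "Z * F \<in> UU d"
    "\<And>C. C \<in> MM d \<Longrightarrow> C * (adj Z * Z) = (adj Z * Z) * C \<Longrightarrow> C * F = F * C"
    "\<And>W. W \<in> UU d \<Longrightarrow> hs_dist d (Z * F) Z \<le> hs_dist d W Z"
proof -
  define H where "H = adj Z * Z"
  have HM: "H \<in> MM d" using Z by (simp add: H_def)
  have "adj H = H" using Z by (simp add: H_def MM_adj_mult[of _ d])
  from spectral_theorem[OF HM this] obtain V h where V: "V \<in> UU d"
      and h: "H * V = V * dg d (\<lambda>i. of_real (h i))" by blast
  have VM: "V \<in> MM d" "adj V \<in> MM d" using V by auto
  have H: "H = uconj V (dg d (\<lambda>i. of_real (h i)))" using uconj_dg_eq_iff[OF V HM] h by simp
  \<comment> \<open>\<open>h i\<close> is the squared length of column \<open>i\<close> of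
    \<open>Z * V\<close>; if it vanished, applying \<open>Y\<close> would make column
    \<open>i\<close> of the unitary \<open>V\<close> vanish.\<close>
  have hpos: "h i > 0" if i: "i < d" for i
  proof -
    have ZV: "Z * V \<in> MM d" using Z VM by simp
    have "adj (Z * V) * (Z * V) = adj V * (H * V)"
      using Z VM by (simp add: H_def MM_adj_mult[of _ d] MM_assoc[of _ d])
    also have "\<dots> = dg d (\<lambda>i. of_real (h i))" unfolding h using UU_cancel(1)[OF V] by simp
    finally have "complex_of_real (h i) = (adj (Z * V) * (Z * V)) $$ (i, i)" using i by simp
    also have "\<dots> = (\<Sum>k<d. adj (Z * V) $$ (i, k) * (Z * V) $$ (k, i))"
      using ZV i by (intro mult_index[of _ d d _ d]) auto
    also have "\<dots> = (\<Sum>k<d. complex_of_real ((cmod ((Z * V) $$ (k, i)))\<^sup>2))"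
      using ZV carrier_matD[OF ZV] i by (intro sum.cong refl)
        (simp add: complex_norm_square mult.commute del: of_real_power index_mult_mat)
    finally have "h i = (\<Sum>k<d. (cmod ((Z * V) $$ (k, i)))\<^sup>2)" by (simp only: of_real_sum[symmetric] of_real_eq_iff)
    moreover have "\<exists>k<d. (Z * V) $$ (k, i) \<noteq> 0"
    proof (rule ccontr)
      assume *: "\<not> (\<exists>k<d. (Z * V) $$ (k, i) \<noteq> 0)"
      have "V $$ (j, i) = 0" if j: "j < d" for j
      proof -
        have "Y * (Z * V) = V" using MM_assoc[OF Y(1) Z VM(1)] Y(2) VM by simp
        then have "V $$ (j, i) = (\<Sum>k<d. Y $$ (j, k) * (Z * V) $$ (k, i))"
          using mult_index[OF Y(1) ZV j i] by simp
        also have "\<dots> = 0" using * by (intro sum.neutral) auto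
        finally show ?thesis .
      qed
      then show False using UU_col_norm[OF V i] by simp
    qed
    ultimately show ?thesis by (auto intro!: sum_pos2)
  qed
  have hne: "h i \<noteq> 0" if "i < d" for i using hpos[OF that] by simp
  define F where "F = uconj V (dg d (\<lambda>i. of_real (1 / sqrt (h i))))"
  define P where "P = uconj V (dg d (\<lambda>i. of_real (sqrt (h i))))"
  have FM: "F \<in> MM d" and PM: "P \<in> MM d" using VM by (simp_all add: F_def P_def)
  have one: "uconj V (1\<^sub>m d) = 1\<^sub>m d" using V VM(1) unfolding uconj_def UU_iff by simp
  have FP: "F * P = 1\<^sub>m d"
  proof -
    have "F * P = uconj V (dg d (\<lambda>i. 1))"
      unfolding F_def P_def using V hne
      by (subst uconj_mult[symmetric]) (auto simp: dg_mult simp flip: of_real_mult intro!: arg_cong[of _ _ "uconj V"] dg_cong)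
    then show ?thesis by (simp add: dg_one one)
  qed
  have Fh: "adj F = F" unfolding F_def using VM by (simp add: uconj_adjoint[symmetric] adj_dg)
  have U: "Z * F \<in> UU d"
  proof (rule UU_I)
    have "adj (Z * F) * (Z * F) = F * (H * F)"
      using Z FM by (simp add: MM_adj_mult[of _ d] MM_assoc[of _ d] Fh H_def)
    also have "\<dots> = uconj V (dg d (\<lambda>i. of_real (1 / sqrt (h i))) * (dg d (\<lambda>i. of_real (h i)) * dg d (\<lambda>i. of_real (1 / sqrt (h i)))))"
      unfolding F_def H using V by (simp add: uconj_mult[of _ d])
    also have "\<dots> = uconj V (dg d (\<lambda>i. 1))"
    proof -
      have "complex_of_real (1 / sqrt (h i)) * (of_real (h i) * of_real (1 / sqrt (h i))) = 1" if "i < d" for i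
      proof -
        have "1 / sqrt (h i) * (h i * (1 / sqrt (h i))) = h i / (sqrt (h i) * sqrt (h i))" by simp
        also have "\<dots> = 1" using hpos[OF that] by simp
        finally show ?thesis by (simp only: of_real_mult[symmetric] of_real_1)
      qed
      then show ?thesis unfolding dg_mult by (intro arg_cong[of _ _ "uconj V"] dg_cong)
    qed
    finally show "adj (Z * F) * (Z * F) = 1\<^sub>m d" by (simp add: dg_one one)
  qed (use Z FM in simp)
  have comm: "C * F = F * C" if C: "C \<in> MM d" and CH: "C * H = H * C" for C
  proof -
    define C' where "C' = uconj (adj V) C"
    have C': "C' \<in> MM d" "C = uconj V C'" using C V by (simp_all add: C'_def uconj_adj_cancel)
    let ?h = "dg d (\<lambda>i. of_real (h i))" and ?f = "dg d (\<lambda>i. of_real (1 / sqrt (h i)))"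
    have "uconj V (C' * ?h) = uconj V (?h * C')"
    proof -
      have "uconj V C' * H = H * uconj V C'" using CH C'(2) by simp
      then show ?thesis unfolding H using V C'(1) by (simp add: uconj_mult[of _ d])
    qed
    then have *: "uconj (adj V) (uconj V (C' * ?h)) = uconj (adj V) (uconj V (?h * C'))" by (rule arg_cong)
    have "C' * ?h \<in> MM d" "?h * C' \<in> MM d" using C'(1) by simp_all
    from uconj_adj_cancel(2)[OF V this(1)] uconj_adj_cancel(2)[OF V this(2)] *
    have "C' * ?h = ?h * C'" by metis
    then have "C' $$ (i, j) * h j = h i * C' $$ (i, j)" if "i < d" "j < d" for i j
      using dg_mult_right[OF C'(1) that] dg_mult_left[OF C'(1) that] by metis
    \<comment> \<open>In the eigenbasis, \<open>C'\<close> joins only indices with equal eigenvalue,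
      so it commutes with every function of the eigenvalues.\<close>
    then have E: "C' $$ (i, j) = 0 \<or> h i = h j" if "i < d" "j < d" for i j
      using that by (metis mult.commute mult_cancel_left of_real_eq_iff)
    have "C' * ?f = ?f * C'"
    proof (rule eq_matI)
      fix i j assume "i < dim_row (?f * C')" "j < dim_col (?f * C')"
      then have ij: "i < d" "j < d" using C'(1) by auto
      show "(C' * ?f) $$ (i, j) = (?f * C') $$ (i, j)"
        using E[OF ij] by (auto simp: dg_mult_right[OF C'(1) ij] dg_mult_left[OF C'(1) ij])
    qed (use C'(1) in auto)
    then have "uconj V C' * F = F * uconj V C'"
      unfolding F_def using V C'(1) by (simp add: uconj_mult[of _ d, symmetric])
    then show ?thesis using C'(2) by simp
  qed
  have ZFP: "Z * F * P = Z" using MM_assoc[OF Z FM PM] FP Z by simp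
  \<comment> \<open>Multiplication by \<open>adj (Z * F)\<close> and the change of basis
    \<open>V\<close> turn the question into the approximation of the positive diagonal matrix of the
    \<open>sqrt (h i)\<close> by unitaries, where the best choice is the identity.\<close>
  have best: "hs_dist d (Z * F) Z \<le> hs_dist d W Z" if W: "W \<in> UU d" for W
  proof -
    have "hs_dist d (Z * F) Z = hs_dist d (Z * F * 1\<^sub>m d) (Z * F * P)" using ZFP UU_MM[OF U] by simp
    also have "\<dots> = hs_dist d (1\<^sub>m d) P" using U PM by (intro hs_dist_left) auto
    also have "\<dots> = hs_dist d (uconj V (dg d (\<lambda>i. of_real 1))) P" using dg_one[of d] one by simp
    also have "\<dots> = hs_dist d (dg d (\<lambda>i. of_real 1)) (dg d (\<lambda>i. of_real (sqrt (h i))))"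
      unfolding P_def using V by (intro hs_dist_uconj) auto
    also have "\<dots> \<le> hs_dist d (uconj (adj V) (adj (Z * F) * W)) (dg d (\<lambda>i. of_real (sqrt (h i))))"
      using V U W hpos less_imp_le by (intro hs_dist_dg_best) auto
    also have "\<dots> = hs_dist d (adj (Z * F) * W) P"
      using hs_dist_uconj[OF V, of "uconj (adj V) (adj (Z * F) * W)" "dg d (\<lambda>i. of_real (sqrt (h i)))"]
        V U W UU_MM[OF W] UU_MM[OF U] by (simp add: uconj_adj_cancel P_def)
    also have "\<dots> = hs_dist d (Z * F * (adj (Z * F) * W)) (Z * F * P)"
      using U W PM UU_MM[OF W] by (intro hs_dist_left[symmetric]) auto
    finally show ?thesis using ZFP UU_cancel(2)[OF U, of W] W by simp
  qed
  show ?thesis using that[OF FM U] comm best unfolding H_def by blast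
qed

text \<open>Adding \<open>\<mu>\<close> to the diagonal fails to give an invertible matrix only if
  \<open>- \<mu>\<close> is one of the finitely many eigenvalues.\<close>

lemma perturb_invertible:
  fixes \<epsilon> :: real
  assumes Z: "Z \<in> MM d" and "\<epsilon> > 0"
  obtains \<mu> Y where "0 < \<mu>" "\<mu> < \<epsilon>" "Y \<in> MM d" "Y * (Z + dg d (\<lambda>_. of_real \<mu>)) = 1\<^sub>m d"
proof -
  let ?B = "(\<lambda>x. - Re x) ` spectrum Z"
  have "finite ?B" using card_finite_spectrum(1)[OF Z] by simp
  then have "infinite ({0<..<\<epsilon>} - ?B)" using assms(2) by simp
  then obtain \<mu> where mu: "0 < \<mu>" "\<mu> < \<epsilon>" "\<mu> \<notin> ?B" by (metis Diff_iff finite.emptyI ex_in_conv greaterThanLessThan_iff)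
  then have "complex_of_real (- \<mu>) \<notin> spectrum Z" by (force simp: image_iff)
  then have "det (char_matrix Z (complex_of_real (- \<mu>))) \<noteq> 0"
    using eigenvalue_det[OF Z] by (auto simp: spectrum_def)
  moreover have "char_matrix Z (complex_of_real (- \<mu>)) = Z + dg d (\<lambda>_. of_real \<mu>)"
    using Z by (auto simp: char_matrix_def intro!: eq_matI)
  moreover have M: "Z + dg d (\<lambda>_. of_real \<mu>) \<in> MM d" using Z by simp
  ultimately have "Z + dg d (\<lambda>_. of_real \<mu>) \<in> Units (ring_mat TYPE(complex) d ())"
    using det_non_zero_imp_unit by metis
  then obtain Y where "Y \<in> MM d" "Y * (Z + dg d (\<lambda>_. of_real \<mu>)) = 1\<^sub>m d"
    by (auto simp: Units_def ring_mat_def)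
  then show ?thesis using that mu by blast
qed

text \<open>Diagonalising \<open>H + c N\<close>, where \<open>N\<close> is diagonal and enumerates the labels, localises every
  eigenvector in a single block once \<open>c\<close> avoids finitely many coincidences of eigenvalues.\<close>
lemma block_diagonalization:
  fixes \<kappa> :: "nat \<Rightarrow> 'a"
  assumes H: "H \<in> MM d" "adj H = H"
    and blk: "\<And>j k. j < d \<Longrightarrow> k < d \<Longrightarrow> H $$ (j, k) \<noteq> 0 \<Longrightarrow> \<kappa> j = \<kappa> k"
  obtains V and h :: "nat \<Rightarrow> real" and \<kappa>' where "V \<in> UU d" "H = uconj V (dg d (\<lambda>i. of_real (h i)))"
    "\<And>j k. j < d \<Longrightarrow> k < d \<Longrightarrow> V $$ (j, k) \<noteq> 0 \<Longrightarrow> \<kappa> j = \<kappa>' k"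
    "\<And>k. k < d \<Longrightarrow> \<kappa>' k \<in> \<kappa> ` {..<d}"
proof -
  define enc :: "'a \<Rightarrow> real" where "enc x = real (to_nat_on (\<kappa> ` {..<d}) x)" for x
  have enc: "enc x = enc y \<Longrightarrow> x = y" if "x \<in> \<kappa> ` {..<d}" "y \<in> \<kappa> ` {..<d}" for x y
    using that by (auto simp: enc_def countable_finite)
  define E where "E = Re ` spectrum H"
  have finE: "finite E" using card_finite_spectrum(1)[OF H(1)] by (simp add: E_def)
  let ?K = "enc ` \<kappa> ` {..<d}"
  \<comment> \<open>Exactly the values of \<open>c\<close> for which two eigenvalues
    \<open>l\<close>, \<open>l'\<close> of \<open>H\<close>, shifted by different codes
    \<open>e\<close>, \<open>e'\<close>, could meet: \<open>l + c * e = l' + c * e'\<close>.\<close>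
  let ?bad = "(\<lambda>(l, l', e, e'). (l - l') / (e' - e)) ` (E \<times> E \<times> ?K \<times> ?K)"
  have "finite ?bad" using finE by auto
  then obtain c where c: "c \<notin> ?bad" by (metis ex_new_if_finite infinite_UNIV_char_0)
  have sep: "x = y" if xy: "x \<in> \<kappa> ` {..<d}" "y \<in> \<kappa> ` {..<d}" and "q - c * enc x \<in> E" "q - c * enc y \<in> E" for x y q
  proof (rule ccontr)
    assume "x \<noteq> y"
    then have ne: "enc x \<noteq> enc y" using enc xy by blast
    then have "c = ((q - c * enc x) - (q - c * enc y)) / (enc y - enc x)" by (simp add: field_simps)
    moreover have "(q - c * enc x, q - c * enc y, enc x, enc y) \<in> E \<times> E \<times> ?K \<times> ?K" using that by auto
    ultimately show False using c by (metis (mono_tags, lifting) case_prod_conv image_eqI)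
  qed
  define Q where "Q = H + dg d (\<lambda>i. of_real (c * enc (\<kappa> i)))"
  have QM: "Q \<in> MM d" using H by (simp add: Q_def)
  have "adj Q = Q" unfolding Q_def using H by (simp add: adj_add[of _ d d] adj_dg)
  from spectral_theorem[OF QM this] obtain V q where V: "V \<in> UU d"
      and QV: "Q * V = V * dg d (\<lambda>i. of_real (q i))" by blast
  have VM: "V \<in> MM d" using V by simp
  have HV: "(\<Sum>k<d. H $$ (i, k) * V $$ (k, j)) = (q j - c * enc (\<kappa> i)) * V $$ (i, j)" if ij: "i < d" "j < d" for i j
  proof -
    have "(Q * V) $$ (i, j) = (H * V + dg d (\<lambda>i. of_real (c * enc (\<kappa> i))) * V) $$ (i, j)"
      unfolding Q_def using H VM by (simp add: add_mult_distrib_mat[of _ d d])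
    also have "\<dots> = (\<Sum>k<d. H $$ (i, k) * V $$ (k, j)) + c * enc (\<kappa> i) * V $$ (i, j)"
      using ij H VM dg_mult_left[OF VM ij] mult_index[OF H(1) VM ij] by (simp del: index_mult_mat(1))
    finally show ?thesis using dg_mult_right[OF VM ij] unfolding QV by (simp add: algebra_simps)
  qed
  have inE: "q j - c * enc (\<kappa> i) \<in> E" if ij: "i < d" "j < d" and nz: "V $$ (i, j) \<noteq> 0" for i j
  proof -
    \<comment> \<open>The part of column \<open>j\<close> of \<open>V\<close> in the block of
      \<open>i\<close>. Since \<open>H\<close> and the added diagonal matrix preserve blocks, this
      part is itself an eigenvector of \<open>H\<close>.\<close>
    define v where "v = vec d (\<lambda>k. if \<kappa> k = \<kappa> i then V $$ (k, j) else 0)"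
    let ?l = "complex_of_real (q j - c * enc (\<kappa> i))"
    have "H *\<^sub>v v = ?l \<cdot>\<^sub>v v"
    proof (rule eq_vecI)
      fix m assume "m < dim_vec (?l \<cdot>\<^sub>v v)"
      then have m: "m < d" by (simp add: v_def)
      have "(H *\<^sub>v v) $ m = (\<Sum>k<d. H $$ (m, k) * (if \<kappa> k = \<kappa> i then V $$ (k, j) else 0))"
        using m H by (simp add: v_def scalar_prod_def atLeast0LessThan)
      also have "\<dots> = (if \<kappa> m = \<kappa> i then (\<Sum>k<d. H $$ (m, k) * V $$ (k, j)) else 0)"
      proof -
        have z: "H $$ (m, k) = 0" if "k < d" "\<kappa> m \<noteq> \<kappa> k" for k using blk[OF m that(1)] that(2) by blast
        show ?thesis by (auto intro!: sum.cong sum.neutral z)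
      qed
      also have "\<dots> = (?l \<cdot>\<^sub>v v) $ m" using HV[OF m ij(2)] m by (auto simp: v_def)
      finally show "(H *\<^sub>v v) $ m = (?l \<cdot>\<^sub>v v) $ m" .
    qed (use H in \<open>auto simp: v_def\<close>)
    moreover have "v \<noteq> 0\<^sub>v d" using ij nz by (auto simp: v_def dest: arg_cong[of _ _ "\<lambda>v. v $ i"])
    moreover have "v \<in> carrier_vec d" by (simp add: v_def)
    ultimately have "?l \<in> spectrum H"
      using H by (auto simp: spectrum_def eigenvalue_def eigenvector_def)
    then have "Re ?l \<in> E" unfolding E_def by blast
    then show ?thesis by simp
  qed
  have "\<exists>i<d. V $$ (i, j) \<noteq> 0" if "j < d" for j
  proof (rule ccontr)
    assume "\<not> ?thesis"
    then have "(\<Sum>i<d. (cmod (V $$ (i, j)))\<^sup>2) = 0" by (intro sum.neutral) auto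
    then show False using UU_col_norm[OF V that] by simp
  qed
  then obtain i where i: "\<And>j. j < d \<Longrightarrow> i j < d \<and> V $$ (i j, j) \<noteq> 0" by metis
  define \<kappa>' where "\<kappa>' j = \<kappa> (i j)" for j
  have loc: "\<kappa> k = \<kappa>' j" if "k < d" "j < d" "V $$ (k, j) \<noteq> 0" for j k
    unfolding \<kappa>'_def using that i[OF that(2)] inE[of k j] inE[of "i j" j] by (intro sep[of _ _ "q j"]) auto
  have "H * V = V * dg d (\<lambda>j. of_real (q j - c * enc (\<kappa>' j)))"
  proof (rule eq_matI)
    fix m j assume "m < dim_row (V * dg d (\<lambda>j. of_real (q j - c * enc (\<kappa>' j))))"
        "j < dim_col (V * dg d (\<lambda>j. of_real (q j - c * enc (\<kappa>' j))))"
    then have mj: "m < d" "j < d" using VM by auto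
    show "(H * V) $$ (m, j) = (V * dg d (\<lambda>j. of_real (q j - c * enc (\<kappa>' j)))) $$ (m, j)"
      unfolding mult_index[OF H(1) VM mj] dg_mult_right[OF VM mj] HV[OF mj]
      using loc[OF mj] by (cases "V $$ (m, j) = 0") auto
  qed (use H VM in auto)
  then have "H = uconj V (dg d (\<lambda>j. of_real (q j - c * enc (\<kappa>' j))))"
    using uconj_dg_eq_iff[OF V H(1)] by simp
  moreover have "\<kappa>' j \<in> \<kappa> ` {..<d}" if "j < d" for j using i[OF that] by (auto simp: \<kappa>'_def)
  ultimately show ?thesis using loc by (intro that[OF V, where h = "\<lambda>j. q j - c * enc (\<kappa>' j)" and \<kappa>' = \<kappa>']) auto
qed

section \<open>Almost commuting almost involutions\<close>

definition lsign :: "'a set \<Rightarrow> 'a \<Rightarrow> real" where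
  "lsign w x = (if x \<in> w then - 1 else 1)"

definition dsign :: "nat \<Rightarrow> (nat \<Rightarrow> 'a set) \<Rightarrow> 'a \<Rightarrow> complex mat" where
  "dsign d l x = dg d (\<lambda>k. of_real (lsign (l k) x))"

lemma lsign_eq_iff: "lsign w x = lsign v y \<longleftrightarrow> (x \<in> w \<longleftrightarrow> y \<in> v)"
  by (simp add: lsign_def)

lemma lsign_diff: "lsign w x \<noteq> lsign v y \<Longrightarrow> (cmod (of_real (lsign w x) - of_real (lsign v y)))\<^sup>2 = 4"
  by (auto simp: lsign_def split: if_splits)

lemma dsign_UU [simp]: "dsign d l x \<in> UU d"
  unfolding dsign_def by (rule dg_UU) (auto simp: lsign_def)

lemma dsign_MM [simp]: "dsign d l x \<in> MM d"
  by (rule UU_MM) simp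

lemma dsign_dim [simp]: "dim_row (dsign d l x) = d" "dim_col (dsign d l x) = d"
  by (simp_all add: dsign_def)

lemma hs_dist_le:
  fixes e :: real
  assumes "A \<in> MM d" "B \<in> MM d" "e \<ge> 0" "d \<ge> 1"
    and "sqdist d A B \<le> e\<^sup>2 * d"
  shows "hs_dist d A B \<le> e"
proof -
  have "(hs_dist d A B)\<^sup>2 \<le> e\<^sup>2"
    unfolding hs_dist_sq[OF assms(1,2)] using assms(4,5) by (simp add: divide_le_eq)
  then show ?thesis using assms(3) by (rule power2_le_imp_le)
qed

text \<open>For \<open>S\<close> in \<open>MM d\<close> with \<open>d \<ge> 1\<close>, this is
  \<open>d\<close> times the squared distance that \<open>S\<close> moves when all its entries
  outside \<open>P\<close> are deleted.\<close>

abbreviation offmass :: "nat \<Rightarrow> (nat \<Rightarrow> nat \<Rightarrow> bool) \<Rightarrow> complex mat \<Rightarrow> real" where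
  "offmass d P S \<equiv> \<Sum>i<d. \<Sum>j<d. if P i j then 0 else (cmod (S $$ (i,j)))\<^sup>2"

lemma hs_dist_sum:
  assumes "A \<in> MM d" "B \<in> MM d" "d \<ge> 1"
  shows "sqdist d A B = (hs_dist d A B)\<^sup>2 * d"
  using assms by (simp add: hs_dist_sq)

text \<open>Entries of \<open>S\<close> that join differently signed indices are magnified by the factor \<open>4\<close> in
  \<open>S D\<^sub>x - D'\<^sub>x S\<close>.\<close>
lemma incompatible_mass:
  fixes e :: real
  assumes S: "S \<in> MM d" and d: "d \<ge> 1" and W: "finite W"
    and e: "\<And>x. x \<in> W \<Longrightarrow> hs_dist d (S * dsign d l x) (dsign d l' (p x) * S) \<le> e"
    and P: "\<And>i j. i < d \<Longrightarrow> j < d \<Longrightarrow> P i j \<or> (\<exists>x\<in>W. lsign (l j) x \<noteq> lsign (l' i) (p x))"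
  shows "offmass d (\<lambda>i j. P i j) S \<le> card W * e\<^sup>2 / 4 * d"
proof -
  let ?g = "\<lambda>x i j. (cmod ((S * dsign d l x) $$ (i,j) - (dsign d l' (p x) * S) $$ (i,j)))\<^sup>2"
  have g: "?g x i j = (cmod (S $$ (i,j)))\<^sup>2 * (cmod (of_real (lsign (l j) x) - of_real (lsign (l' i) (p x))))\<^sup>2"
    if "i < d" "j < d" for x i j
  proof -
    have "(S * dsign d l x) $$ (i,j) - (dsign d l' (p x) * S) $$ (i,j) =
        S $$ (i,j) * (of_real (lsign (l j) x) - of_real (lsign (l' i) (p x)))"
      unfolding dsign_def dg_mult_right[OF S that] dg_mult_left[OF S that] by (simp add: algebra_simps)
    then show ?thesis by (simp only: norm_mult power_mult_distrib)
  qed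
  have "offmass d (\<lambda>i j. P i j) S \<le> (\<Sum>i<d. \<Sum>j<d. \<Sum>x\<in>W. ?g x i j / 4)"
  proof (intro sum_mono)
    fix i j assume "i \<in> {..<d}" "j \<in> {..<d}"
    then have ij: "i < d" "j < d" by auto
    show "(if P i j then 0 else (cmod (S $$ (i,j)))\<^sup>2) \<le> (\<Sum>x\<in>W. ?g x i j / 4)"
    proof (cases "P i j")
      case False
      then obtain x where x: "x \<in> W" "lsign (l j) x \<noteq> lsign (l' i) (p x)" using P[OF ij] by auto
      have "(cmod (S $$ (i,j)))\<^sup>2 = ?g x i j / 4" unfolding g[OF ij] lsign_diff[OF x(2)] by simp
      also have "\<dots> \<le> (\<Sum>x\<in>W. ?g x i j / 4)" using x W by (intro member_le_sum) auto
      finally show ?thesis using False by simp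
    qed (auto intro: sum_nonneg)
  qed
  also have "\<dots> = (\<Sum>x\<in>W. (\<Sum>i<d. \<Sum>j<d. ?g x i j) / 4)"
    unfolding sum_divide_distrib by (subst sum.swap[of _ W], subst sum.swap[of _ W]) (rule refl)
  also have "\<dots> \<le> (\<Sum>x\<in>W. e\<^sup>2 * d / 4)"
  proof (intro sum_mono divide_right_mono)
    fix x assume "x \<in> W"
    have "(\<Sum>i<d. \<Sum>j<d. ?g x i j) = (hs_dist d (S * dsign d l x) (dsign d l' (p x) * S))\<^sup>2 * d"
      using S d by (intro hs_dist_sum) auto
    also have "\<dots> \<le> e\<^sup>2 * d"
      using e[OF \<open>x \<in> W\<close>] S by (intro mult_right_mono power_mono hs_dist_nonneg) auto
    finally show "(\<Sum>i<d. \<Sum>j<d. ?g x i j) \<le> e\<^sup>2 * d" .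
  qed simp
  finally show ?thesis by simp
qed

text \<open>\<open>H\<close> is the mean of \<open>A\<close> and \<open>adj A\<close>, and balls
  around \<open>C\<close> are convex.\<close>

lemma hs_dist_real_part:
  fixes e :: real
  assumes A: "A \<in> MM d" and C: "C \<in> MM d" and "d \<ge> 1" "hs_dist d A C \<le> e" "hs_dist d (adj A) C \<le> e"
  defines "H \<equiv> mat d d (\<lambda>(i, j). (A $$ (i, j) + cnj (A $$ (j, i))) / 2)"
  shows "hs_dist d H C \<le> e"
proof (rule hs_dist_le)
  show "H \<in> MM d" by (simp add: H_def)
  have e: "e \<ge> 0" using hs_dist_nonneg[OF A C] assms(4) by linarith
  then show "0 \<le> e" .
  let ?s = "\<lambda>M. sqdist d M C"
  have "?s H \<le> (\<Sum>i<d. \<Sum>j<d. ((cmod (A $$ (i,j) - C $$ (i,j)))\<^sup>2 + (cmod (adj A $$ (i,j) - C $$ (i,j)))\<^sup>2) / 2)"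
  proof (intro sum_mono)
    fix i j assume "i \<in> {..<d}" "j \<in> {..<d}"
    then have ij: "i < d" "j < d" by auto
    have "H $$ (i, j) = (A $$ (i, j) + adj A $$ (i, j)) / 2" using ij A by (simp add: H_def)
    then have eq: "H $$ (i, j) - C $$ (i, j) = ((A $$ (i,j) - C $$ (i,j)) + (adj A $$ (i,j) - C $$ (i,j))) / 2"
      by (simp add: field_simps)
    have "cmod (H $$ (i, j) - C $$ (i, j)) \<le> (cmod (A $$ (i,j) - C $$ (i,j)) + cmod (adj A $$ (i,j) - C $$ (i,j))) / 2"
      unfolding eq norm_divide norm_numeral by (intro divide_right_mono norm_triangle_ineq) simp
    then have "(cmod (H $$ (i, j) - C $$ (i, j)))\<^sup>2 \<le> ((cmod (A $$ (i,j) - C $$ (i,j)) + cmod (adj A $$ (i,j) - C $$ (i,j))) / 2)\<^sup>2"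
      by (intro power_mono) auto
    also have "\<dots> \<le> ((cmod (A $$ (i,j) - C $$ (i,j)))\<^sup>2 + (cmod (adj A $$ (i,j) - C $$ (i,j)))\<^sup>2) / 2"
    proof -
      have "((a + b) / 2)\<^sup>2 \<le> (a\<^sup>2 + b\<^sup>2) / 2" for a b :: real
        using zero_le_power2[of "a - b"] by (simp add: power2_eq_square field_simps)
      then show ?thesis .
    qed
    finally show "(cmod (H $$ (i, j) - C $$ (i, j)))\<^sup>2 \<le> \<dots>" .
  qed
  also have "\<dots> = (?s A + ?s (adj A)) / 2"
    by (simp add: sum.distrib sum_divide_distrib add_divide_distrib)
  also have "\<dots> \<le> (e\<^sup>2 * d + e\<^sup>2 * d) / 2"
    unfolding hs_dist_sum[OF A C \<open>d \<ge> 1\<close>] hs_dist_sum[OF adj_carrier[OF A] C \<open>d \<ge> 1\<close>]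
    using assms(4,5) A C
    by (intro divide_right_mono add_mono mult_right_mono power_mono hs_dist_nonneg) auto
  finally show "?s H \<le> e\<^sup>2 * d" by (simp add: mult.commute)
qed (use assms in auto)

text \<open>The dimension is quantified inside, so the pair of \<delta> and \<epsilon> works for all
  dimensions at once.\<close>

definition approx_diagonalizable :: "'a set \<Rightarrow> real \<Rightarrow> real \<Rightarrow> bool" where
  "approx_diagonalizable W \<delta> \<epsilon> \<longleftrightarrow> (\<forall>d\<ge>1. \<forall>B.
    (\<forall>x\<in>W. B x \<in> UU d \<and> hs_dist d (B x * B x) (1\<^sub>m d) \<le> \<delta>) \<longrightarrow>
    (\<forall>x\<in>W. \<forall>y\<in>W. hs_dist d (B x * B y) (B y * B x) \<le> \<delta>) \<longrightarrow>
    (\<exists>V\<in>UU d. \<exists>l. (\<forall>k<d. l k \<subseteq> W) \<and> (\<forall>x\<in>W. hs_dist d (B x) (uconj V (dsign d l x)) \<le> \<epsilon>)))"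

lemma approx_diagonalizableD:
  assumes "approx_diagonalizable W \<delta> \<epsilon>" "d \<ge> 1"
    and "\<And>x. x \<in> W \<Longrightarrow> B x \<in> UU d" "\<And>x. x \<in> W \<Longrightarrow> hs_dist d (B x * B x) (1\<^sub>m d) \<le> \<delta>"
    and "\<And>x y. x \<in> W \<Longrightarrow> y \<in> W \<Longrightarrow> hs_dist d (B x * B y) (B y * B x) \<le> \<delta>"
  obtains V l where "V \<in> UU d" "\<And>k. k < d \<Longrightarrow> l k \<subseteq> W"
    "\<And>x. x \<in> W \<Longrightarrow> hs_dist d (B x) (uconj V (dsign d l x)) \<le> \<epsilon>"
proof -
  have "\<exists>V\<in>UU d. \<exists>l. (\<forall>k<d. l k \<subseteq> W) \<and> (\<forall>x\<in>W. hs_dist d (B x) (uconj V (dsign d l x)) \<le> \<epsilon>)"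
    using assms(1)[unfolded approx_diagonalizable_def] assms(2)
    by (elim allE[of _ d] allE[of _ B] impE) (use assms(3-5) in simp_all)
  then show ?thesis using that by blast
qed

text \<open>Induction on the number of matrices. In a basis that nearly diagonalises the old ones,
  the new unitary \<open>T\<close> nearly preserves the blocks of equal labels and is nearly
  self-adjoint. It is cut down to these blocks, replaced by its Hermitian part, diagonalised within
  the blocks, and its eigenvalues are replaced by their signs.\<close>

lemma almost_commuting_involutions:
  assumes "finite W" "\<epsilon> > 0"
  shows "\<exists>\<delta>>0. approx_diagonalizable W \<delta> \<epsilon>"
  using assms
proof (induction W arbitrary: \<epsilon>)
  case empty
  then show ?case by (auto intro!: exI[of _ 1] exI[of _ "\<lambda>_. {}"] UU_one simp: approx_diagonalizable_def)
next
  case (insert y W)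
  show ?case
  proof -
    have eps: "\<epsilon> > 0" by fact
    define c where "c = real (card W) + 1"
    \<comment> \<open>Cutting to blocks costs
      \<open>c * (3 * \<eta> / 2) = 3 * \<epsilon> / 16\<close>, and the failure of \<open>T\<close>
      to be self-adjoint at most \<open>\<eta> \<le> \<epsilon> / 8\<close>. So \<open>H\<close> is
      within \<open>5 * \<epsilon> / 16\<close> of \<open>T\<close>, and the sign matrix, at least
      as near to \<open>H\<close> as \<open>T\<close> is, within twice that of
      \<open>T\<close>.\<close>
    define \<eta> where "\<eta> = \<epsilon> / (8 * c)"
    have c: "c \<ge> 1" by (simp add: c_def)
    have eta: "\<eta> > 0" "\<eta> \<le> \<epsilon> / 8" using eps c mult_left_mono[of 1 c \<epsilon>] by (auto simp: \<eta>_def field_simps)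
    obtain \<delta>' where d': "\<delta>' > 0" and IH: "approx_diagonalizable W \<delta>' \<eta>"
      using insert.IH eta(1) by blast
    define \<delta> where "\<delta> = min \<delta>' \<eta>"
    show "\<exists>\<delta>>0. approx_diagonalizable (insert y W) \<delta> \<epsilon>"
      unfolding approx_diagonalizable_def
    proof (intro exI[of _ \<delta>] conjI allI impI)
      show "\<delta> > 0" using d' eta by (simp add: \<delta>_def)
      fix d :: nat and B assume d: "d \<ge> 1"
        and B1: "\<forall>x\<in>insert y W. B x \<in> UU d \<and> hs_dist d (B x * B x) (1\<^sub>m d) \<le> \<delta>"
        and B2: "\<forall>x\<in>insert y W. \<forall>z\<in>insert y W. hs_dist d (B x * B z) (B z * B x) \<le> \<delta>"
      obtain V l where V: "V \<in> UU d" and l: "\<And>k. k < d \<Longrightarrow> l k \<subseteq> W"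
        and Vl: "\<And>x. x \<in> W \<Longrightarrow> hs_dist d (B x) (uconj V (dsign d l x)) \<le> \<eta>"
        by (rule approx_diagonalizableD[OF IH d, of B]) (use B1 B2 in \<open>auto simp: \<delta>_def\<close>)
      have By: "B y \<in> UU d" using B1 by simp
      define T where "T = uconj (adj V) (B y)"
      have T: "T \<in> UU d" "T \<in> MM d" using V By by (auto simp: T_def)
      have VT: "uconj V T = B y" unfolding T_def using V By by (simp add: uconj_adj_cancel)
      \<comment> \<open>Two errors \<eta> from replacing \<open>B x\<close> by its diagonal model on
        both sides, and one from the commutation of \<open>B x\<close> with
        \<open>B y\<close>.\<close>
      have comm: "hs_dist d (T * dsign d l x) (dsign d l x * T) \<le> 3 * \<eta>" if x: "x \<in> W" for x
      proof -
        let ?C = "uconj V (dsign d l x)"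
        have Bx: "B x \<in> UU d" using B1 x by simp
        have CU: "?C \<in> UU d" using V by simp
        have "hs_dist d (T * dsign d l x) (dsign d l x * T) = hs_dist d (B y * ?C) (?C * B y)"
          using hs_dist_uconj[OF V, of "T * dsign d l x" "dsign d l x * T"] T V VT by (simp add: uconj_mult[of _ d])
        also have "\<dots> \<le> hs_dist d (B y * ?C) (B y * B x) + hs_dist d (B y * B x) (?C * B y)"
          using By Bx CU by (intro hs_dist_triangle) auto
        also have "hs_dist d (B y * B x) (?C * B y) \<le> hs_dist d (B y * B x) (B x * B y) + hs_dist d (B x * B y) (?C * B y)"
          using By Bx CU by (intro hs_dist_triangle) auto
        also have "hs_dist d (B y * ?C) (B y * B x) = hs_dist d (B x) ?C"
          using By Bx CU hs_dist_commute[OF UU_MM[OF Bx] UU_MM[OF CU]] by (simp add: hs_dist_left)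
        also have "hs_dist d (B x * B y) (?C * B y) = hs_dist d (B x) ?C"
          using By Bx CU by (simp add: hs_dist_right)
        also have "hs_dist d (B y * B x) (B x * B y) \<le> \<eta>" using B2 x by (auto simp: \<delta>_def)
        finally show ?thesis using Vl[OF x] by simp
      qed
      define Bp where "Bp = mat d d (\<lambda>(i, j). if l i = l j then T $$ (i, j) else 0)"
      have BpM: "Bp \<in> MM d" by (simp add: Bp_def)
      have BpT: "hs_dist d Bp T \<le> c * (3 * \<eta> / 2)"
      proof (rule hs_dist_le[OF BpM T(2) _ d])
        have "sqdist d Bp T =
              offmass d (\<lambda>i j. l i = l j) T"
          by (intro sum.cong refl) (auto simp: Bp_def)
        also have "\<dots> \<le> card W * (3 * \<eta>)\<^sup>2 / 4 * d"
        proof (rule incompatible_mass[where p = "\<lambda>x. x" and l = l and l' = l, OF T(2) d insert.hyps(1) comm])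
          fix i j assume "i < d" "j < d"
          then show "l i = l j \<or> (\<exists>x\<in>W. lsign (l j) x \<noteq> lsign (l i) x)"
            using l[of i] l[of j] by (auto simp: lsign_eq_iff)
        qed
        also have "\<dots> \<le> (c * (3 * \<eta> / 2))\<^sup>2 * d"
        proof (rule mult_right_mono)
          have "card W \<le> c * c" using c by (simp add: c_def algebra_simps)
          then have "card W * (3 * \<eta> / 2)\<^sup>2 \<le> c * c * (3 * \<eta> / 2)\<^sup>2" by (intro mult_right_mono) auto
          then show "card W * (3 * \<eta>)\<^sup>2 / 4 \<le> (c * (3 * \<eta> / 2))\<^sup>2"
            by (simp add: power_mult_distrib power2_eq_square power_divide mult_ac)
        qed simp
        finally show "sqdist d Bp T \<le> (c * (3 * \<eta> / 2))\<^sup>2 * d" .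
      qed (use c eta in auto)
      have ce: "c * (3 * \<eta> / 2) = 3 * \<epsilon> / 16" using c by (simp add: \<eta>_def)
      have "hs_dist d (adj T) T \<le> \<eta>"
      proof -
        have "hs_dist d (adj T) T = hs_dist d (uconj V (adj T)) (uconj V T)"
          using V T by (intro hs_dist_uconj[symmetric]) auto
        also have "\<dots> = hs_dist d (adj (B y)) (B y)" using VT uconj_adjoint[OF UU_MM[OF V] T(2)] by simp
        also have "\<dots> = hs_dist d (B y * adj (B y)) (B y * B y)" using By by (simp add: hs_dist_left)
        also have "\<dots> = hs_dist d (B y * B y) (1\<^sub>m d)"
          using By by (simp add: UU_iff hs_dist_commute[of _ d])
        finally show ?thesis using B1 by (auto simp: \<delta>_def)
      qed
      moreover have "hs_dist d (adj Bp) T \<le> hs_dist d (adj Bp) (adj T) + hs_dist d (adj T) T"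
        using BpM T by (intro hs_dist_triangle) auto
      ultimately have BpT': "hs_dist d (adj Bp) T \<le> 5 * \<epsilon> / 16"
        using BpT[unfolded ce] eta hs_dist_adj[OF BpM T(2)] by linarith
      define H where "H = mat d d (\<lambda>(i, j). (Bp $$ (i, j) + cnj (Bp $$ (j, i))) / 2)"
      have HM: "H \<in> MM d" by (simp add: H_def)
      have HT: "hs_dist d H T \<le> 5 * \<epsilon> / 16"
        unfolding H_def using BpM T d BpT[unfolded ce] eps BpT' by (intro hs_dist_real_part) auto
      have Hh: "adj H = H" by (rule eq_matI) (auto simp: H_def)
      have blk: "l i = l j" if "i < d" "j < d" "H $$ (i, j) \<noteq> 0" for i j
        using that by (auto simp: H_def Bp_def split: if_splits)
      obtain V' and h :: "nat \<Rightarrow> real" and l' where V': "V' \<in> UU d" "H = uconj V' (dg d (\<lambda>i. of_real (h i)))"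
        and loc: "\<And>j k. j < d \<Longrightarrow> k < d \<Longrightarrow> V' $$ (j, k) \<noteq> 0 \<Longrightarrow> l j = l' k"
        and l': "\<And>k. k < d \<Longrightarrow> l' k \<in> l ` {..<d}"
        by (rule block_diagonalization[of H d l]) (use HM Hh blk in auto)
      define s :: "nat \<Rightarrow> real" where "s i = (if h i < 0 then - 1 else 1)" for i
      \<comment> \<open>The sign of the new matrix is recorded by adding \<open>y\<close> to the
        label inherited from the block.\<close>
      define L where "L k = l' k \<union> (if h k < 0 then {y} else {})" for k
      have l'W: "l' k \<subseteq> W" if "k < d" for k using l'[OF that] l by auto
      have Ly: "dsign d L y = dg d (\<lambda>i. of_real (s i))"
        unfolding dsign_def using l'W insert.hyps(2) by (intro dg_cong) (auto simp: lsign_def L_def s_def)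
      \<comment> \<open>\<open>V'\<close> joins old and new indices only if they carry the same
        subset of \<open>W\<close>, so the sign matrices obtained earlier are not disturbed at
        all.\<close>
      have Lx: "dsign d l x = uconj V' (dsign d L x)" if x: "x \<in> W" for x
        unfolding dsign_def[of d L]
      proof (subst uconj_dg_eq_iff[OF V'(1)], simp, rule eq_matI)
        fix i j assume "i < dim_row (V' * dg d (\<lambda>k. complex_of_real (lsign (L k) x)))"
          "j < dim_col (V' * dg d (\<lambda>k. complex_of_real (lsign (L k) x)))"
        then have ij: "i < d" "j < d" using UU_MM[OF V'(1)] by auto
        have "lsign (L j) x = lsign (l' j) x" using x insert.hyps(2) by (auto simp: lsign_def L_def)
        then show "(dsign d l x * V') $$ (i, j) = (V' * dg d (\<lambda>k. complex_of_real (lsign (L k) x))) $$ (i, j)"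
          unfolding dsign_def dg_mult_left[OF UU_MM[OF V'(1)] ij] dg_mult_right[OF UU_MM[OF V'(1)] ij]
          using loc[OF ij] by (cases "V' $$ (i, j) = 0") auto
      qed (use UU_MM[OF V'(1)] in auto)
      have "hs_dist d (uconj V' (dsign d L y)) H \<le> hs_dist d T H"
      proof -
        have "hs_dist d (uconj V' (dsign d L y)) H = hs_dist d (dg d (\<lambda>i. of_real (s i))) (dg d (\<lambda>i. of_real (h i)))"
          unfolding V'(2) Ly using V' by (intro hs_dist_uconj) auto
        also have "\<dots> \<le> hs_dist d (uconj (adj V') T) (dg d (\<lambda>i. of_real (h i)))"
          using V' T by (intro hs_dist_dg_best) (auto simp: s_def)
        also have "\<dots> = hs_dist d (uconj V' (uconj (adj V') T)) H"
          unfolding V'(2) using V' T by (intro hs_dist_uconj[symmetric]) auto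
        finally show ?thesis using V' T by (simp add: uconj_adj_cancel)
      qed
      moreover have "hs_dist d T (uconj V' (dsign d L y)) \<le> hs_dist d T H + hs_dist d H (uconj V' (dsign d L y))"
        using T HM V' by (intro hs_dist_triangle) auto
      moreover have "hs_dist d H (uconj V' (dsign d L y)) = hs_dist d (uconj V' (dsign d L y)) H"
        "hs_dist d T H = hs_dist d H T"
        using T HM V' by (auto intro!: hs_dist_commute)
      ultimately have TL: "hs_dist d T (uconj V' (dsign d L y)) \<le> \<epsilon>" using HT eps by linarith
      show "\<exists>V\<in>UU d. \<exists>l. (\<forall>k<d. l k \<subseteq> insert y W) \<and> (\<forall>x\<in>insert y W. hs_dist d (B x) (uconj V (dsign d l x)) \<le> \<epsilon>)"
      proof (intro bexI[of _ "V * V'"] exI[of _ L] conjI allI impI ballI)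
        show "V * V' \<in> UU d" using V V' by simp
        show "L k \<subseteq> insert y W" if "k < d" for k using l'W[OF that] by (auto simp: L_def)
        fix x assume "x \<in> insert y W"
        have VV: "uconj (V * V') (dsign d L x) = uconj V (uconj V' (dsign d L x))"
          using V V' by (intro uconj_uconj) auto
        show "hs_dist d (B x) (uconj (V * V') (dsign d L x)) \<le> \<epsilon>"
        proof (cases "x = y")
          case True
          have "hs_dist d (uconj V T) (uconj V (uconj V' (dsign d L y))) = hs_dist d T (uconj V' (dsign d L y))"
            using V V' T by (intro hs_dist_uconj) auto
          then show ?thesis unfolding VV using True TL VT by simp
        next
          case False
          then have "x \<in> W" using \<open>x \<in> insert y W\<close> by simp
          then show ?thesis using Vl[of x] Lx[of x] VV eta eps by auto
        qed
      qed
    qed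
  qed
qed

section \<open>Unitaries that almost preserve a block structure\<close>

definition row_perm :: "nat \<Rightarrow> (nat \<Rightarrow> nat) \<Rightarrow> complex mat \<Rightarrow> complex mat" where
  "row_perm d \<pi> A = mat d d (\<lambda>(i, j). A $$ (\<pi> i, j))"

lemma row_perm_MM [simp]: "row_perm d \<pi> A \<in> MM d"
  by (simp add: row_perm_def)

lemma row_perm_index [simp]: "i < d \<Longrightarrow> j < d \<Longrightarrow> row_perm d \<pi> A $$ (i, j) = A $$ (\<pi> i, j)"
  by (simp add: row_perm_def)

lemma row_perm_UU:
  assumes A: "A \<in> UU d" and p: "bij_betw \<pi> {..<d} {..<d}"
  shows "row_perm d \<pi> A \<in> UU d"
proof (rule UU_I)
  have AM: "A \<in> MM d" using A by simp
  have pi: "\<pi> i < d" if "i < d" for i using bij_betwE[OF p] that by auto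
  show "adj (row_perm d \<pi> A) * row_perm d \<pi> A = 1\<^sub>m d"
  proof (rule eq_matI)
    fix i j assume "i < dim_row (1\<^sub>m d :: complex mat)" "j < dim_col (1\<^sub>m d :: complex mat)"
    then have ij: "i < d" "j < d" by auto
    have "(adj (row_perm d \<pi> A) * row_perm d \<pi> A) $$ (i, j) = (\<Sum>k<d. cnj (A $$ (\<pi> k, i)) * A $$ (\<pi> k, j))"
      using ij by (subst mult_index[of _ d d _ d]) (auto simp: row_perm_def intro!: sum.cong)
    also have "\<dots> = (\<Sum>k<d. cnj (A $$ (k, i)) * A $$ (k, j))"
      by (rule sum.reindex_bij_betw[OF p])
    also have "\<dots> = (adj A * A) $$ (i, j)"
      using ij AM by (subst mult_index[of _ d d _ d]) (auto intro!: sum.cong)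
    finally show "(adj (row_perm d \<pi> A) * row_perm d \<pi> A) $$ (i, j) = 1\<^sub>m d $$ (i, j)"
      using A by (simp add: UU_iff)
  qed (auto simp: row_perm_def)
qed simp

lemma hs_dist_row_perm:
  assumes "A \<in> MM d" "B \<in> MM d" "bij_betw \<pi> {..<d} {..<d}"
  shows "hs_dist d (row_perm d \<pi> A) (row_perm d \<pi> B) = hs_dist d A B"
proof -
  have "sqdist d (row_perm d \<pi> A) (row_perm d \<pi> B) =
        (\<Sum>i<d. \<Sum>j<d. (cmod (A $$ (\<pi> i,j) - B $$ (\<pi> i,j)))\<^sup>2)"
    by (intro sum.cong refl) auto
  also have "\<dots> = sqdist d A B"
    by (rule sum.reindex_bij_betw[OF assms(3)])
  finally show ?thesis using assms by (simp add: hs_dist_sqrt)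
qed

text \<open>Permuting rows by \<pi> turns the pattern \<open>\<rho> i = \<kappa> j\<close> into a
  block diagonal one. The unitary is cut down to the blocks, made invertible by a small multiple of
  the identity and replaced by its polar factor. As the polar factor is the nearest unitary, it is
  no further from \<open>Z\<close> than \<open>S0\<close> is: this gives the factor 2 in the bound,
  and \<open>\<mu> < \<epsilon> / 2\<close> the rest.\<close>

lemma block_unitary:
  fixes \<rho> \<kappa> :: "nat \<Rightarrow> 'b" and \<eta> \<epsilon> :: real
  assumes S: "S \<in> UU d" and d: "d \<ge> 1" and p: "bij_betw \<pi> {..<d} {..<d}"
    and rk: "\<And>k. k < d \<Longrightarrow> \<rho> (\<pi> k) = \<kappa> k" and eta: "\<eta> \<ge> 0" and eps: "\<epsilon> > 0"
    and mass: "offmass d (\<lambda>i j. \<rho> i = \<kappa> j) S \<le> \<eta>\<^sup>2 * d"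
  shows "\<exists>S'\<in>UU d. (\<forall>i<d. \<forall>j<d. S' $$ (i, j) \<noteq> 0 \<longrightarrow> \<rho> i = \<kappa> j) \<and> hs_dist d S S' \<le> 2 * \<eta> + \<epsilon>"
proof -
  have pi: "\<pi> i < d" if "i < d" for i using bij_betwE[OF p] that by auto
  define S0 where "S0 = row_perm d \<pi> S"
  have S0: "S0 \<in> UU d" "S0 \<in> MM d" using row_perm_UU[OF S p] by (auto simp: S0_def)
  define Zp where "Zp = mat d d (\<lambda>(i, j). if \<kappa> i = \<kappa> j then S0 $$ (i, j) else 0)"
  have ZpM: "Zp \<in> MM d" by (simp add: Zp_def)
  obtain \<mu> Y where mu: "0 < \<mu>" "\<mu> < \<epsilon> / 2" and Y: "Y \<in> MM d" "Y * (Zp + dg d (\<lambda>_. of_real \<mu>)) = 1\<^sub>m d"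
    using perturb_invertible[OF ZpM, of "\<epsilon> / 2"] eps by auto
  define Z where "Z = Zp + dg d (\<lambda>_. of_real \<mu>)"
  have ZM: "Z \<in> MM d" using ZpM by (simp add: Z_def)
  obtain F where F: "F \<in> MM d" "Z * F \<in> UU d"
    and comm: "\<And>C. C \<in> MM d \<Longrightarrow> C * (adj Z * Z) = (adj Z * Z) * C \<Longrightarrow> C * F = F * C"
    and best: "\<And>W. W \<in> UU d \<Longrightarrow> hs_dist d (Z * F) Z \<le> hs_dist d W Z"
    using polar_decomposition[OF ZM Y(1)] Y(2) unfolding Z_def by metis
  have "hs_dist d S0 Zp \<le> \<eta>"
  proof (rule hs_dist_le[OF S0(2) ZpM eta d])
    have "sqdist d S0 Zp =
          (\<Sum>i<d. \<Sum>j<d. if \<rho> (\<pi> i) = \<kappa> j then 0 else (cmod (S $$ (\<pi> i,j)))\<^sup>2)"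
      by (intro sum.cong refl) (auto simp: Zp_def S0_def rk)
    also have "\<dots> = offmass d (\<lambda>i j. \<rho> i = \<kappa> j) S"
      by (rule sum.reindex_bij_betw[OF p])
    finally show "sqdist d S0 Zp \<le> \<eta>\<^sup>2 * d" using mass by simp
  qed
  moreover have "hs_dist d Zp Z \<le> \<mu>"
  proof (rule hs_dist_le[OF ZpM ZM _ d])
    have "sqdist d Zp Z = (\<Sum>i<d. \<Sum>j<d. if j = i then \<mu>\<^sup>2 else 0)"
      using ZpM by (intro sum.cong refl) (auto simp: Z_def)
    then show "sqdist d Zp Z \<le> \<mu>\<^sup>2 * d" by simp
  qed (use mu in simp)
  moreover have "hs_dist d S0 Z \<le> hs_dist d S0 Zp + hs_dist d Zp Z"
    using S0 ZpM ZM by (intro hs_dist_triangle) auto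
  moreover have "hs_dist d S0 (Z * F) \<le> hs_dist d S0 Z + hs_dist d (Z * F) Z"
    using hs_dist_triangle[OF S0(2) ZM UU_MM[OF F(2)]] hs_dist_commute[OF ZM UU_MM[OF F(2)]] by simp
  moreover have "hs_dist d (Z * F) Z \<le> hs_dist d S0 Z" using best S0 by simp
  ultimately have close: "hs_dist d S0 (Z * F) \<le> 2 * \<eta> + \<epsilon>" using mu by linarith
  have Zblk: "\<kappa> i = \<kappa> j" if "i < d" "j < d" "Z $$ (i, j) \<noteq> 0" for i j
    using that ZpM by (auto simp: Z_def Zp_def split: if_splits)
  have Fblk: "\<kappa> i = \<kappa> j" if ij: "i < d" "j < d" "F $$ (i, j) \<noteq> 0" for i j
  proof -
    \<comment> \<open>The projection onto one block commutes with \<open>Z\<close> and with its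
      adjoint, hence with \<open>adj Z * Z\<close> and so with \<open>F\<close>.\<close>
    let ?f = "\<lambda>k. if \<kappa> k = \<kappa> i then 1 else (0::complex)"
    let ?C = "dg d ?f"
    have CZ: "?C * Z = Z * ?C"
    proof (rule eq_matI)
      fix a b assume "a < dim_row (Z * ?C)" "b < dim_col (Z * ?C)"
      then have ab: "a < d" "b < d" using ZM by auto
      show "(?C * Z) $$ (a, b) = (Z * ?C) $$ (a, b)"
        unfolding dg_mult_left[OF ZM ab] dg_mult_right[OF ZM ab] using Zblk[OF ab] by (cases "Z $$ (a, b) = 0") auto
    qed (use ZM in auto)
    have "adj (?C * Z) = adj (Z * ?C)" using CZ by simp
    moreover have "adj ?C = ?C" unfolding adj_dg by (rule dg_cong) auto
    ultimately have CZ': "?C * adj Z = adj Z * ?C" using ZM by (simp add: MM_adj_mult[of _ d])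
    have ZA: "adj Z \<in> MM d" using ZM by simp
    have "?C * (adj Z * Z) = adj Z * (?C * Z)"
      using MM_assoc[OF dg_MM ZA ZM, of ?f] MM_assoc[OF ZA dg_MM ZM, of ?f] CZ' by simp
    also have "\<dots> = adj Z * Z * ?C" unfolding CZ using MM_assoc[OF ZA ZM dg_MM, of ?f] by simp
    finally have "?C * F = F * ?C" by (intro comm) auto
    then show ?thesis using dg_mult_left[OF F(1) ij(1,2), of ?f] dg_mult_right[OF F(1) ij(1,2), of ?f] ij(3)
      by (auto split: if_splits)
  qed
  define \<sigma> where "\<sigma> = the_inv_into {..<d} \<pi>"
  have s: "bij_betw \<sigma> {..<d} {..<d}" unfolding \<sigma>_def by (rule bij_betw_the_inv_into[OF p])
  have ps: "\<pi> (\<sigma> i) = i" "\<sigma> i < d" if "i < d" for i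
    using f_the_inv_into_f_bij_betw[OF p] bij_betwE[OF s] that by (auto simp: \<sigma>_def)
  have SS: "S = row_perm d \<sigma> S0"
    using UU_MM[OF S] ps by (intro eq_matI) (auto simp: S0_def row_perm_def)
  show ?thesis
  proof (intro bexI[of _ "row_perm d \<sigma> (Z * F)"] conjI allI impI)
    show "row_perm d \<sigma> (Z * F) \<in> UU d" by (rule row_perm_UU[OF F(2) s])
    show "hs_dist d S (row_perm d \<sigma> (Z * F)) \<le> 2 * \<eta> + \<epsilon>"
      using hs_dist_row_perm[OF S0(2) UU_MM[OF F(2)] s] close SS by simp
    fix i j assume ij: "i < d" "j < d" "row_perm d \<sigma> (Z * F) $$ (i, j) \<noteq> 0"
    then have "(\<Sum>k<d. Z $$ (\<sigma> i, k) * F $$ (k, j)) \<noteq> 0"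
      using mult_index[OF ZM F(1) ps(2)[OF ij(1)] ij(2)] by (simp del: index_mult_mat(1))
    then obtain k where "k < d" "Z $$ (\<sigma> i, k) * F $$ (k, j) \<noteq> 0"
      by (meson lessThan_iff sum.not_neutral_contains_not_neutral)
    then have "\<kappa> (\<sigma> i) = \<kappa> j" using Zblk[of "\<sigma> i" k] Fblk[of k j] ij ps(2) by auto
    then show "\<rho> i = \<kappa> j" using rk[of "\<sigma> i"] ps ij by simp
  qed
qed

section \<open>Integral rounding\<close>

text \<open>Pigeonhole: the vectors of fractional parts of \<open>q * \<theta> w\<close>, for
  \<open>N ^ card \<Omega> + 1\<close> values of \<open>q\<close>, fall into
  \<open>N ^ card \<Omega>\<close> boxes of side \<open>1 / N\<close>. The difference of two values
  in one box is the denominator.\<close>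

lemma dirichlet_simultaneous:
  fixes \<theta> :: "'a \<Rightarrow> real" and N :: nat
  assumes fin: "finite \<Omega>" and N: "N > 0"
  obtains q :: nat and p :: "'a \<Rightarrow> int" where "0 < q" "q \<le> N ^ card \<Omega>"
    "\<And>w. w \<in> \<Omega> \<Longrightarrow> \<bar>real q * \<theta> w - of_int (p w)\<bar> < 1 / N"
proof -
  define f where "f q = (\<lambda>w\<in>\<Omega>. nat \<lfloor>N * frac (real q * \<theta> w)\<rfloor>)" for q :: nat
  have flt: "nat \<lfloor>N * frac y\<rfloor> < N" for y :: real
  proof -
    have "N * frac y < N" using N frac_lt_1[of y] by simp
    then show ?thesis using N by (simp add: nat_less_iff floor_less_iff frac_ge_0)
  qed
  have "f ` {..N ^ card \<Omega>} \<subseteq> \<Omega> \<rightarrow>\<^sub>E {..<N}" using flt by (auto simp: f_def)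
  then have "card (f ` {..N ^ card \<Omega>}) \<le> card (\<Omega> \<rightarrow>\<^sub>E {..<N})"
    using fin by (intro card_mono finite_PiE) auto
  also have "\<dots> < card {..N ^ card \<Omega>}" using fin by (simp add: card_PiE)
  finally have "\<not> inj_on f {..N ^ card \<Omega>}" by (rule pigeonhole)
  then obtain q1 q2 where q: "q1 \<le> N ^ card \<Omega>" "q2 \<le> N ^ card \<Omega>" "q1 < q2" "f q1 = f q2"
    by (auto simp: inj_on_def) (metis linorder_neqE_nat)
  define p where "p w = \<lfloor>real q2 * \<theta> w\<rfloor> - \<lfloor>real q1 * \<theta> w\<rfloor>" for w
  show ?thesis
  proof (rule that[of "q2 - q1" p])
    fix w assume w: "w \<in> \<Omega>"
    let ?a = "frac (real q1 * \<theta> w)" and ?b = "frac (real q2 * \<theta> w)"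
    have "nat \<lfloor>N * ?a\<rfloor> = nat \<lfloor>N * ?b\<rfloor>" using fun_cong[OF q(4), of w] w by (simp add: f_def)
    then have "\<lfloor>N * ?a\<rfloor> = \<lfloor>N * ?b\<rfloor>" by (subst (asm) eq_nat_nat_iff) (auto simp: frac_ge_0)
    then have "\<bar>N * ?b - N * ?a\<bar> < 1" by linarith
    moreover have "N * ?b - N * ?a = N * (?b - ?a)" by (simp add: algebra_simps)
    ultimately have "N * \<bar>?b - ?a\<bar> < 1" by (simp add: abs_mult)
    then have "\<bar>?b - ?a\<bar> < 1 / N" using N by (simp add: field_simps)
    moreover have "?b - ?a = real (q2 - q1) * \<theta> w - of_int (p w)"
      using q(3) by (simp add: frac_def p_def of_nat_diff algebra_simps)
    ultimately show "\<bar>real (q2 - q1) * \<theta> w - of_int (p w)\<bar> < 1 / N" by simp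
  qed (use q in auto)
qed

text \<open>A simultaneous rational approximation \<open>p / q\<close> of \<open>m / |m|\<close> satisfies the integral linear
  constraints exactly as soon as it satisfies them up to an error below \<open>1\<close>.\<close>
lemma integral_rounding:
  fixes \<epsilon> :: real
  assumes fin: "finite \<Omega>" and eps: "\<epsilon> > 0"
  shows "\<exists>\<delta>>0. \<forall>(C :: ('a \<Rightarrow> int) set) m :: 'a \<Rightarrow> nat.
    (\<forall>a\<in>C. (\<forall>w\<in>\<Omega>. \<bar>a w\<bar> \<le> 1) \<and>
      \<bar>real_of_int (\<Sum>w\<in>\<Omega>. a w * int (m w))\<bar> \<le> \<delta> * (\<Sum>w\<in>\<Omega>. real (m w))) \<longrightarrow>
    (\<exists>m'. (\<forall>w\<in>\<Omega>. m' w \<le> m w) \<and> (\<forall>a\<in>C. (\<Sum>w\<in>\<Omega>. a w * int (m' w)) = 0) \<and>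
      (\<Sum>w\<in>\<Omega>. real (m w) - real (m' w)) \<le> \<epsilon> * (\<Sum>w\<in>\<Omega>. real (m w)))"
proof -
  define K where "K = card \<Omega>"
  \<comment> \<open>The bound \<open>2 * K\<close> keeps the approximation error in each constraint
    below 1/2; \<open>6 * K / \<epsilon>\<close> keeps the proportional loss of mass below half of
    the allowance. \<open>Q\<close> bounds the denominators, and beyond size \<open>D\<close> the
    constant loss \<open>2 * K * Q\<close> fits into the other half.\<close>
  obtain N :: nat where N: "real N > max (2 * K) (6 * K / \<epsilon>)" using reals_Archimedean2 by blast
  then have N0: "N > 0" and NK: "2 * real K < N" "6 * K / \<epsilon> < N" by auto
  define Q where "Q = N ^ K"
  define D where "D = 4 * real Q * (real K + 1) / \<epsilon>"
  have Q: "Q > 0" using N0 by (simp add: Q_def)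
  have D: "D > 0" unfolding D_def using Q eps by (intro divide_pos_pos mult_pos_pos) auto
  define \<delta> where "\<delta> = min (1 / (2 * Q)) (1 / (2 * D))"
  show ?thesis
  proof (intro exI[of _ \<delta>] conjI allI impI)
    show "\<delta> > 0" using Q D by (simp add: \<delta>_def)
    fix C :: "('a \<Rightarrow> int) set" and m :: "'a \<Rightarrow> nat"
    assume C: "\<forall>a\<in>C. (\<forall>w\<in>\<Omega>. \<bar>a w\<bar> \<le> 1) \<and>
      \<bar>real_of_int (\<Sum>w\<in>\<Omega>. a w * int (m w))\<bar> \<le> \<delta> * (\<Sum>w\<in>\<Omega>. real (m w))"
    have A: "\<bar>c w\<bar> \<le> 1" if "c \<in> C" "w \<in> \<Omega>" for c w using C that by blast
    have Am: "\<bar>real_of_int (\<Sum>w\<in>\<Omega>. c w * int (m w))\<bar> \<le> \<delta> * (\<Sum>w\<in>\<Omega>. real (m w))" if "c \<in> C" for c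
      using C that by blast
    define M where "M = (\<Sum>w\<in>\<Omega>. real (m w))"
    have M0: "M \<ge> 0" by (simp add: M_def sum_nonneg)
    show "\<exists>m'. (\<forall>w\<in>\<Omega>. m' w \<le> m w) \<and> (\<forall>c\<in>C. (\<Sum>w\<in>\<Omega>. c w * int (m' w)) = 0) \<and>
      (\<Sum>w\<in>\<Omega>. real (m w) - real (m' w)) \<le> \<epsilon> * (\<Sum>w\<in>\<Omega>. real (m w))"
    proof (cases "M \<le> D")
      \<comment> \<open>At size at most \<open>D\<close> each constraint is off by at most 1/2,
        hence by 0, and \<open>m\<close> itself is the solution.\<close>
      case True
      have "(\<Sum>w\<in>\<Omega>. c w * int (m w)) = 0" if "c \<in> C" for c
      proof -
        have "\<bar>real_of_int (\<Sum>w\<in>\<Omega>. c w * int (m w))\<bar> \<le> \<delta> * M" using Am[OF that] by (simp add: M_def)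
        also have "\<dots> \<le> 1 / (2 * D) * D" using True M0 D by (intro mult_mono) (auto simp: \<delta>_def)
        also have "\<dots> < 1" using D by simp
        finally show ?thesis by linarith
      qed
      then show ?thesis using eps M0 by (intro exI[of _ m]) (simp add: M_def)
    next
      case False
      then have MD: "M > D" by simp
      then have M: "M > 0" using D by simp
      obtain q p where q: "0 < q" "q \<le> Q"
        and p: "\<And>w. w \<in> \<Omega> \<Longrightarrow> \<bar>real q * (real (m w) / M) - of_int (p w)\<bar> < 1 / N"
        using dirichlet_simultaneous[OF fin N0, of "\<lambda>w. real (m w) / M"] unfolding Q_def K_def by metis
      have pz: "(\<Sum>w\<in>\<Omega>. c w * p w) = 0" if c: "c \<in> C" for c
      proof -
        have "real_of_int (\<Sum>w\<in>\<Omega>. c w * p w) = (\<Sum>w\<in>\<Omega>. c w * (of_int (p w) - real q * (real (m w) / M))) +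
           q / M * (\<Sum>w\<in>\<Omega>. c w * real (m w))"
          by (simp add: sum.distrib[symmetric] sum_distrib_left algebra_simps)
        moreover have "\<bar>\<Sum>w\<in>\<Omega>. c w * (of_int (p w) - real q * (real (m w) / M))\<bar> \<le> (\<Sum>w\<in>\<Omega>. 1 / N)"
        proof (rule order_trans[OF sum_abs sum_mono])
          fix w assume w: "w \<in> \<Omega>"
          have "\<bar>c w * (of_int (p w) - real q * (real (m w) / M))\<bar> \<le> 1 * (1 / N)"
            unfolding abs_mult using p[OF w] A[OF c w] by (intro mult_mono) (auto simp: abs_minus_commute simp flip: of_int_abs)
          then show "\<bar>c w * (of_int (p w) - real q * (real (m w) / M))\<bar> \<le> 1 / N" by simp
        qed
        moreover have "(\<Sum>w\<in>\<Omega>. 1 / real N) < 1 / 2" using NK N0 by (simp add: K_def field_simps)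
        moreover have "\<bar>q / M * (\<Sum>w\<in>\<Omega>. c w * real (m w))\<bar> \<le> 1 / 2"
        proof -
          have "\<bar>\<Sum>w\<in>\<Omega>. c w * real (m w)\<bar> \<le> \<delta> * M" using Am[OF c] by (simp add: M_def)
          then have "\<bar>q / M * (\<Sum>w\<in>\<Omega>. c w * real (m w))\<bar> \<le> q / M * (\<delta> * M)"
            unfolding abs_mult using M by (intro mult_mono) auto
          also have "\<dots> = q * \<delta>" using M by simp
          also have "\<dots> \<le> Q * (1 / (2 * Q))" using q by (intro mult_mono) (auto simp: \<delta>_def Q D less_imp_le)
          finally show ?thesis using Q by simp
        qed
        ultimately have "\<bar>real_of_int (\<Sum>w\<in>\<Omega>. c w * p w)\<bar> < 1" by linarith
        then show ?thesis by linarith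
      qed
      have N1: "1 / real N \<le> 1" using N0 by simp
      have p0: "p w \<ge> 0" if w: "w \<in> \<Omega>" for w
      proof -
        have "real q * (real (m w) / M) \<ge> 0" using M by simp
        then have "of_int (p w) > (- 1 :: real)" using p[OF w] N1 by linarith
        then show ?thesis by linarith
      qed
      \<comment> \<open>The solution is \<open>t\<close> copies of \<open>p\<close>, with
        \<open>t\<close> close to \<open>M / q\<close>. The factor \<open>1 - 1 / N\<close> pays for
        rounding up: if \<open>p w \<ge> 1\<close> then
        \<open>p w * (1 - 1 / N) \<le> p w - 1 / N\<close>, which is below
        \<open>q * m w / M\<close>, so that \<open>t * p w\<close> stays below
        \<open>m w\<close>.\<close>
      define t where "t = nat \<lfloor>M / q * (1 - 1 / N)\<rfloor>"
      have t0: "M / q * (1 - 1 / N) \<ge> 0" using M N1 by simp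
      have t: "real t \<le> M / q * (1 - 1 / N)" "real t > M / q * (1 - 1 / N) - 1"
        using t0 by (auto simp: t_def)
      define m' where "m' w = t * nat (p w)" for w
      have m': "real (m' w) = real t * of_int (p w)" if "w \<in> \<Omega>" for w using p0[OF that] by (simp add: m'_def)
      have mle: "m' w \<le> m w" if w: "w \<in> \<Omega>" for w
      proof (cases "p w = 0")
        case False
        then have p1: "real_of_int (p w) \<ge> 1" using p0[OF w] by simp
        have "real (m' w) \<le> M / q * (1 - 1 / N) * of_int (p w)"
          unfolding m'[OF w] using t(1) p1 by (intro mult_right_mono) auto
        also have "\<dots> = M / q * (of_int (p w) - of_int (p w) / N)" by (simp add: algebra_simps)
        also have "\<dots> \<le> M / q * (of_int (p w) - 1 / N)"
          using M p1 by (intro mult_left_mono diff_left_mono divide_right_mono) auto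
        also have "\<dots> \<le> M / q * (real q * (real (m w) / M))"
        proof (rule mult_left_mono)
          show "of_int (p w) - 1 / real N \<le> real q * (real (m w) / M)" using p[OF w, unfolded abs_diff_less_iff] by (simp only: less_imp_le)
        qed (use M in simp)
        also have "\<dots> = m w" using M q by simp
        finally show ?thesis by simp
      qed (simp add: m'_def)
      have "(\<Sum>w\<in>\<Omega>. c w * int (m' w)) = 0" if "c \<in> C" for c
      proof -
        have "(\<Sum>w\<in>\<Omega>. c w * int (m' w)) = int t * (\<Sum>w\<in>\<Omega>. c w * p w)"
          unfolding sum_distrib_left using p0 by (intro sum.cong refl) (simp add: m'_def mult_ac)
        then show ?thesis using pz[OF that] by simp
      qed
      moreover have "(\<Sum>w\<in>\<Omega>. real (m w) - real (m' w)) \<le> \<epsilon> * M"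
      proof -
        have "(\<Sum>w\<in>\<Omega>. real (m w) - real (m' w)) \<le> (\<Sum>w\<in>\<Omega>. 3 * M / N + 2 * Q)"
        proof (rule sum_mono)
          fix w assume w: "w \<in> \<Omega>"
          have mM: "real (m w) / M \<le> 1"
          proof -
            have "real (m w) \<le> M" unfolding M_def using fin w by (intro member_le_sum) auto
            then show ?thesis using M by simp
          qed
          have "of_int (p w) \<le> real q * (real (m w) / M) + 1 / N"
            using p[OF w, unfolded abs_diff_less_iff, THEN conjunct1] unfolding diff_less_eq by (rule less_imp_le)
          also have "\<dots> \<le> real q * 1 + real q" using mM N1 q by (intro add_mono mult_left_mono) auto
          finally have pq: "of_int (p w) \<le> 2 * real q" by simp
          have "real (m w) = M / q * (real q * (real (m w) / M))" using M q by simp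
          also have "\<dots> \<le> M / q * (of_int (p w) + 1 / N)"
          proof (rule mult_left_mono)
            show "real q * (real (m w) / M) \<le> of_int (p w) + 1 / real N" using p[OF w, unfolded abs_diff_less_iff] by (simp only: less_imp_le)
          qed (use M in simp)
          finally have m1: "real (m w) \<le> M / q * of_int (p w) + M / q * (1 / N)" by (simp add: algebra_simps)
          have "(M / q * (1 - 1 / N) - 1) * of_int (p w) \<le> real t * of_int (p w)"
            using t(2) p0[OF w] by (intro mult_right_mono) auto
          then have "M / q * of_int (p w) - M / q * of_int (p w) / N - of_int (p w) \<le> real (m' w)"
            unfolding m'[OF w] by (simp add: algebra_simps)
          moreover have "M / q * of_int (p w) \<le> 2 * M"
            using mult_left_mono[OF pq, of "M / q"] M q by simp
          then have "M / q * of_int (p w) / N \<le> 2 * M / N" by (rule divide_right_mono) simp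
          moreover have "M / q * (1 / N) \<le> M / N"
          proof -
            have "M / q \<le> M / 1" using M q by (intro divide_left_mono) auto
            then have "M / q * (1 / N) \<le> M * (1 / N)" by (intro mult_right_mono) auto
            then show ?thesis by simp
          qed
          moreover have "of_int (p w) \<le> 2 * real Q" using pq q by linarith
          ultimately show "real (m w) - real (m' w) \<le> 3 * M / N + 2 * Q" using m1 by simp
        qed
        also have "\<dots> = 3 * K / N * M + 2 * K * Q" by (simp add: K_def algebra_simps)
        also have "\<dots> \<le> \<epsilon> / 2 * M + \<epsilon> / 2 * M"
        proof (rule add_mono)
          have "3 * K / N \<le> \<epsilon> / 2" using NK(2) N0 eps by (simp add: field_simps)
          then show "3 * K / N * M \<le> \<epsilon> / 2 * M" using M by (intro mult_right_mono) auto
          have "2 * K * Q \<le> \<epsilon> / 2 * D" using eps by (simp add: D_def field_simps)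
          also have "\<dots> \<le> \<epsilon> / 2 * M" using MD eps by simp
          finally show "2 * K * Q \<le> \<epsilon> / 2 * M" .
        qed
        finally show ?thesis by (simp add: mult.commute)
      qed
      ultimately show ?thesis using mle unfolding M_def by blast
    qed
  qed
qed

lemma card_fibre_sum:
  assumes "finite \<Omega>" "\<And>k. k \<in> J \<Longrightarrow> l k \<in> \<Omega>" "finite J"
  shows "card {k\<in>J. P (l k)} = (\<Sum>w\<in>\<Omega>. of_bool (P w) * card {k\<in>J. l k = w})"
proof -
  have "{k\<in>J. P (l k)} = (\<Union>w\<in>{w\<in>\<Omega>. P w}. {k\<in>J. l k = w})" using assms by auto
  then have "card {k\<in>J. P (l k)} = (\<Sum>w\<in>{w\<in>\<Omega>. P w}. card {k\<in>J. l k = w})"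
    using assms by (simp only:) (subst card_UN_disjoint, auto)
  also have "\<dots> = (\<Sum>w\<in>\<Omega>. of_bool (P w) * card {k\<in>J. l k = w})"
    unfolding sum.inter_filter[OF assms(1)] by (intro sum.cong refl) auto
  finally show ?thesis .
qed

text \<open>Equality of the two fibre counts is linear in the multiplicities of the labels, with
  coefficients in -1, 0, 1. After rounding, only as many indices as the rounded multiplicities allow
  keep their labels; all others get \<open>z\<close>, which contributes equally to both sides and so
  preserves the balance.\<close>

lemma balanced_relabelling:
  fixes \<alpha> \<beta> :: "'i \<Rightarrow> 'a \<Rightarrow> 'k" and \<epsilon> :: real
  assumes fin: "finite \<Omega>" and eps: "\<epsilon> > 0" and z: "z \<in> \<Omega>" "\<And>i. i \<in> I \<Longrightarrow> \<alpha> i z = \<beta> i z"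
  obtains \<delta> :: real where "\<delta> > 0"
    "\<And>(d::nat) l. (\<And>k. k < d \<Longrightarrow> l k \<in> \<Omega>) \<Longrightarrow>
      (\<And>i u. i \<in> I \<Longrightarrow> \<bar>real (card {k\<in>{..<d}. \<alpha> i (l k) = u}) - real (card {k\<in>{..<d}. \<beta> i (l k) = u})\<bar> \<le> \<delta> * d) \<Longrightarrow>
      \<exists>l'. (\<forall>k<d. l' k \<in> \<Omega>) \<and> card {k\<in>{..<d}. l' k \<noteq> l k} \<le> \<epsilon> * d \<and>
        (\<forall>i\<in>I. \<forall>u. card {k\<in>{..<d}. \<alpha> i (l' k) = u} = card {k\<in>{..<d}. \<beta> i (l' k) = u})"
proof -
  obtain \<delta> where d: "\<delta> > 0" and R: "\<forall>(C :: ('a \<Rightarrow> int) set) m.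
      (\<forall>a\<in>C. (\<forall>w\<in>\<Omega>. \<bar>a w\<bar> \<le> 1) \<and>
        \<bar>real_of_int (\<Sum>w\<in>\<Omega>. a w * int (m w))\<bar> \<le> \<delta> * (\<Sum>w\<in>\<Omega>. real (m w))) \<longrightarrow>
      (\<exists>m'. (\<forall>w\<in>\<Omega>. m' w \<le> m w) \<and> (\<forall>a\<in>C. (\<Sum>w\<in>\<Omega>. a w * int (m' w)) = 0) \<and>
        (\<Sum>w\<in>\<Omega>. real (m w) - real (m' w)) \<le> \<epsilon> * (\<Sum>w\<in>\<Omega>. real (m w)))"
    using integral_rounding[OF fin eps] by (elim exE conjE) (rule that)
  show ?thesis
  proof (rule that[OF d])
    fix d :: nat and l
    assume l: "\<And>k. k < d \<Longrightarrow> l k \<in> \<Omega>"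
      and bal: "\<And>i u. i \<in> I \<Longrightarrow> \<bar>real (card {k\<in>{..<d}. \<alpha> i (l k) = u}) - real (card {k\<in>{..<d}. \<beta> i (l k) = u})\<bar> \<le> \<delta> * d"
    define m where "m w = card {k\<in>{..<d}. l k = w}" for w
    define A :: "'i \<Rightarrow> 'k \<Rightarrow> 'a \<Rightarrow> int" where "A i u w = of_bool (\<alpha> i w = u) - of_bool (\<beta> i w = u)" for i u w
    have cnt: "card {k\<in>{..<d}. P (l k)} = (\<Sum>w\<in>\<Omega>. of_bool (P w) * m w)" for P
      unfolding m_def using l by (intro card_fibre_sum[OF fin]) auto
    have tot: "(\<Sum>w\<in>\<Omega>. real (m w)) = d" using cnt[of "\<lambda>_. True"] by (simp flip: of_nat_sum)
    have "\<exists>m'. (\<forall>w\<in>\<Omega>. m' w \<le> m w) \<and> (\<forall>a\<in>{A i u |i u. i \<in> I}. (\<Sum>w\<in>\<Omega>. a w * int (m' w)) = 0) \<and>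
      (\<Sum>w\<in>\<Omega>. real (m w) - real (m' w)) \<le> \<epsilon> * (\<Sum>w\<in>\<Omega>. real (m w))"
    proof (rule R[rule_format])
      fix a assume "a \<in> {A i u |i u. i \<in> I}"
      then obtain i u where i: "i \<in> I" and a: "a = A i u" by blast
      have "(\<Sum>w\<in>\<Omega>. A i u w * int (m w)) =
          int (card {k\<in>{..<d}. \<alpha> i (l k) = u}) - int (card {k\<in>{..<d}. \<beta> i (l k) = u})"
        unfolding cnt[of "\<lambda>w. \<alpha> i w = u"] cnt[of "\<lambda>w. \<beta> i w = u"]
        by (simp add: A_def left_diff_distrib sum_subtractf)
      then show "(\<forall>w\<in>\<Omega>. \<bar>a w\<bar> \<le> 1) \<and>
          \<bar>real_of_int (\<Sum>w\<in>\<Omega>. a w * int (m w))\<bar> \<le> \<delta> * (\<Sum>w\<in>\<Omega>. real (m w))"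
        unfolding tot a using bal[OF i, of u] by (simp add: A_def)
    qed
    then obtain m' where m': "\<And>w. w \<in> \<Omega> \<Longrightarrow> m' w \<le> m w" "\<And>i u. i \<in> I \<Longrightarrow> (\<Sum>w\<in>\<Omega>. A i u w * int (m' w)) = 0"
        "(\<Sum>w\<in>\<Omega>. real (m w) - real (m' w)) \<le> \<epsilon> * d" unfolding tot by blast
    have "\<exists>J. J \<subseteq> {k\<in>{..<d}. l k = w} \<and> card J = m' w" if "w \<in> \<Omega>" for w
      using m'(1)[OF that] obtain_subset_with_card_n[of "m' w" "{k\<in>{..<d}. l k = w}"] unfolding m_def by metis
    then obtain J where J: "\<And>w. w \<in> \<Omega> \<Longrightarrow> J w \<subseteq> {k\<in>{..<d}. l k = w}" "\<And>w. w \<in> \<Omega> \<Longrightarrow> card (J w) = m' w"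
      by metis
    \<comment> \<open>The indices that keep their label: \<open>m' w\<close> of those labelled
      \<open>w\<close>.\<close>
    define G where "G = {k\<in>{..<d}. k \<in> J (l k)}"
    define l' where "l' k = (if k \<in> G then l k else z)" for k
    have GJ: "{k\<in>G. l k = w} = J w" if "w \<in> \<Omega>" for w using J(1)[OF that] by (auto simp: G_def)
    have cntG: "card {k\<in>G. P (l k)} = (\<Sum>w\<in>\<Omega>. of_bool (P w) * m' w)" for P
      using card_fibre_sum[OF fin, of G l P] l J GJ by (auto simp: G_def cong: sum.cong)
    have fG: "finite G" "G \<subseteq> {..<d}" by (auto simp: G_def)
    have split: "card {k\<in>{..<d}. P (l' k)} = (\<Sum>w\<in>\<Omega>. of_bool (P w) * m' w) + of_bool (P z) * card ({..<d} - G)" for P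
    proof -
      have "{k\<in>{..<d}. P (l' k)} = {k\<in>G. P (l k)} \<union> {k\<in>{..<d} - G. P z}" using fG by (auto simp: l'_def)
      moreover have "card ({k\<in>G. P (l k)} \<union> {k\<in>{..<d} - G. P z}) = card {k\<in>G. P (l k)} + card {k\<in>{..<d} - G. P z}"
        using fG by (intro card_Un_disjoint) auto
      moreover have "card {k\<in>{..<d} - G. P z} = of_bool (P z) * card ({..<d} - G)"
      proof -
        have "{k\<in>{..<d} - G. P z} = (if P z then {..<d} - G else {})" by auto
        then show ?thesis by (simp only: of_bool_def) simp
      qed
      ultimately show ?thesis by (simp only: cntG)
    qed
    show "\<exists>l'. (\<forall>k<d. l' k \<in> \<Omega>) \<and> card {k\<in>{..<d}. l' k \<noteq> l k} \<le> \<epsilon> * d \<and>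
        (\<forall>i\<in>I. \<forall>u. card {k\<in>{..<d}. \<alpha> i (l' k) = u} = card {k\<in>{..<d}. \<beta> i (l' k) = u})"
    proof (intro exI[of _ l'] conjI allI impI ballI)
      show "l' k \<in> \<Omega>" if "k < d" for k using l[OF that] z by (simp add: l'_def)
      have "card {k\<in>{..<d}. l' k \<noteq> l k} \<le> card ({..<d} - G)" by (intro card_mono) (auto simp: l'_def)
      also have "\<dots> = d - (\<Sum>w\<in>\<Omega>. m' w)"
        using cntG[of "\<lambda>_. True"] fG by (simp add: card_Diff_subset)
      also have "real \<dots> = (\<Sum>w\<in>\<Omega>. real (m w) - real (m' w))"
      proof -
        have "(\<Sum>w\<in>\<Omega>. m' w) \<le> (\<Sum>w\<in>\<Omega>. m w)" using m'(1) by (intro sum_mono) auto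
        then have "(\<Sum>w\<in>\<Omega>. m' w) \<le> d" using cnt[of "\<lambda>_. True"] by simp
        then show ?thesis using tot by (simp add: of_nat_diff sum_subtractf)
      qed
      finally show "card {k\<in>{..<d}. l' k \<noteq> l k} \<le> \<epsilon> * d" using m'(3) by simp
      fix i u assume i: "i \<in> I"
      have "int (\<Sum>w\<in>\<Omega>. of_bool (\<alpha> i w = u) * m' w) = int (\<Sum>w\<in>\<Omega>. of_bool (\<beta> i w = u) * m' w)"
        using m'(2)[OF i, of u] by (simp add: A_def left_diff_distrib sum_subtractf)
      then show "card {k\<in>{..<d}. \<alpha> i (l' k) = u} = card {k\<in>{..<d}. \<beta> i (l' k) = u}"
        unfolding split[of "\<lambda>w. \<alpha> i w = u"] split[of "\<lambda>w. \<beta> i w = u"] of_nat_eq_iff using z(2)[OF i] by simp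
    qed
  qed
qed

lemma fibre_matching:
  assumes "\<And>u. card {k\<in>{..<d::nat}. a k = u} = card {k\<in>{..<d}. b k = u}"
  obtains \<pi> where "bij_betw \<pi> {..<d} {..<d}" "\<And>k. k < d \<Longrightarrow> b (\<pi> k) = a k"
proof -
  have "\<exists>f. bij_betw f {k\<in>{..<d}. a k = u} {k\<in>{..<d}. b k = u}" for u
    using assms by (intro finite_same_card_bij) auto
  then obtain f where f: "\<And>u. bij_betw (f u) {k\<in>{..<d}. a k = u} {k\<in>{..<d}. b k = u}" by metis
  define \<pi> where "\<pi> k = f (a k) k" for k
  have pi: "\<pi> k < d \<and> b (\<pi> k) = a k" if "k < d" for k
    using bij_betwE[OF f[of "a k"]] that by (auto simp: \<pi>_def)
  have "inj_on \<pi> {..<d}"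
  proof (rule inj_onI)
    fix x y assume xy: "x \<in> {..<d}" "y \<in> {..<d}" "\<pi> x = \<pi> y"
    then have "a x = a y" using pi by (metis lessThan_iff)
    then show "x = y" using xy f[of "a x"] by (auto simp: \<pi>_def bij_betw_def inj_on_def)
  qed
  then have "bij_betw \<pi> {..<d} {..<d}" unfolding bij_betw_def
    using pi by (intro conjI endo_inj_surj) auto
  then show ?thesis using that pi by blast
qed

section \<open>Exact representations on a window\<close>

text \<open>\<open>compatible W p w v\<close> says that moving the marks \<open>w\<close> in the window \<open>W\<close> along \<open>p\<close> gives the
  marks \<open>v\<close>, as far as the window allows to compare them.\<close>
definition compatible :: "'a set \<Rightarrow> ('a \<Rightarrow> 'a) \<Rightarrow> 'a set \<Rightarrow> 'a set \<Rightarrow> bool" where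
  "compatible W p w v \<longleftrightarrow> {x\<in>W. p x \<in> W \<and> x \<in> w} = {x\<in>W. p x \<in> W \<and> p x \<in> v}"

lemma compatibleD: "compatible W p w v \<Longrightarrow> x \<in> W \<Longrightarrow> p x \<in> W \<Longrightarrow> x \<in> w \<longleftrightarrow> p x \<in> v"
  unfolding compatible_def by blast

text \<open>Entrywise form of exact intertwining: it amounts to
  \<open>S * dsign d l x = dsign d l (p x) * S\<close> for all \<open>x\<close> with
  \<open>x\<close> and \<open>p x\<close> in \<open>W\<close>.\<close>

definition implements :: "'a set \<Rightarrow> ('a \<Rightarrow> 'a) \<Rightarrow> nat \<Rightarrow> (nat \<Rightarrow> 'a set) \<Rightarrow> complex mat \<Rightarrow> bool" where
  "implements W p d l S \<longleftrightarrow> (\<forall>j<d. \<forall>k<d. S $$ (j, k) \<noteq> 0 \<longrightarrow> compatible W p (l k) (l j))"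

lemma implementsD: "implements W p d l S \<Longrightarrow> j < d \<Longrightarrow> k < d \<Longrightarrow> S $$ (j, k) \<noteq> 0 \<Longrightarrow> compatible W p (l k) (l j)"
  by (simp add: implements_def)

lemma of_bool_sum_card: "(\<Sum>k<d::nat. if P k then 1 else 0 :: real) = card {k\<in>{..<d}. P k}"
proof -
  have "(\<Sum>k<d. if P k then 1 else 0 :: real) = (\<Sum>k\<in>{k\<in>{..<d}. P k}. 1)"
    by (rule sum.inter_filter[symmetric]) simp
  then show ?thesis by simp
qed

text \<open>The squared moduli of the entries of a unitary form a doubly stochastic matrix.\<close>
lemma unitary_fibre_balance:
  assumes S: "S \<in> UU d"
  shows "\<bar>real (card {k\<in>{..<d}. \<kappa> k = u}) - real (card {k\<in>{..<d}. \<rho> k = u})\<bar> \<le>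
    offmass d (\<lambda>i j. \<rho> i = \<kappa> j) S"
proof -
  let ?s = "\<lambda>i j. (cmod (S $$ (i,j)))\<^sup>2"
  have "real (card {k\<in>{..<d}. \<kappa> k = u}) = (\<Sum>j<d. if \<kappa> j = u then 1 else 0)" by (rule of_bool_sum_card[symmetric])
  also have "\<dots> = (\<Sum>j<d. \<Sum>i<d. if \<kappa> j = u then ?s i j else 0)"
    by (intro sum.cong refl) (auto simp: UU_col_norm[OF S])
  also have "\<dots> = (\<Sum>i<d. \<Sum>j<d. if \<kappa> j = u then ?s i j else 0)" by (rule sum.swap)
  finally have k: "real (card {k\<in>{..<d}. \<kappa> k = u}) = \<dots>" .
  have "real (card {k\<in>{..<d}. \<rho> k = u}) = (\<Sum>i<d. if \<rho> i = u then 1 else 0)" by (rule of_bool_sum_card[symmetric])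
  also have "\<dots> = (\<Sum>i<d. \<Sum>j<d. if \<rho> i = u then ?s i j else 0)"
    by (intro sum.cong refl) (auto simp: UU_row_norm[OF S])
  finally have r: "real (card {k\<in>{..<d}. \<rho> k = u}) = \<dots>" .
  have "\<bar>(\<Sum>i<d. \<Sum>j<d. (if \<kappa> j = u then ?s i j else 0) - (if \<rho> i = u then ?s i j else 0))\<bar> \<le>
    (\<Sum>i<d. \<Sum>j<d. if \<rho> i = \<kappa> j then 0 else ?s i j)"
    by (rule order_trans[OF sum_abs sum_mono], rule order_trans[OF sum_abs sum_mono]) auto
  then show ?thesis unfolding k r by (simp add: sum_subtractf)
qed

text \<open>Relabelling an index affects only one row and one column, and each of these has mass
  1.\<close>

lemma incompatible_mass_relabel:
  assumes S: "S \<in> UU d"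
  shows "offmass d (\<lambda>i j. P (l' i) (l' j)) S \<le>
    offmass d (\<lambda>i j. P (l i) (l j)) S + 2 * card {k\<in>{..<d}. l' k \<noteq> l k}"
proof -
  let ?s = "\<lambda>i j. (cmod (S $$ (i,j)))\<^sup>2"
  have "(\<Sum>i<d. \<Sum>j<d. if P (l' i) (l' j) then 0 else ?s i j) \<le>
    (\<Sum>i<d. \<Sum>j<d. (if P (l i) (l j) then 0 else ?s i j) + ((if l' i \<noteq> l i then ?s i j else 0) + (if l' j \<noteq> l j then ?s i j else 0)))"
    by (intro sum_mono) auto
  also have "\<dots> = (\<Sum>i<d. \<Sum>j<d. if P (l i) (l j) then 0 else ?s i j) +
     ((\<Sum>i<d. \<Sum>j<d. if l' i \<noteq> l i then ?s i j else 0) + (\<Sum>i<d. \<Sum>j<d. if l' j \<noteq> l j then ?s i j else 0))"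
    by (simp only: sum.distrib)
  also have "(\<Sum>i<d. \<Sum>j<d. if l' i \<noteq> l i then ?s i j else 0) = (\<Sum>i<d. if l' i \<noteq> l i then 1 else 0)"
    by (intro sum.cong refl) (auto simp: UU_row_norm[OF S])
  also have "(\<Sum>i<d. \<Sum>j<d. if l' j \<noteq> l j then ?s i j else 0) = (\<Sum>j<d. \<Sum>i<d. if l' j \<noteq> l j then ?s i j else 0)"
    by (rule sum.swap)
  also have "\<dots> = (\<Sum>j<d. if l' j \<noteq> l j then 1 else 0)"
    by (intro sum.cong refl) (auto simp: UU_col_norm[OF S])
  finally show ?thesis unfolding of_bool_sum_card by simp
qed

text \<open>A relabelled index changes at most one diagonal entry, by 2 in modulus.\<close>

lemma hs_dist_dsign_relabel:
  assumes "d \<ge> 1" "e \<ge> 0" "4 * real (card {k\<in>{..<d}. l' k \<noteq> l k}) \<le> e\<^sup>2 * d"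
  shows "hs_dist d (dsign d l x) (dsign d l' x) \<le> e"
proof (rule hs_dist_le)
  have "sqdist d (dsign d l x) (dsign d l' x) \<le>
    (\<Sum>i<d. \<Sum>j<d. if j = i then (if l' i \<noteq> l i then 4 else 0) else 0)"
    by (intro sum_mono) (auto simp: dsign_def lsign_def)
  also have "\<dots> = 4 * (\<Sum>i<d. if l' i \<noteq> l i then 1 else 0)"
    unfolding sum_distrib_left by (intro sum.cong refl) auto
  also have "\<dots> = 4 * real (card {k\<in>{..<d}. l' k \<noteq> l k})" by (simp only: of_bool_sum_card)
  finally show "sqdist d (dsign d l x) (dsign d l' x) \<le> e\<^sup>2 * d"
    using assms by simp
qed (use assms in auto)

definition almost_window ::
    "'a set \<Rightarrow> ('i \<Rightarrow> 'a \<Rightarrow> 'a) \<Rightarrow> 'i set \<Rightarrow> nat \<Rightarrow> (nat \<Rightarrow> 'a set) \<Rightarrow> ('i \<Rightarrow> complex mat) \<Rightarrow> real \<Rightarrow> bool" where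
  "almost_window W p I d l S \<delta> \<longleftrightarrow> (\<forall>k<d. l k \<subseteq> W) \<and> (\<forall>i\<in>I. S i \<in> UU d) \<and>
     (\<forall>i\<in>I. \<forall>x\<in>W. p i x \<in> W \<longrightarrow> hs_dist d (S i * dsign d l x) (dsign d l (p i x) * S i) \<le> \<delta>)"

text \<open>A single \<open>l'\<close> is shared by all of \<open>I\<close>, whereas each
  \<open>S' i\<close> may be chosen on its own.\<close>

definition near_window ::
    "'a set \<Rightarrow> ('i \<Rightarrow> 'a \<Rightarrow> 'a) \<Rightarrow> 'i set \<Rightarrow> nat \<Rightarrow> (nat \<Rightarrow> 'a set) \<Rightarrow> ('i \<Rightarrow> complex mat) \<Rightarrow> real \<Rightarrow> bool" where
  "near_window W p I d l S \<epsilon> \<longleftrightarrow> (\<exists>l' S'. (\<forall>x. hs_dist d (dsign d l x) (dsign d l' x) \<le> \<epsilon>) \<and>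
     (\<forall>i\<in>I. S' i \<in> UU d \<and> hs_dist d (S i) (S' i) \<le> \<epsilon> \<and> implements W (p i) d l' (S' i)))"

lemma exact_window_representation:
  fixes p :: "'i \<Rightarrow> 'a \<Rightarrow> 'a" and \<epsilon> :: real
  assumes W: "finite W" and eps: "\<epsilon> > 0"
  shows "\<exists>\<delta>>0. \<forall>d\<ge>1. \<forall>l S. almost_window W p I d l S \<delta> \<longrightarrow> near_window W p I d l S \<epsilon>"
proof -
  \<comment> \<open>Two coarsenings of a label: the marks before the move and the marks found after
    it, the latter pulled back along \<open>p i\<close> so that both are subsets of the same set of
    positions.\<close>
  define \<alpha> where "\<alpha> i w = {x\<in>W. p i x \<in> W \<and> x \<in> w}" for i w
  define \<beta> where "\<beta> i w = {x\<in>W. p i x \<in> W \<and> p i x \<in> w}" for i w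
  have comp: "compatible W (p i) w v \<longleftrightarrow> \<beta> i v = \<alpha> i w" for i w v
    by (auto simp: compatible_def \<alpha>_def \<beta>_def)
  \<comment> \<open>Chosen so that the mass outside the pattern after relabelling, at most
    \<open>2 * e * d\<close> from before and \<open>2 * e * d\<close> from relabelled rows and
    columns, is \<open>(\<epsilon> / 3)\<^sup>2 * d\<close>; the block correction then costs
    \<open>2 * (\<epsilon> / 3) + \<epsilon> / 3\<close>.\<close>
  define e where "e = \<epsilon>\<^sup>2 / 36"
  have e: "e > 0" using eps by (simp add: e_def)
  obtain \<delta>' :: real where d': "\<delta>' > 0" and R: "\<And>(d::nat) l. (\<And>k. k < d \<Longrightarrow> l k \<in> Pow W) \<Longrightarrow>
      (\<And>i u. i \<in> I \<Longrightarrow> \<bar>real (card {k\<in>{..<d}. \<alpha> i (l k) = u}) - real (card {k\<in>{..<d}. \<beta> i (l k) = u})\<bar> \<le> \<delta>' * d) \<Longrightarrow>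
      \<exists>l'. (\<forall>k<d. l' k \<in> Pow W) \<and> card {k\<in>{..<d}. l' k \<noteq> l k} \<le> e * d \<and>
        (\<forall>i\<in>I. \<forall>u. card {k\<in>{..<d}. \<alpha> i (l' k) = u} = card {k\<in>{..<d}. \<beta> i (l' k) = u})"
  \<comment> \<open>The empty label has empty coarsenings on both sides for every \<open>i\<close>,
    so it can absorb the surplus indices.\<close>
  proof (rule balanced_relabelling[where \<Omega> = "Pow W" and \<epsilon> = e and z = "{}" and I = I and \<alpha> = \<alpha> and \<beta> = \<beta>], goal_cases)
    case (5 \<delta>)
    show ?case by (rule 5(1)[OF 5(2) 5(3)])
  qed (use W e in \<open>auto simp: \<alpha>_def \<beta>_def\<close>)
  define b where "b = min (2 * e) \<delta>'"
  have b: "b > 0" using e d' by (simp add: b_def)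
  \<comment> \<open>The bound 1 allows the square of \<delta> to be estimated by \<delta>
    itself.\<close>
  define \<delta> where "\<delta> = min 1 (b / (card W + 1))"
  have dpos: "\<delta> > 0" using b by (simp add: \<delta>_def)
  have db: "card W * \<delta>\<^sup>2 / 4 \<le> b"
  proof -
    have "\<delta>\<^sup>2 \<le> \<delta> * 1" unfolding power2_eq_square using dpos by (intro mult_left_mono) (auto simp: \<delta>_def)
    then have "card W * \<delta>\<^sup>2 \<le> (card W + 1) * (b / (card W + 1))"
      using dpos by (intro mult_mono) (auto simp: \<delta>_def)
    then have "card W * \<delta>\<^sup>2 \<le> b" by simp
    moreover have "0 \<le> card W * \<delta>\<^sup>2" by simp
    ultimately show ?thesis by linarith
  qed
  show ?thesis
  proof (intro exI[of _ \<delta>] conjI dpos allI impI)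
    fix d :: nat and l S
    assume d: "d \<ge> 1" and aw: "almost_window W p I d l S \<delta>"
    have l: "l k \<subseteq> W" if "k < d" for k using aw that by (simp add: almost_window_def)
    have S: "S i \<in> UU d" if "i \<in> I" for i using aw that by (simp add: almost_window_def)
    have eq: "hs_dist d (S i * dsign d l x) (dsign d l (p i x) * S i) \<le> \<delta>"
      if "i \<in> I" "x \<in> W" "p i x \<in> W" for i x using aw that by (simp add: almost_window_def)
    have mass: "offmass d (\<lambda>j k. \<beta> i (l j) = \<alpha> i (l k)) (S i) \<le> b * d" if i: "i \<in> I" for i
    proof -
      let ?W = "{x\<in>W. p i x \<in> W}"
      have "offmass d (\<lambda>j k. \<beta> i (l j) = \<alpha> i (l k)) (S i) \<le> card ?W * \<delta>\<^sup>2 / 4 * d"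
        by (rule incompatible_mass[where l = l and l' = l and p = "p i"])
           (use S[OF i] d W eq[OF i] in \<open>auto simp: \<alpha>_def \<beta>_def lsign_eq_iff\<close>)
      also have "\<dots> \<le> card W * \<delta>\<^sup>2 / 4 * d"
        using W by (intro mult_right_mono divide_right_mono) (auto intro: card_mono)
      also have "\<dots> \<le> b * d" using db by (intro mult_right_mono) auto
      finally show ?thesis .
    qed
    have "\<exists>l'. (\<forall>k<d. l' k \<in> Pow W) \<and> card {k\<in>{..<d}. l' k \<noteq> l k} \<le> e * d \<and>
        (\<forall>i\<in>I. \<forall>u. card {k\<in>{..<d}. \<alpha> i (l' k) = u} = card {k\<in>{..<d}. \<beta> i (l' k) = u})"
    proof (rule R)
      fix i u assume i: "i \<in> I"
      have "b * d \<le> \<delta>' * d" by (intro mult_right_mono) (auto simp: b_def)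
      then show "\<bar>real (card {k\<in>{..<d}. \<alpha> i (l k) = u}) - real (card {k\<in>{..<d}. \<beta> i (l k) = u})\<bar> \<le> \<delta>' * d"
        using unitary_fibre_balance[OF S[OF i], of "\<lambda>k. \<alpha> i (l k)" u "\<lambda>k. \<beta> i (l k)"] mass[OF i] by linarith
    qed (use l in auto)
    then obtain l' where l': "\<And>k. k < d \<Longrightarrow> l' k \<subseteq> W" "card {k\<in>{..<d}. l' k \<noteq> l k} \<le> e * d"
      and bal: "\<And>i u. i \<in> I \<Longrightarrow> card {k\<in>{..<d}. \<alpha> i (l' k) = u} = card {k\<in>{..<d}. \<beta> i (l' k) = u}" by blast
    have ex: "\<exists>U\<in>UU d. (\<forall>j<d. \<forall>k<d. U $$ (j, k) \<noteq> 0 \<longrightarrow> \<beta> i (l' j) = \<alpha> i (l' k)) \<and> hs_dist d (S i) U \<le> 2 * (\<epsilon> / 3) + \<epsilon> / 3"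
      if i: "i \<in> I" for i
    proof -
      obtain \<pi> where pi: "bij_betw \<pi> {..<d} {..<d}" "\<And>k. k < d \<Longrightarrow> \<beta> i (l' (\<pi> k)) = \<alpha> i (l' k)"
        using fibre_matching[where d = d and a = "\<lambda>k. \<alpha> i (l' k)" and b = "\<lambda>k. \<beta> i (l' k)"] bal[OF i] by auto
      have "offmass d (\<lambda>j k. \<beta> i (l' j) = \<alpha> i (l' k)) (S i) \<le> b * d + 2 * (e * d)"
        using incompatible_mass_relabel[OF S[OF i], of "\<lambda>v w. \<beta> i v = \<alpha> i w" l' l] mass[OF i] l'(2) by linarith
      also have "\<dots> \<le> 2 * e * d + 2 * (e * d)" by (intro add_right_mono mult_right_mono) (auto simp: b_def)
      also have "\<dots> = (\<epsilon> / 3)\<^sup>2 * d" by (simp add: e_def power_divide)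
      finally show ?thesis using S[OF i] d pi eps by (intro block_unitary[where \<pi> = \<pi>]) auto
    qed
    then obtain S' where S': "\<And>i. i \<in> I \<Longrightarrow> S' i \<in> UU d \<and> hs_dist d (S i) (S' i) \<le> 2 * (\<epsilon> / 3) + \<epsilon> / 3 \<and>
       (\<forall>j<d. \<forall>k<d. S' i $$ (j, k) \<noteq> 0 \<longrightarrow> \<beta> i (l' j) = \<alpha> i (l' k))" by metis
    show "near_window W p I d l S \<epsilon>" unfolding near_window_def
    proof (intro exI[of _ l'] exI[of _ S'] conjI allI ballI impI)
      fix x
      have "4 * real (card {k\<in>{..<d}. l' k \<noteq> l k}) \<le> 4 * (e * d)" using l'(2) by simp
      also have "\<dots> = (\<epsilon>\<^sup>2 / 9) * d" by (simp add: e_def)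
      also have "\<dots> \<le> \<epsilon>\<^sup>2 * d" by (intro mult_right_mono) auto
      finally show "hs_dist d (dsign d l x) (dsign d l' x) \<le> \<epsilon>"
        using d eps by (intro hs_dist_dsign_relabel) auto
    qed (use l' S' comp in \<open>auto simp: implements_def\<close>)
  qed
qed

section \<open>Lamp groups\<close>

text \<open>The elements of the groups are triples: the set of lit lamps, the permutation of the positions,
  and, in place of an element of the free group on \<open>s\<close> and \<open>t\<close>, the values of the corresponding
  word at all pairs \<open>(S, T)\<close> of unitary \<open>d \<times> d\<close> matrices. Every such pair thus extends to a
  representation by evaluation.\<close>
type_synonym lamp = "int set \<times> (int \<Rightarrow> int) \<times> (nat \<times> complex mat \<times> complex mat \<Rightarrow> complex mat)"

abbreviation pinv :: "('a \<Rightarrow> 'b) \<Rightarrow> 'b \<Rightarrow> 'a" where "pinv p \<equiv> inv_into UNIV p"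

text \<open>One ambient group for all \<tau>: the symmetric difference is addition in the direct sum
  of copies of Z/2, on which the second component acts by moving positions.\<close>

definition wreath :: "lamp monoid" where
  "wreath =
     \<lparr>carrier = {(L, p, F). finite L \<and> bij p \<and> (\<forall>d S T. F (d, S, T) \<in> UU d)},
      monoid.mult = (\<lambda>(L, p, F) (L', p', F'). ((L - p ` L') \<union> (p ` L' - L), p \<circ> p', \<lambda>i. F i * F' i)),
      one = ({}, id, \<lambda>(d, S, T). 1\<^sub>m d)\<rparr>"

abbreviation wreath_mult (infixl "\<star>" 70) where "(\<star>) \<equiv> monoid.mult wreath"

lemma wreath_carrier [simp]:
  "(L, p, F) \<in> carrier wreath \<longleftrightarrow> finite L \<and> bij p \<and> (\<forall>d S T. F (d, S, T) \<in> UU d)"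
  by (simp add: wreath_def)

lemma wreath_mult [simp]:
  "(L, p, F) \<star> (L', p', F') = ((L - p ` L') \<union> (p ` L' - L), p \<circ> p', \<lambda>i. F i * F' i)"
  by (simp add: wreath_def)

lemma wreath_one: "\<one>\<^bsub>wreath\<^esub> = ({}, id, \<lambda>(d, S, T). 1\<^sub>m d)"
  by (simp add: wreath_def)

lemma group_wreath: "group wreath"
proof (rule groupI)
  fix g h assume "g \<in> carrier wreath" "h \<in> carrier wreath"
  then show "g \<star> h \<in> carrier wreath"
    by (cases g; cases h) (auto intro: bij_comp)
next
  show "\<one>\<^bsub>wreath\<^esub> \<in> carrier wreath" by (simp add: wreath_one)
next
  fix g h k assume *: "g \<in> carrier wreath" "h \<in> carrier wreath" "k \<in> carrier wreath"
  obtain L p F L' p' F' L'' p'' F'' where [simp]: "g = (L, p, F)" "h = (L', p', F')" "k = (L'', p'', F'')"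
    by (cases g; cases h; cases k)
  have "inj p" using * by (auto simp: bij_def)
  then have "p ` (L' - p' ` L'' \<union> (p' ` L'' - L')) = (p ` L' - p ` p' ` L'') \<union> (p ` p' ` L'' - p ` L')"
    by (simp add: image_Un image_set_diff)
  moreover have "F i * F' i * F'' i = F i * (F' i * F'' i)" for i
    using * by (cases i) (auto intro!: MM_assoc)
  ultimately show "g \<star> h \<star> k = g \<star> (h \<star> k)"
    by (auto simp: image_comp comp_assoc)
next
  fix g assume *: "g \<in> carrier wreath"
  obtain L p F where [simp]: "g = (L, p, F)" by (cases g)
  have p: "bij p" using * by simp
  have "(\<lambda>(d, S, T). adj (F (d, S, T)) * F (d, S, T)) = (\<lambda>(d, S, T). 1\<^sub>m d)"
    using * by (auto simp: UU_iff fun_eq_iff)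
  then show "\<one>\<^bsub>wreath\<^esub> \<star> g = g"
    using * by (auto simp: wreath_one fun_eq_iff)
  have "(pinv p ` L, pinv p, \<lambda>i. adj (F i)) \<star> g = \<one>\<^bsub>wreath\<^esub>"
    using * by (auto simp: wreath_one fun_eq_iff UU_iff bij_is_inj)
  moreover have "(pinv p ` L, pinv p, \<lambda>i. adj (F i)) \<in> carrier wreath"
    using * by (auto intro: bij_imp_bij_inv)
  ultimately show "\<exists>h\<in>carrier wreath. h \<star> g = \<one>\<^bsub>wreath\<^esub>" by blast
qed

lemma wreath_inv:
  assumes "(L, p, F) \<in> carrier wreath"
  shows "inv\<^bsub>wreath\<^esub> (L, p, F) = (pinv p ` L, pinv p, \<lambda>i. adj (F i))"
proof (rule group.inv_equality[OF group_wreath])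
  show "(pinv p ` L, pinv p, \<lambda>i. adj (F i)) \<star> (L, p, F) = \<one>\<^bsub>wreath\<^esub>"
    using assms by (auto simp: wreath_one fun_eq_iff UU_iff bij_is_inj)
qed (use assms in \<open>auto intro: bij_imp_bij_inv\<close>)

definition lamp_a :: "int \<Rightarrow> lamp" where
  "lamp_a x = ({x}, id, \<lambda>(d, S, T). 1\<^sub>m d)"

text \<open>The third component is a coordinate function. Where its argument is not a unitary of
  size \<open>d\<close> the value is 1, so that it is unitary at every index, as membership in the
  carrier demands.\<close>

definition lamp_s :: lamp where
  "lamp_s = ({}, \<lambda>x. x + 1, \<lambda>(d, S, T). if S \<in> UU d then S else 1\<^sub>m d)"

definition lamp_t :: "(int \<Rightarrow> int) \<Rightarrow> lamp" where
  "lamp_t \<tau> = ({}, \<tau>, \<lambda>(d, S, T). if T \<in> UU d then T else 1\<^sub>m d)"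

definition lamp_gens :: "(int \<Rightarrow> int) \<Rightarrow> lamp set" where
  "lamp_gens \<tau> = {lamp_a 0, lamp_s, lamp_t \<tau>}"

definition lamp_group :: "(int \<Rightarrow> int) \<Rightarrow> lamp monoid" where
  "lamp_group \<tau> = wreath\<lparr>carrier := generate wreath (lamp_gens \<tau>)\<rparr>"

lemma lamp_group_sel [simp]:
  "(\<otimes>\<^bsub>lamp_group \<tau>\<^esub>) = (\<star>)" "\<one>\<^bsub>lamp_group \<tau>\<^esub> = \<one>\<^bsub>wreath\<^esub>"
  by (simp_all add: lamp_group_def)

lemma bij_shift: "bij (\<lambda>x::int. x + 1)"
  by (rule bij_betw_byWitness[where f' = "\<lambda>x. x - 1"]) auto

lemma lamp_gens_carrier: "bij \<tau> \<Longrightarrow> lamp_gens \<tau> \<subseteq> carrier wreath"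
  by (auto simp: lamp_gens_def lamp_a_def lamp_s_def lamp_t_def bij_shift)

lemma lamp_subgroup: "bij \<tau> \<Longrightarrow> subgroup (carrier (lamp_group \<tau>)) wreath"
  using group.generate_is_subgroup[OF group_wreath lamp_gens_carrier] by (simp add: lamp_group_def)

lemma group_lamp_group: "bij \<tau> \<Longrightarrow> group (lamp_group \<tau>)"
  using subgroup.subgroup_is_group[OF lamp_subgroup group_wreath] by (simp add: lamp_group_def)

lemma lamp_gens_lamp_group: "lamp_gens \<tau> \<subseteq> carrier (lamp_group \<tau>)"
  by (auto simp: lamp_group_def intro: generate.incl)

lemma lamp_group_ambient: "bij \<tau> \<Longrightarrow> g \<in> carrier (lamp_group \<tau>) \<Longrightarrow> g \<in> carrier wreath"
  using subgroup.subset[OF lamp_subgroup] by auto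

lemma lamp_group_inv: "bij \<tau> \<Longrightarrow> g \<in> carrier (lamp_group \<tau>) \<Longrightarrow> inv\<^bsub>lamp_group \<tau>\<^esub> g = inv\<^bsub>wreath\<^esub> g"
  using group.m_inv_consistent[OF group_wreath lamp_subgroup] by (simp add: lamp_group_def)

lemma finite_generating_set_lamp:
  assumes "bij \<tau>" shows "finite_generating_set (lamp_group \<tau>) (lamp_gens \<tau>)"
proof -
  have "generate (lamp_group \<tau>) (lamp_gens \<tau>) = carrier (lamp_group \<tau>)"
    using group.generate_consistent[OF group_wreath lamp_gens_lamp_group lamp_subgroup[OF assms]]
    by (simp add: lamp_group_def)
  then show ?thesis using lamp_gens_lamp_group by (auto simp: finite_generating_set_def lamp_gens_def)
qed

section \<open>Word balls and the locality of their elements\<close>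

abbreviation lamp_ball :: "(int \<Rightarrow> int) \<Rightarrow> nat \<Rightarrow> lamp set" where
  "lamp_ball \<tau> \<equiv> word_ball (lamp_group \<tau>) (lamp_gens \<tau>)"

lemma word_ball_mono: "m \<le> n \<Longrightarrow> word_ball G S m \<subseteq> word_ball G S n"
  by (auto simp: word_ball_def intro: order_trans)

lemma (in group) word_ball_closed:
  assumes S: "S \<subseteq> carrier G"
  shows word_ball_carrier: "word_ball G S n \<subseteq> carrier G"
    and word_ball_mult: "g \<in> word_ball G S m \<Longrightarrow> h \<in> word_ball G S n \<Longrightarrow> g \<otimes> h \<in> word_ball G S (m + n)"
    and word_ball_one: "\<one> \<in> word_ball G S n"
    and word_ball_gen: "x \<in> S \<Longrightarrow> x \<in> word_ball G S 1" "x \<in> S \<Longrightarrow> inv x \<in> word_ball G S 1"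
proof -
  have fc: "foldr (\<otimes>) ws \<one> \<in> carrier G" if "set ws \<subseteq> S \<union> m_inv G ` S" for ws
    using that S by (induction ws) auto
  then show "word_ball G S n \<subseteq> carrier G" by (auto simp: word_ball_def)
  have fa: "foldr (\<otimes>) ws \<one> \<otimes> foldr (\<otimes>) vs \<one> = foldr (\<otimes>) (ws @ vs) \<one>"
    if "set ws \<subseteq> S \<union> m_inv G ` S" "set vs \<subseteq> S \<union> m_inv G ` S" for ws vs
    using that(1)
  proof (induction ws)
    case Nil
    then show ?case using fc[OF that(2)] by simp
  next
    case (Cons w ws)
    have "w \<in> carrier G" using Cons.prems S by auto
    then show ?case using Cons fc[OF that(2)] fc[of ws] by (simp add: m_assoc)
  qed
  show "g \<otimes> h \<in> word_ball G S (m + n)" if "g \<in> word_ball G S m" "h \<in> word_ball G S n"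
  proof -
    from that obtain ws vs where *: "g = foldr (\<otimes>) ws \<one>" "h = foldr (\<otimes>) vs \<one>"
      "set ws \<subseteq> S \<union> m_inv G ` S" "set vs \<subseteq> S \<union> m_inv G ` S" "length ws \<le> m" "length vs \<le> n"
      by (auto simp: word_ball_def)
    then show ?thesis unfolding word_ball_def using fa[OF *(3,4)] by (auto intro!: exI[of _ "ws @ vs"])
  qed
  show "\<one> \<in> word_ball G S n" unfolding word_ball_def by (auto intro!: exI[of _ "[]"])
  show "x \<in> S \<Longrightarrow> x \<in> word_ball G S 1" unfolding word_ball_def using S by (auto intro!: exI[of _ "[x]"])
  show "x \<in> S \<Longrightarrow> inv x \<in> word_ball G S 1" unfolding word_ball_def using S by (auto intro!: exI[of _ "[inv x]"])
qed

lemma (in group) generate_word_ball: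
  assumes S: "S \<subseteq> carrier G" and "g \<in> generate G S"
  shows "\<exists>n. g \<in> word_ball G S n"
  using assms(2)
proof induction
  case (eng g h)
  then show ?case using word_ball_mult[OF S] by blast
qed (use word_ball_one[OF S] word_ball_gen[OF S] in blast)+

text \<open>\<open>local_at R d l S T n g\<close>: the lamps of \<open>g\<close> lie within distance \<open>n\<close>, and on labels, \<open>g\<close> acts
  through \<open>S\<close> and \<open>T\<close> as it acts on positions, except within distance \<open>n\<close> of the boundary of
  the window \<open>[-R, R]\<close>.\<close>
definition local_at :: "int \<Rightarrow> nat \<Rightarrow> (nat \<Rightarrow> int set) \<Rightarrow> complex mat \<Rightarrow> complex mat \<Rightarrow> int \<Rightarrow> lamp \<Rightarrow> bool" where
  "local_at R d l S T n = (\<lambda>(L, p, F). L \<subseteq> {- n..n} \<and> (\<forall>x. \<bar>p x - x\<bar> \<le> n) \<and>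
     (\<forall>j<d. \<forall>k<d. F (d, S, T) $$ (j, k) \<noteq> 0 \<longrightarrow> (\<forall>x. \<bar>x\<bar> + n \<le> R \<longrightarrow> (x \<in> l k \<longleftrightarrow> p x \<in> l j))))"

lemma local_at_one: "local_at R d l S T 0 \<one>\<^bsub>wreath\<^esub>"
  by (auto simp: local_at_def wreath_one)

lemma local_atI:
  assumes "L \<subseteq> {- n..n}" "\<And>x. \<bar>p x - x\<bar> \<le> n"
    and "\<And>j k x. j < d \<Longrightarrow> k < d \<Longrightarrow> F (d, S, T) $$ (j, k) \<noteq> 0 \<Longrightarrow> \<bar>x\<bar> + n \<le> R \<Longrightarrow> x \<in> l k \<longleftrightarrow> p x \<in> l j"
  shows "local_at R d l S T n (L, p, F)"
  using assms unfolding local_at_def prod.case by blast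

lemma local_atD:
  assumes "local_at R d l S T n (L, p, F)"
  shows "L \<subseteq> {- n..n}" "\<bar>p x - x\<bar> \<le> n"
    "j < d \<Longrightarrow> k < d \<Longrightarrow> F (d, S, T) $$ (j, k) \<noteq> 0 \<Longrightarrow> \<bar>x\<bar> + n \<le> R \<Longrightarrow> x \<in> l k \<longleftrightarrow> p x \<in> l j"
  using assms unfolding local_at_def prod.case by blast+

lemma local_at_mono:
  assumes "local_at R d l S T m g" "m \<le> n"
  shows "local_at R d l S T n g"
proof -
  obtain L p F where g: "g = (L, p, F)" by (cases g)
  note D = local_atD[OF assms(1)[unfolded g]]
  show ?thesis unfolding g
  proof (rule local_atI)
    show "L \<subseteq> {- n..n}" using assms(2) by (intro order_trans[OF D(1)]) simp
    show "\<bar>p x - x\<bar> \<le> n" for x using D(2)[of x] assms(2) by linarith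
    show "x \<in> l k \<longleftrightarrow> p x \<in> l j" if "j < d" "k < d" "F (d, S, T) $$ (j, k) \<noteq> 0" "\<bar>x\<bar> + n \<le> R" for j k x
      using D(3)[OF that(1-3), of x] that(4) assms(2) by simp
  qed
qed

text \<open>A nonzero entry of a product passes through an index \<open>i\<close> at which both
  factors have nonzero entries, and the second factor moves a position by at most \<open>n\<close>
  towards the boundary.\<close>

lemma local_at_mult:
  assumes "g \<in> carrier wreath" "h \<in> carrier wreath"
    and "local_at R d l S T m g" "local_at R d l S T n h"
  shows "local_at R d l S T (m + n) (g \<star> h)"
proof -
  obtain L p F L' p' F' where [simp]: "g = (L, p, F)" "h = (L', p', F')" by (cases g; cases h)
  have FM: "F (d, S, T) \<in> MM d" "F' (d, S, T) \<in> MM d" using assms by auto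
  have L: "L \<subseteq> {- m..m}" "L' \<subseteq> {- n..n}" and p: "\<bar>p x - x\<bar> \<le> m" "\<bar>p' x - x\<bar> \<le> n" for x
    using assms(3,4) by (auto simp: local_at_def)
  have mn: "0 \<le> m" "0 \<le> n" using p[of 0] by auto
  have "p ` L' \<subseteq> {- (m + n)..m + n}"
  proof
    fix y assume "y \<in> p ` L'"
    then obtain x where x: "x \<in> L'" "y = p x" by auto
    then have "- n \<le> x \<and> x \<le> n" using L(2) by auto
    then have "- (m + n) \<le> y \<and> y \<le> m + n" using p(1)[of x] unfolding x(2) by linarith
    then show "y \<in> {- (m + n)..m + n}" by simp
  qed
  moreover have "L \<subseteq> {- (m + n)..m + n}" using mn by (intro order_trans[OF L(1)]) simp
  moreover have "\<bar>p (p' x) - x\<bar> \<le> m + n" for x using p(1)[of "p' x"] p(2)[of x] by linarith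
  moreover have "x \<in> l k \<longleftrightarrow> p (p' x) \<in> l j"
    if jk: "j < d" "k < d" "(F (d, S, T) * F' (d, S, T)) $$ (j, k) \<noteq> 0" and x: "\<bar>x\<bar> + (m + n) \<le> R" for j k x
  proof -
    have "(\<Sum>i<d. F (d, S, T) $$ (j, i) * F' (d, S, T) $$ (i, k)) \<noteq> 0"
      using mult_index[OF FM jk(1,2)] jk(3) by simp
    then obtain i where i: "i < d" "F (d, S, T) $$ (j, i) \<noteq> 0" "F' (d, S, T) $$ (i, k) \<noteq> 0"
      by (metis (no_types, lifting) lessThan_iff mult_eq_0_iff sum.neutral)
    have "x \<in> l k \<longleftrightarrow> p' x \<in> l i" using assms(4) i jk x mn by (auto simp: local_at_def)
    also have "\<dots> \<longleftrightarrow> p (p' x) \<in> l j" using assms(3) i jk x p(2)[of x] by (auto simp: local_at_def)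
    finally show ?thesis .
  qed
  ultimately show ?thesis unfolding local_at_def by auto
qed

text \<open>For the inverses, the entry of an adjoint at \<open>(j, k)\<close> is nonzero just if
  the original one at \<open>(k, j)\<close> is; compatibility is then read backwards.\<close>

lemma local_at_gens:
  assumes tau: "bij \<tau>" "\<And>x. \<bar>\<tau> x - x\<bar> \<le> 1" and ST: "S \<in> UU d" "T \<in> UU d"
    and S: "implements {- R..R} (\<lambda>x. x + 1) d l S"
    and T: "implements {- R..R} \<tau> d l T"
    and g: "g \<in> lamp_gens \<tau>"
  shows "local_at R d l S T 1 g" "local_at R d l S T 1 (inv\<^bsub>wreath\<^esub> g)"
proof -
  have inv_tau: "\<tau> (pinv \<tau> x) = x" for x using tau(1) by (simp add: bij_is_surj surj_f_inv_f)
  have tau': "\<bar>pinv \<tau> x - x\<bar> \<le> 1" for x using tau(2)[of "pinv \<tau> x"] by (simp add: inv_tau abs_minus_commute)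
  have inv_s: "pinv (\<lambda>x::int. x + 1) = (\<lambda>x. x - 1)" by (rule inv_equality) auto
  have STM: "S \<in> MM d" "T \<in> MM d" using ST by auto
  have gc: "g \<in> carrier wreath" using g lamp_gens_carrier[OF tau(1)] by auto
  consider "g = lamp_a 0" | "g = lamp_s" | "g = lamp_t \<tau>" using g by (auto simp: lamp_gens_def)
  then have "local_at R d l S T 1 g \<and> local_at R d l S T 1 (inv\<^bsub>wreath\<^esub> g)"
  proof cases
    case 1
    then show ?thesis using gc by (auto simp: lamp_a_def wreath_inv local_at_def)
  next
    case 2
    have a: "x \<in> l k \<longleftrightarrow> x + 1 \<in> l j" if "S $$ (j, k) \<noteq> 0" "j < d" "k < d" "\<bar>x\<bar> + 1 \<le> R" for j k x
      using compatibleD[OF implementsD[OF S that(2,3,1)], of x] that(4) by auto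
    have b: "x \<in> l k \<longleftrightarrow> x - 1 \<in> l j" if "S $$ (k, j) \<noteq> 0" "j < d" "k < d" "\<bar>x\<bar> + 1 \<le> R" for j k x
      using compatibleD[OF implementsD[OF S that(3,2,1)], of "x - 1"] that(4) by auto
    have "local_at R d l S T 1 g" unfolding 2 lamp_s_def
      by (rule local_atI) (use a ST in auto)
    moreover have "local_at R d l S T 1 (inv\<^bsub>wreath\<^esub> g)"
      unfolding 2 lamp_s_def wreath_inv[OF gc[unfolded 2 lamp_s_def]] inv_s image_empty
      by (rule local_atI) (use b STM ST in auto)
    ultimately show ?thesis ..
  next
    case 3
    have a: "x \<in> l k \<longleftrightarrow> \<tau> x \<in> l j" if "T $$ (j, k) \<noteq> 0" "j < d" "k < d" "\<bar>x\<bar> + 1 \<le> R" for j k x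
    proof -
      have "- R \<le> x \<and> x \<le> R \<and> - R \<le> \<tau> x \<and> \<tau> x \<le> R" using that(4) tau(2)[of x] by linarith
      then show ?thesis using compatibleD[OF implementsD[OF T that(2,3,1)], of x] by auto
    qed
    have b: "x \<in> l k \<longleftrightarrow> pinv \<tau> x \<in> l j" if "T $$ (k, j) \<noteq> 0" "j < d" "k < d" "\<bar>x\<bar> + 1 \<le> R" for j k x
    proof -
      have "- R \<le> x \<and> x \<le> R \<and> - R \<le> pinv \<tau> x \<and> pinv \<tau> x \<le> R" using that(4) tau'[of x] by linarith
      then show ?thesis using compatibleD[OF implementsD[OF T that(3,2,1)], of "pinv \<tau> x"] by (auto simp: inv_tau)
    qed
    have "local_at R d l S T 1 g" unfolding 3 lamp_t_def
      by (rule local_atI) (use a ST tau(2) in auto)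
    moreover have "local_at R d l S T 1 (inv\<^bsub>wreath\<^esub> g)"
      unfolding 3 lamp_t_def wreath_inv[OF gc[unfolded 3 lamp_t_def]] image_empty
      by (rule local_atI) (use b STM ST tau' in auto)
    ultimately show ?thesis ..
  qed
  then show "local_at R d l S T 1 g" "local_at R d l S T 1 (inv\<^bsub>wreath\<^esub> g)" by auto
qed

lemma local_at_word_ball:
  assumes tau: "bij \<tau>" "\<And>x. \<bar>\<tau> x - x\<bar> \<le> 1" and ST: "S \<in> UU d" "T \<in> UU d"
    and S: "implements {- R..R} (\<lambda>x. x + 1) d l S"
    and T: "implements {- R..R} \<tau> d l T"
    and g: "g \<in> lamp_ball \<tau> n"
  shows "local_at R d l S T (int n) g"
proof -
  obtain ws where ws: "g = foldr (\<star>) ws \<one>\<^bsub>wreath\<^esub>"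
      "set ws \<subseteq> lamp_gens \<tau> \<union> m_inv (lamp_group \<tau>) ` lamp_gens \<tau>" "length ws \<le> n"
    using g by (auto simp: word_ball_def)
  interpret group "lamp_group \<tau>" by (rule group_lamp_group[OF tau(1)])
  have "m_inv (lamp_group \<tau>) ` lamp_gens \<tau> \<subseteq> carrier (lamp_group \<tau>)"
    using lamp_gens_lamp_group[of \<tau>] by (intro image_subsetI inv_closed) blast
  then have car: "set ws \<subseteq> carrier (lamp_group \<tau>)" using ws(2) lamp_gens_lamp_group[of \<tau>] by blast
  have "foldr (\<star>) ws \<one>\<^bsub>wreath\<^esub> \<in> carrier (lamp_group \<tau>) \<and>
     local_at R d l S T (int (length ws)) (foldr (\<star>) ws \<one>\<^bsub>wreath\<^esub>)"
    using ws(2) car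
  proof (induction ws)
    case Nil
    then show ?case using local_at_one one_closed by simp
  next
    case (Cons w ws)
    have w: "local_at R d l S T 1 w"
    proof -
      note gens = local_at_gens[where l = l and R = R, OF tau ST S T]
      from Cons.prems(1) consider "w \<in> lamp_gens \<tau>" | g where "g \<in> lamp_gens \<tau>" "w = inv\<^bsub>lamp_group \<tau>\<^esub> g" by auto
      then show ?thesis
      proof cases
        case 2
        then have "w = inv\<^bsub>wreath\<^esub> g" using lamp_group_inv[OF tau(1)] lamp_gens_lamp_group[of \<tau>] by blast
        then show ?thesis using gens(2)[OF 2(1)] by simp
      qed (rule gens(1))
    qed
    have IH: "foldr (\<star>) ws \<one>\<^bsub>wreath\<^esub> \<in> carrier (lamp_group \<tau>)"
      "local_at R d l S T (int (length ws)) (foldr (\<star>) ws \<one>\<^bsub>wreath\<^esub>)" using Cons by auto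
    have wc: "w \<in> carrier (lamp_group \<tau>)" using Cons.prems by auto
    show ?case using m_closed[OF wc IH(1)] local_at_mult[OF _ _ w IH(2)] lamp_group_ambient[OF tau(1)] wc IH(1) by simp
  qed
  from this[THEN conjunct2] show ?thesis unfolding ws(1) by (rule local_at_mono) (use ws(3) in simp)
qed

section \<open>Representing a ball by diagonal signs and two unitaries\<close>

definition lamp_diag :: "nat \<Rightarrow> (nat \<Rightarrow> int set) \<Rightarrow> int set \<Rightarrow> complex mat" where
  "lamp_diag d l L = dg d (\<lambda>k. of_real (\<Prod>x\<in>L. lsign (l k) x))"

definition lamp_rep :: "nat \<Rightarrow> (nat \<Rightarrow> int set) \<Rightarrow> complex mat \<Rightarrow> complex mat \<Rightarrow> lamp \<Rightarrow> complex mat" where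
  "lamp_rep d l S T = (\<lambda>(L, p, F). lamp_diag d l L * F (d, S, T))"

lemma prod_lsign_cases: "(\<Prod>x\<in>L. lsign w x) = 1 \<or> (\<Prod>x\<in>L. lsign w x) = - 1"
  by (induction L rule: infinite_finite_induct) (auto simp: lsign_def)

lemma lamp_diag_UU [simp]: "lamp_diag d l L \<in> UU d"
  unfolding lamp_diag_def using prod_lsign_cases[of _ L] by (intro dg_UU) (metis norm_minus_cancel norm_of_real abs_1 abs_minus norm_one of_real_1)

lemma prod_lsign_sym_diff:
  assumes "finite L" "finite M"
  shows "(\<Prod>x\<in>(L - M) \<union> (M - L). lsign w x) = (\<Prod>x\<in>L. lsign w x) * (\<Prod>x\<in>M. lsign w x)"
proof -
  have sq: "lsign w x * lsign w x = 1" for x by (simp add: lsign_def)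
  let ?P = "\<lambda>A. \<Prod>x\<in>A. lsign w x"
  have "?P L = ?P (L - M) * ?P (L \<inter> M)" "?P M = ?P (M - L) * ?P (L \<inter> M)"
    using prod.Int_Diff[OF assms(1), of "lsign w" M] prod.Int_Diff[OF assms(2), of "lsign w" L]
    by (simp_all add: Int_commute mult.commute)
  moreover have "?P (L \<inter> M) * ?P (L \<inter> M) = 1" by (simp add: sq flip: prod.distrib)
  moreover have "?P ((L - M) \<union> (M - L)) = ?P (L - M) * ?P (M - L)"
    using assms by (intro prod.union_disjoint) auto
  ultimately show ?thesis by (simp add: mult_ac)
qed

text \<open>The only point is to move the matrix of the first factor past the lamps of the second.
  These lie within \<open>r\<close> of 0, and locality of the first factor holds up to
  \<open>R - r\<close>, whence \<open>2 * r \<le> R\<close>.\<close>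

lemma lamp_rep_mult:
  assumes gh: "g \<in> carrier wreath" "h \<in> carrier wreath"
    and loc: "local_at R d l S T r g" "local_at R d l S T r h" and R: "2 * r \<le> R"
  shows "lamp_rep d l S T (g \<star> h) = lamp_rep d l S T g * lamp_rep d l S T h"
proof -
  obtain L p F L' p' F' where [simp]: "g = (L, p, F)" "h = (L', p', F')" by (cases g; cases h)
  let ?F = "F (d, S, T)" and ?F' = "F' (d, S, T)"
  have FM: "?F \<in> MM d" "?F' \<in> MM d" using gh by auto
  have p: "inj_on p L'" using gh by (auto simp: bij_def intro: inj_on_subset)
  have comm: "?F * lamp_diag d l L' = lamp_diag d l (p ` L') * ?F"
  proof (rule eq_matI)
    fix j k assume "j < dim_row (lamp_diag d l (p ` L') * ?F)" "k < dim_col (lamp_diag d l (p ` L') * ?F)"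
    then have jk: "j < d" "k < d" using FM by (auto simp: lamp_diag_def)
    have "(\<Prod>x\<in>p ` L'. lsign (l j) x) = (\<Prod>x\<in>L'. lsign (l k) x)" if nz: "?F $$ (j, k) \<noteq> 0"
    proof -
      have "(\<Prod>x\<in>p ` L'. lsign (l j) x) = (\<Prod>x\<in>L'. lsign (l j) (p x))" by (simp add: prod.reindex[OF p])
      also have "\<dots> = (\<Prod>x\<in>L'. lsign (l k) x)"
      proof (rule prod.cong[OF refl])
        fix x assume "x \<in> L'"
        then have "\<bar>x\<bar> + r \<le> R" using loc(2) R by (auto simp: local_at_def subset_iff abs_if)
        then show "lsign (l j) (p x) = lsign (l k) x"
          using loc(1) nz jk by (auto simp: local_at_def lsign_eq_iff)
      qed
      finally show ?thesis .
    qed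
    then show "(?F * lamp_diag d l L') $$ (j, k) = (lamp_diag d l (p ` L') * ?F) $$ (j, k)"
      unfolding lamp_diag_def dg_mult_left[OF FM(1) jk] dg_mult_right[OF FM(1) jk]
      by (cases "?F $$ (j, k) = 0") (auto simp: mult.commute)
  qed (use FM in \<open>auto simp: lamp_diag_def\<close>)
  have split: "lamp_diag d l ((L - p ` L') \<union> (p ` L' - L)) = lamp_diag d l L * lamp_diag d l (p ` L')"
    unfolding lamp_diag_def dg_mult using gh by (intro dg_cong) (simp add: prod_lsign_sym_diff)
  have DM: "lamp_diag d l M \<in> MM d" for M by (rule UU_MM) simp
  have "lamp_rep d l S T g * lamp_rep d l S T h = lamp_diag d l L * ((?F * lamp_diag d l L') * ?F')"
    using FM DM by (simp add: lamp_rep_def MM_assoc[of _ d])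
  also have "\<dots> = lamp_diag d l L * lamp_diag d l (p ` L') * (?F * ?F')"
    unfolding comm using FM DM by (simp add: MM_assoc[of _ d])
  finally show ?thesis by (simp add: lamp_rep_def split)
qed

lemma lamp_rep_UU: "g \<in> carrier wreath \<Longrightarrow> lamp_rep d l S T g \<in> UU d"
  by (cases g) (auto simp: lamp_rep_def)

lemma lamp_rep_a: "lamp_rep d l S T (lamp_a x) = dsign d l x"
  using MM_one(1)[OF dsign_MM] by (simp add: lamp_rep_def lamp_a_def lamp_diag_def dsign_def)

lemma lamp_rep_s: "S \<in> UU d \<Longrightarrow> lamp_rep d l S T lamp_s = S"
  using MM_one(2)[OF UU_MM] by (simp add: lamp_rep_def lamp_s_def lamp_diag_def dg_one)

lemma lamp_rep_t: "T \<in> UU d \<Longrightarrow> lamp_rep d l S T (lamp_t \<tau>) = T"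
  using MM_one(2)[OF UU_MM] by (simp add: lamp_rep_def lamp_t_def lamp_diag_def dg_one)

lemma lamp_local_rep:
  assumes tau: "bij \<tau>" "\<And>x. \<bar>\<tau> x - x\<bar> \<le> 1" and ST: "S \<in> UU d" "T \<in> UU d" and V: "V \<in> UU d"
    and S: "implements {- int (2 * r)..int (2 * r)} (\<lambda>x. x + 1) d l S"
    and T: "implements {- int (2 * r)..int (2 * r)} \<tau> d l T"
  shows "local_rep (lamp_group \<tau>) (lamp_gens \<tau>) r d (\<lambda>g. uconj V (lamp_rep d l S T g))"
proof -
  let ?B = "lamp_ball \<tau> r"
  have car: "g \<in> carrier wreath" if "g \<in> ?B" for g
    using that group.word_ball_carrier[OF group_lamp_group[OF tau(1)] lamp_gens_lamp_group]
      lamp_group_ambient[OF tau(1)] by blast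
  show ?thesis unfolding local_rep_def
  proof (intro conjI ballI impI)
    show "(\<lambda>g. uconj V (lamp_rep d l S T g)) \<in> ?B \<rightarrow> UU d"
      using car lamp_rep_UU V by auto
    fix g h assume gh: "g \<in> ?B" "h \<in> ?B"
    have "lamp_rep d l S T (g \<star> h) = lamp_rep d l S T g * lamp_rep d l S T h"
      by (rule lamp_rep_mult[OF car[OF gh(1)] car[OF gh(2)] local_at_word_ball[where l = l and R = "int (2 * r)", OF tau ST S T gh(1)] local_at_word_ball[where l = l and R = "int (2 * r)", OF tau ST S T gh(2)]]) auto
    then show "uconj V (lamp_rep d l S T (g \<otimes>\<^bsub>lamp_group \<tau>\<^esub> h)) = uconj V (lamp_rep d l S T g) * uconj V (lamp_rep d l S T h)"
      using uconj_mult[OF V] lamp_rep_UU[OF car[OF gh(1)], of d l S T] lamp_rep_UU[OF car[OF gh(2)], of d l S T] by simp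
  qed
qed

section \<open>Local stability\<close>

lemma lamp_mult_simps:
  "lamp_a x \<star> lamp_a x = \<one>\<^bsub>wreath\<^esub>"
  "lamp_a x \<star> lamp_a y = lamp_a y \<star> lamp_a x"
  "lamp_s \<star> lamp_a x = lamp_a (x + 1) \<star> lamp_s"
  "lamp_t \<tau> \<star> lamp_a x = lamp_a (\<tau> x) \<star> lamp_t \<tau>"
  by (auto simp: lamp_a_def lamp_s_def lamp_t_def wreath_one fun_eq_iff split: prod.splits)

lemma lamp_a_ambient [simp]: "lamp_a x \<in> carrier wreath"
  by (simp add: lamp_a_def)

lemma lamp_s_conj:
  "lamp_s \<star> lamp_a x \<star> inv\<^bsub>wreath\<^esub> lamp_s = lamp_a (x + 1)"
  "inv\<^bsub>wreath\<^esub> lamp_s \<star> lamp_a (x + 1) \<star> lamp_s = lamp_a x"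
proof -
  interpret group wreath by (rule group_wreath)
  have s: "lamp_s \<in> carrier wreath" by (simp add: lamp_s_def bij_shift)
  then show "lamp_s \<star> lamp_a x \<star> inv\<^bsub>wreath\<^esub> lamp_s = lamp_a (x + 1)"
    unfolding lamp_mult_simps by (simp add: m_assoc)
  have "inv\<^bsub>wreath\<^esub> lamp_s \<star> lamp_a (x + 1) \<star> lamp_s =
      inv\<^bsub>wreath\<^esub> lamp_s \<star> (lamp_s \<star> lamp_a x)"
    using s by (simp add: lamp_mult_simps(3) m_assoc)
  also have "\<dots> = lamp_a x" using s by (simp flip: m_assoc)
  finally show "inv\<^bsub>wreath\<^esub> lamp_s \<star> lamp_a (x + 1) \<star> lamp_s = lamp_a x" .
qed

text \<open>The lamp at \<open>x\<close> is the lamp at 0 conjugated by the power \<open>x\<close>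
  of \<open>s\<close>: \<bar>x\<bar> letters on each side and one in the middle.\<close>

lemma lamp_a_ball:
  assumes tau: "bij \<tau>"
  shows "lamp_a x \<in> lamp_ball \<tau> (2 * nat \<bar>x\<bar> + 1)"
proof -
  interpret group "lamp_group \<tau>" by (rule group_lamp_group[OF tau])
  note gens = lamp_gens_lamp_group[of \<tau>]
  have sg: "lamp_s \<in> lamp_gens \<tau>" "lamp_a 0 \<in> lamp_gens \<tau>" by (auto simp: lamp_gens_def)
  have sc: "lamp_s \<in> carrier wreath" "lamp_s \<in> carrier (lamp_group \<tau>)"
    using sg lamp_gens_carrier[OF tau] gens by auto
  let ?i = "inv\<^bsub>wreath\<^esub> lamp_s"
  have i: "inv\<^bsub>lamp_group \<tau>\<^esub> lamp_s = ?i" by (rule lamp_group_inv[OF tau sc(2)])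
  note ball_gen = word_ball_gen[OF gens] and ball_mult = word_ball_mult[OF gens, unfolded lamp_group_sel]
  note up = lamp_s_conj(1) and down = lamp_s_conj(2)
  have pos: "lamp_a (int n) \<in> lamp_ball \<tau> (2 * n + 1)" for n
  proof (induction n)
    case 0
    then show ?case using ball_gen(1)[OF sg(2)] by simp
  next
    case (Suc n)
    have "lamp_s \<star> lamp_a (int n) \<star> ?i \<in> lamp_ball \<tau> (1 + (2 * n + 1) + 1)"
      using ball_mult[OF ball_mult[OF ball_gen(1)[OF sg(1)] Suc] ball_gen(2)[OF sg(1), unfolded i]] .
    then show ?case unfolding up by (simp add: add.commute)
  qed
  have neg: "lamp_a (- int n) \<in> lamp_ball \<tau> (2 * n + 1)" for n
  proof (induction n)
    case 0
    then show ?case using ball_gen(1)[OF sg(2)] by simp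
  next
    case (Suc n)
    have "?i \<star> lamp_a (- int n) \<star> lamp_s \<in> lamp_ball \<tau> (1 + (2 * n + 1) + 1)"
      using ball_mult[OF ball_mult[OF ball_gen(2)[OF sg(1), unfolded i] Suc] ball_gen(1)[OF sg(1)]] .
    then show ?case using down[of "- int (Suc n)"] by (simp add: add.commute)
  qed
  show ?thesis
  proof (cases "x \<ge> 0")
    case True
    then show ?thesis using pos[of "nat x"] by simp
  next
    case False
    then show ?thesis using neg[of "nat (- x)"] by simp
  qed
qed

lemma lamp_locally_stable:
  assumes tau: "bij \<tau>" "\<And>x. \<bar>\<tau> x - x\<bar> \<le> 1"
  shows "locally_hs_stable_wrt (lamp_group \<tau>) (lamp_gens \<tau>)"
  unfolding locally_hs_stable_wrt_def
proof (intro allI impI)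
  fix \<epsilon> :: real and r :: nat assume eps: "\<epsilon> > 0" and r: "r \<ge> 1"
  interpret group "lamp_group \<tau>" by (rule group_lamp_group[OF tau(1)])
  let ?R = "int (2 * r)"
  define W where "W = {- ?R..?R}"
  have W: "finite W" by (simp add: W_def)
  \<comment> \<open>The two moves are indexed by truth values: \<open>False\<close> for
    \<open>s\<close> and \<open>True\<close> for \<open>t\<close>.\<close>
  define p where "p i = (if i then \<tau> else (\<lambda>x. x + 1))" for i
  obtain \<delta>1 :: real where d1: "\<delta>1 > 0"
    and exact: "\<forall>d\<ge>1. \<forall>l S. almost_window W p UNIV d l S \<delta>1 \<longrightarrow> near_window W p UNIV d l S (\<epsilon> / 3)"
    using exact_window_representation[OF W, of "\<epsilon> / 3" p UNIV] eps by auto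
  \<comment> \<open>Replacing lamps by their diagonal models costs \<open>2 * e\<close> and swapping
    a generator with a lamp \<open>2 * \<delta>\<close>; quarters of \<open>\<delta>1\<close> make
    the sum at most \<open>\<delta>1\<close>. The thirds of \<epsilon> serve the final comparison at
    the generators.\<close>
  define e where "e = min (\<epsilon> / 3) (\<delta>1 / 4)"
  have e: "e > 0" using eps d1 by (simp add: e_def)
  obtain \<delta>2 where d2: "\<delta>2 > 0" "approx_diagonalizable W \<delta>2 e"
    using almost_commuting_involutions[OF W e] by blast
  define \<delta> where "\<delta> = min (\<delta>2 / 2) (\<delta>1 / 4)"
  \<comment> \<open>Lamps in the window have length at most \<open>4 * r + 1\<close>, so products of
    two lamps, and of a lamp with a generator, stay inside the ball.\<close>
  define n where "n = 8 * r + 4"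
  let ?B = "lamp_ball \<tau>"
  show "\<exists>\<delta>>0. \<exists>n\<ge>1. \<forall>d\<ge>1. \<forall>\<phi>. almost_rep (lamp_group \<tau>) (lamp_gens \<tau>) n \<delta> d \<phi> \<longrightarrow>
      (\<exists>f. local_rep (lamp_group \<tau>) (lamp_gens \<tau>) r d f \<and> (\<forall>s\<in>lamp_gens \<tau>. hs_dist d (\<phi> s) (f s) < \<epsilon>))"
  proof (intro exI[of _ \<delta>] exI[of _ n] conjI allI impI)
    show "\<delta> > 0" using d1 d2 by (simp add: \<delta>_def)
    show "1 \<le> n" by (simp add: n_def)
    fix d :: nat and \<phi> assume d: "d \<ge> 1" and phi: "almost_rep (lamp_group \<tau>) (lamp_gens \<tau>) n \<delta> d \<phi>"
    have up: "g \<in> ?B n" if "g \<in> ?B m" "m \<le> n" for g m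
      using word_ball_mono[OF that(2), of "lamp_group \<tau>" "lamp_gens \<tau>"] that(1) by blast
    have U: "\<phi> g \<in> UU d" if "g \<in> ?B n" for g using phi that by (auto simp: almost_rep_def)
    have M: "hs_dist d (\<phi> (g \<star> h)) (\<phi> g * \<phi> h) \<le> \<delta>"
      if "g \<in> ?B n" "h \<in> ?B n" "g \<star> h \<in> ?B n" for g h
      using phi that by (auto simp: almost_rep_def)
    note gens = lamp_gens_lamp_group[of \<tau>]
    note ball_mult = word_ball_mult[OF gens, unfolded lamp_group_sel]
    have one: "\<one>\<^bsub>wreath\<^esub> \<in> ?B n" using word_ball_one[OF gens] by simp
    \<comment> \<open>Both products are within \<delta> of the value of \<open>\<phi>\<close> at the
      common group element.\<close>
    have swap: "hs_dist d (\<phi> g * \<phi> h) (\<phi> g' * \<phi> h') \<le> 2 * \<delta>"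
      if "g \<in> ?B n" "h \<in> ?B n" "g' \<in> ?B n" "h' \<in> ?B n" "g \<star> h \<in> ?B n"
        "g \<star> h = g' \<star> h'" for g h g' h'
    proof -
      let ?p = "\<phi> (g \<star> h)"
      have "hs_dist d (\<phi> g * \<phi> h) (\<phi> g' * \<phi> h') \<le> hs_dist d (\<phi> g * \<phi> h) ?p + hs_dist d ?p (\<phi> g' * \<phi> h')"
        using U that by (intro hs_dist_triangle) auto
      also have "hs_dist d (\<phi> g * \<phi> h) ?p = hs_dist d ?p (\<phi> g * \<phi> h)"
        using U that by (intro hs_dist_commute) auto
      also have "hs_dist d ?p (\<phi> g * \<phi> h) \<le> \<delta>" using M that by blast
      also have "hs_dist d ?p (\<phi> g' * \<phi> h') \<le> \<delta>" using M[OF that(3,4)] that(5,6) by simp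
      finally show ?thesis by simp
    qed
    have phi1: "hs_dist d (\<phi> \<one>\<^bsub>wreath\<^esub>) (1\<^sub>m d) \<le> \<delta>"
    proof -
      let ?o = "\<phi> \<one>\<^bsub>wreath\<^esub>"
      have oo: "\<one>\<^bsub>wreath\<^esub> \<star> \<one>\<^bsub>wreath\<^esub> = \<one>\<^bsub>wreath\<^esub>"
        using group.is_monoid[OF group_wreath] by (simp add: monoid.l_one monoid.one_closed)
      have "hs_dist d ?o (1\<^sub>m d) = hs_dist d (?o * ?o) (?o * 1\<^sub>m d)"
        using U[OF one] by (intro hs_dist_left[symmetric]) auto
      also have "\<dots> = hs_dist d ?o (?o * ?o)" using U[OF one] UU_MM[OF U[OF one]] by (simp add: hs_dist_commute[of _ d])
      also have "\<dots> \<le> \<delta>" using M[OF one one] one oo by simp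
      finally show ?thesis .
    qed
    have aB: "lamp_a x \<in> ?B (4 * r + 1)" if "x \<in> W" for x
      using that lamp_a_ball[OF tau(1), of x] word_ball_mono[of "2 * nat \<bar>x\<bar> + 1" "4 * r + 1"] by (force simp: W_def)
    have aBn: "lamp_a x \<in> ?B n" if "x \<in> W" for x
      by (rule up[OF aB[OF that]]) (simp add: n_def)
    have gB: "lamp_s \<in> ?B 1" "lamp_t \<tau> \<in> ?B 1" using word_ball_gen(1)[OF gens] by (auto simp: lamp_gens_def)
    have gBn: "lamp_s \<in> ?B n" "lamp_t \<tau> \<in> ?B n" using up[OF gB(1)] up[OF gB(2)] by (auto simp: n_def)
    obtain V l where V: "V \<in> UU d" and l: "\<And>k. k < d \<Longrightarrow> l k \<subseteq> W"
      and Vl: "\<And>x. x \<in> W \<Longrightarrow> hs_dist d (\<phi> (lamp_a x)) (uconj V (dsign d l x)) \<le> e"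
    proof (rule approx_diagonalizableD[OF d2(2) d, of "\<lambda>x. \<phi> (lamp_a x)"])
      fix x assume x: "x \<in> W"
      show "\<phi> (lamp_a x) \<in> UU d" using U[OF aBn[OF x]] .
      have "hs_dist d (\<phi> (lamp_a x) * \<phi> (lamp_a x)) (1\<^sub>m d) \<le>
        hs_dist d (\<phi> (lamp_a x) * \<phi> (lamp_a x)) (\<phi> \<one>\<^bsub>wreath\<^esub>) + hs_dist d (\<phi> \<one>\<^bsub>wreath\<^esub>) (1\<^sub>m d)"
        using U[OF aBn[OF x]] U[OF one] by (intro hs_dist_triangle) auto
      also have "hs_dist d (\<phi> (lamp_a x) * \<phi> (lamp_a x)) (\<phi> \<one>\<^bsub>wreath\<^esub>) =
          hs_dist d (\<phi> \<one>\<^bsub>wreath\<^esub>) (\<phi> (lamp_a x) * \<phi> (lamp_a x))"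
        using U[OF aBn[OF x]] U[OF one] by (intro hs_dist_commute) auto
      also have "\<dots> \<le> \<delta>" using M[OF aBn[OF x] aBn[OF x]] one by (simp add: lamp_mult_simps(1))
      finally show "hs_dist d (\<phi> (lamp_a x) * \<phi> (lamp_a x)) (1\<^sub>m d) \<le> \<delta>2" using phi1 unfolding \<delta>_def by linarith
      fix y assume y: "y \<in> W"
      have "lamp_a x \<star> lamp_a y \<in> ?B n"
        by (rule up[OF ball_mult[OF aB[OF x] aB[OF y]]]) (simp add: n_def)
      then have "hs_dist d (\<phi> (lamp_a x) * \<phi> (lamp_a y)) (\<phi> (lamp_a y) * \<phi> (lamp_a x)) \<le> 2 * \<delta>"
        using aBn x y by (intro swap) (auto simp: lamp_mult_simps(2)[of x y])
      then show "hs_dist d (\<phi> (lamp_a x) * \<phi> (lamp_a y)) (\<phi> (lamp_a y) * \<phi> (lamp_a x)) \<le> \<delta>2" unfolding \<delta>_def by linarith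
    qed blast
    define g where "g i = (if i then lamp_t \<tau> else lamp_s)" for i
    have gU: "\<phi> (g i) \<in> UU d" for i using U gBn by (simp add: g_def)
    define S where "S i = uconj (adj V) (\<phi> (g i))" for i
    have SU: "S i \<in> UU d" for i using V gU by (simp add: S_def)
    have VS: "uconj V (S i) = \<phi> (g i)" for i unfolding S_def using V gU by (simp add: uconj_adj_cancel)
    have eq: "hs_dist d (S i * dsign d l x) (dsign d l (p i x) * S i) \<le> \<delta>1" if x: "x \<in> W" "p i x \<in> W" for i x
    proof -
      let ?C = "\<lambda>x. uconj V (dsign d l x)" and ?A = "\<lambda>x. \<phi> (lamp_a x)"
      have CU: "?C x \<in> UU d" for x using V by simp
      have AU: "?A x \<in> UU d" if "x \<in> W" for x using U[OF aBn[OF that]] .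
      have "hs_dist d (S i * dsign d l x) (dsign d l (p i x) * S i) = hs_dist d (\<phi> (g i) * ?C x) (?C (p i x) * \<phi> (g i))"
        using hs_dist_uconj[OF V, of "S i * dsign d l x" "dsign d l (p i x) * S i"] V SU UU_MM[OF SU] VS by (simp add: uconj_mult[of _ d])
      also have "\<dots> \<le> hs_dist d (\<phi> (g i) * ?C x) (\<phi> (g i) * ?A x) + hs_dist d (\<phi> (g i) * ?A x) (?C (p i x) * \<phi> (g i))"
        using gU CU AU x by (intro hs_dist_triangle) auto
      also have "hs_dist d (\<phi> (g i) * ?A x) (?C (p i x) * \<phi> (g i)) \<le>
          hs_dist d (\<phi> (g i) * ?A x) (?A (p i x) * \<phi> (g i)) + hs_dist d (?A (p i x) * \<phi> (g i)) (?C (p i x) * \<phi> (g i))"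
        using gU CU AU x by (intro hs_dist_triangle) auto
      also have "hs_dist d (\<phi> (g i) * ?C x) (\<phi> (g i) * ?A x) = hs_dist d (?A x) (?C x)"
        using gU CU AU x hs_dist_commute[OF UU_MM[OF AU[OF x(1)]] UU_MM[OF CU]] by (simp add: hs_dist_left)
      also have "hs_dist d (?A (p i x) * \<phi> (g i)) (?C (p i x) * \<phi> (g i)) = hs_dist d (?A (p i x)) (?C (p i x))"
        using gU CU AU x by (intro hs_dist_right) auto
      also have "hs_dist d (\<phi> (g i) * ?A x) (?A (p i x) * \<phi> (g i)) \<le> 2 * \<delta>"
      proof (rule swap)
        show "g i \<star> lamp_a x \<in> ?B n"
          using up[OF ball_mult[OF gB(1) aB[OF x(1)]]] up[OF ball_mult[OF gB(2) aB[OF x(1)]]]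
          by (auto simp: n_def g_def)
      qed (use gBn aBn x in \<open>auto simp: g_def p_def lamp_mult_simps\<close>)
      finally have "hs_dist d (S i * dsign d l x) (dsign d l (p i x) * S i) \<le> e + (2 * \<delta> + e)"
        using Vl[OF x(1)] Vl[OF x(2)] by linarith
      then show ?thesis unfolding e_def \<delta>_def by linarith
    qed
    have "almost_window W p UNIV d l S \<delta>1" using l SU eq by (simp add: almost_window_def)
    then have "near_window W p UNIV d l S (\<epsilon> / 3)" using exact d by blast
    then obtain l' S' where l': "\<And>x. hs_dist d (dsign d l x) (dsign d l' x) \<le> \<epsilon> / 3"
      and S': "\<And>i. S' i \<in> UU d" "\<And>i. hs_dist d (S i) (S' i) \<le> \<epsilon> / 3" "\<And>i. implements W (p i) d l' (S' i)"
      unfolding near_window_def by blast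
    let ?f = "\<lambda>g. uconj V (lamp_rep d l' (S' False) (S' True) g)"
    show "\<exists>f. local_rep (lamp_group \<tau>) (lamp_gens \<tau>) r d f \<and> (\<forall>s\<in>lamp_gens \<tau>. hs_dist d (\<phi> s) (f s) < \<epsilon>)"
    proof (intro exI[of _ ?f] conjI ballI)
      show "local_rep (lamp_group \<tau>) (lamp_gens \<tau>) r d ?f"
        using S'(3)[of False] S'(3)[of True] by (intro lamp_local_rep[OF tau S'(1) S'(1) V]) (simp_all add: W_def p_def)
      have W0: "0 \<in> W" by (simp add: W_def)
      have a: "hs_dist d (\<phi> (lamp_a 0)) (?f (lamp_a 0)) < \<epsilon>"
      proof -
        have "hs_dist d (\<phi> (lamp_a 0)) (uconj V (dsign d l' 0)) \<le>
          hs_dist d (\<phi> (lamp_a 0)) (uconj V (dsign d l 0)) + hs_dist d (uconj V (dsign d l 0)) (uconj V (dsign d l' 0))"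
          using U[OF aBn[OF W0]] V by (intro hs_dist_triangle) auto
        also have "hs_dist d (uconj V (dsign d l 0)) (uconj V (dsign d l' 0)) = hs_dist d (dsign d l 0) (dsign d l' 0)"
          using V by (intro hs_dist_uconj) auto
        finally show ?thesis using Vl[OF W0] l'[of 0] eps unfolding lamp_rep_a e_def by linarith
      qed
      have gi: "hs_dist d (\<phi> (g i)) (uconj V (S' i)) < \<epsilon>" for i
      proof -
        have "hs_dist d (uconj V (S i)) (uconj V (S' i)) = hs_dist d (S i) (S' i)"
          using V SU S' by (intro hs_dist_uconj) auto
        then show ?thesis using S'(2)[of i] eps by (simp add: VS)
      qed
      fix s assume "s \<in> lamp_gens \<tau>"
      then show "hs_dist d (\<phi> s) (?f s) < \<epsilon>"
        using a gi[of False] gi[of True] S' by (auto simp: lamp_gens_def lamp_rep_s lamp_rep_t g_def)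
    qed
  qed
qed

section \<open>Failure of stability\<close>

lemma finite_word_ball: "finite S \<Longrightarrow> finite (word_ball G S n)"
proof -
  assume "finite S"
  then have "finite {ws. set ws \<subseteq> S \<union> m_inv G ` S \<and> length ws \<le> n}" by (intro finite_lists_length_le) auto
  moreover have "word_ball G S n = (\<lambda>ws. foldr (\<otimes>\<^bsub>G\<^esub>) ws \<one>\<^bsub>G\<^esub>) ` {ws. set ws \<subseteq> S \<union> m_inv G ` S \<and> length ws \<le> n}"
    by (auto simp: word_ball_def)
  ultimately show ?thesis by simp
qed

lemma hom_unitary:
  assumes "group G" "\<pi> \<in> hom G (unitary_group d)"
  shows "g \<in> carrier G \<Longrightarrow> \<pi> g \<in> UU d"
    and "g \<in> carrier G \<Longrightarrow> h \<in> carrier G \<Longrightarrow> \<pi> (g \<otimes>\<^bsub>G\<^esub> h) = \<pi> g * \<pi> h"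
    and "\<pi> \<one>\<^bsub>G\<^esub> = 1\<^sub>m d"
    and "g \<in> carrier G \<Longrightarrow> \<pi> (inv\<^bsub>G\<^esub> g) = adj (\<pi> g)"
proof -
  interpret group_hom G "unitary_group d" \<pi>
    using assms group_unitary_group by (simp add: group_hom_def group_hom_axioms_def)
  show U: "g \<in> carrier G \<Longrightarrow> \<pi> g \<in> UU d" by simp
  show "g \<in> carrier G \<Longrightarrow> h \<in> carrier G \<Longrightarrow> \<pi> (g \<otimes>\<^bsub>G\<^esub> h) = \<pi> g * \<pi> h" by simp
  show "\<pi> \<one>\<^bsub>G\<^esub> = 1\<^sub>m d" using hom_one by simp
  show "g \<in> carrier G \<Longrightarrow> \<pi> (inv\<^bsub>G\<^esub> g) = adj (\<pi> g)" using U by (simp add: inv_unitary_group)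
qed

text \<open>A generating set witnessing stability is unknown, but \<open>b\<close> is some word of
  length at most \<open>m\<close> in it. A representation that is \<epsilon>-close to the model
  \<open>f\<close> on the letters is \<open>m * \<epsilon>\<close>-close at \<open>b\<close>, while
  \<open>b\<close> is at distance at most 1/4 from 1 in the representation and at least 1 in the
  model.\<close>

lemma (in group) not_hs_stableI:
  assumes b: "b \<in> carrier G"
    and triv: "\<And>d \<pi>. d \<ge> 1 \<Longrightarrow> \<pi> \<in> hom G (unitary_group d) \<Longrightarrow> hs_dist d (\<pi> b) (1\<^sub>m d) \<le> 1 / 4"
    and far: "\<And>E. finite E \<Longrightarrow> E \<subseteq> carrier G \<Longrightarrow> \<exists>d\<ge>1. \<exists>f. (\<forall>g\<in>E. f g \<in> UU d) \<and>
      (\<forall>g\<in>E. \<forall>h\<in>E. f (g \<otimes> h) = f g * f h) \<and> hs_dist d (f b) (1\<^sub>m d) \<ge> 1"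
  shows "\<not> hs_stable G"
proof
  assume "hs_stable G"
  then obtain S where S: "finite S" "S \<subseteq> carrier G" "generate G S = carrier G" and st: "hs_stable_wrt G S"
    by (auto simp: hs_stable_def finite_generating_set_def)
  obtain m where "b \<in> word_ball G S m" using generate_word_ball[OF S(2)] S(3) b by blast
  then obtain ws where ws: "b = foldr (\<otimes>) ws \<one>" "set ws \<subseteq> S \<union> m_inv G ` S" "length ws \<le> m"
    by (auto simp: word_ball_def)
  \<comment> \<open>Makes the accumulated error at \<open>b\<close> at most 1/2, which together with
    1/4 stays below 1.\<close>
  define \<epsilon> where "\<epsilon> = 1 / (2 * (real m + 1))"
  have eps: "\<epsilon> > 0" "real m * \<epsilon> \<le> 1 / 2" by (auto simp: \<epsilon>_def field_simps)
  obtain \<delta> n where d: "\<delta> > 0" and n: "n \<ge> 1" and R: "\<forall>d\<ge>1. \<forall>\<phi>. almost_rep G S n \<delta> d \<phi> \<longrightarrow>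
        (\<exists>\<pi> \<in> hom G (unitary_group d). \<forall>s\<in>S. hs_dist d (\<phi> s) (\<pi> s) < \<epsilon>)"
    using st eps(1) unfolding hs_stable_wrt_def by blast
  define E where "E = word_ball G S (max n m)"
  have mono: "g \<in> E" if "g \<in> word_ball G S k" "k \<le> max n m" for g k
    using word_ball_mono[OF that(2), of G S] that(1) by (auto simp: E_def)
  have "finite E" "E \<subseteq> carrier G"
    using finite_word_ball[OF S(1)] word_ball_carrier[OF S(2)] by (auto simp: E_def)
  from far[OF this] obtain d f where d1: "d \<ge> 1" and fU: "\<And>g. g \<in> E \<Longrightarrow> f g \<in> UU d"
    and fm: "\<And>g h. g \<in> E \<Longrightarrow> h \<in> E \<Longrightarrow> f (g \<otimes> h) = f g * f h" and fb: "hs_dist d (f b) (1\<^sub>m d) \<ge> 1" by blast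
  have nE: "word_ball G S n \<subseteq> E" using mono by auto
  have "almost_rep G S n \<delta> d f"
    unfolding almost_rep_def
  proof (intro conjI ballI impI)
    show "f \<in> word_ball G S n \<rightarrow> UU d" using fU nE by auto
    fix g h assume gh: "g \<in> word_ball G S n" "h \<in> word_ball G S n" "g \<otimes> h \<in> word_ball G S n"
    have "f (g \<otimes> h) = f g * f h" using fm gh nE by blast
    moreover have "f (g \<otimes> h) \<in> MM d" using fU gh nE by blast
    ultimately show "hs_dist d (f (g \<otimes> h)) (f g * f h) \<le> \<delta>" using d by simp
  qed
  then obtain \<pi> where pi: "\<pi> \<in> hom G (unitary_group d)" and close: "\<And>s. s \<in> S \<Longrightarrow> hs_dist d (f s) (\<pi> s) < \<epsilon>"
    using R d1 by blast
  note hu = hom_unitary[OF is_group pi]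
  have one: "\<one> \<in> E" using word_ball_one[OF S(2)] by (auto simp: E_def)
  have f1: "f \<one> = 1\<^sub>m d"
  proof -
    have "f \<one> * f \<one> = f \<one>" using fm[OF one one] by simp
    then have "adj (f \<one>) * (f \<one> * f \<one>) = adj (f \<one>) * f \<one>" by simp
    then show ?thesis using UU_cancel(1)[OF fU[OF one] UU_MM[OF fU[OF one]]] fU[OF one] by (simp add: UU_iff)
  qed
  \<comment> \<open>Being multiplicative on \<open>E\<close>, \<open>f\<close> sends inverses of
    generators to adjoints, and adjoints preserve the distance.\<close>
  have letter: "w \<in> E \<and> hs_dist d (f w) (\<pi> w) \<le> \<epsilon>" if w: "w \<in> S \<union> m_inv G ` S" for w
  proof (cases "w \<in> S")
    case True
    then show ?thesis using close[OF True] mono[OF word_ball_gen(1)[OF S(2) True]] n by auto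
  next
    case False
    then obtain s where s: "s \<in> S" "w = inv s" using w by auto
    have sE: "s \<in> E" "w \<in> E" using mono[OF word_ball_gen(1)[OF S(2) s(1)]] mono[OF word_ball_gen(2)[OF S(2) s(1)]] n s by auto
    have sc: "s \<in> carrier G" using s S by auto
    have "f s * f w = 1\<^sub>m d" using fm[OF sE] f1 sc s by simp
    then have "adj (f s) * (f s * f w) = adj (f s)" using fU[OF sE(1)] by simp
    then have "f w = adj (f s)" using UU_cancel(1)[OF fU[OF sE(1)] UU_MM[OF fU[OF sE(2)]]] by simp
    moreover have "\<pi> w = adj (\<pi> s)" using hu(4)[OF sc] s by simp
    ultimately have "hs_dist d (f w) (\<pi> w) = hs_dist d (f s) (\<pi> s)"
      using fU[OF sE(1)] hu(1)[OF sc] by (simp add: hs_dist_adj)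
    then show ?thesis using close[OF s(1)] sE by simp
  qed
  have "hs_dist d (f (foldr (\<otimes>) vs \<one>)) (\<pi> (foldr (\<otimes>) vs \<one>)) \<le> length vs * \<epsilon>"
    if "set vs \<subseteq> S \<union> m_inv G ` S" "length vs \<le> m" for vs
    using that
  proof (induction vs)
    case Nil
    then show ?case by (simp add: f1 hu(3))
  next
    case (Cons v vs)
    let ?g = "foldr (\<otimes>) vs \<one>"
    have "?g \<in> word_ball G S m" using Cons.prems by (auto simp: word_ball_def)
    then have g: "?g \<in> E" "?g \<in> carrier G" using mono[of ?g m] word_ball_carrier[OF S(2)] by auto
    have v: "v \<in> E" "hs_dist d (f v) (\<pi> v) \<le> \<epsilon>" using letter Cons.prems by auto
    have vc: "v \<in> carrier G" using Cons.prems S by auto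
    have "hs_dist d (f (v \<otimes> ?g)) (\<pi> (v \<otimes> ?g)) = hs_dist d (f v * f ?g) (\<pi> v * \<pi> ?g)"
      using fm[OF v(1) g(1)] hu(2)[OF vc g(2)] by simp
    also have "\<dots> \<le> hs_dist d (f v) (\<pi> v) + hs_dist d (f ?g) (\<pi> ?g)"
      using fU v(1) g hu(1) vc by (intro hs_dist_mult) auto
    also have "\<dots> \<le> \<epsilon> + length vs * \<epsilon>" using Cons v by auto
    finally show ?case by (simp add: algebra_simps)
  qed
  then have "hs_dist d (f b) (\<pi> b) \<le> length ws * \<epsilon>" using ws by simp
  also have "\<dots> \<le> m * \<epsilon>" using ws eps by simp
  finally have "hs_dist d (f b) (\<pi> b) \<le> 1 / 2" using eps by simp
  moreover have "b \<in> E" using mono[of b m] \<open>b \<in> word_ball G S m\<close> by simp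
  then have "hs_dist d (f b) (1\<^sub>m d) \<le> hs_dist d (f b) (\<pi> b) + hs_dist d (\<pi> b) (1\<^sub>m d)"
    using fU hu(1)[OF b] by (intro hs_dist_triangle) auto
  ultimately show False using triv[OF d1 pi] fb by linarith
qed

text \<open>In a finite-dimensional representation two of the lamps at \<open>x < y\<close> coincide up to \<open>\<epsilon>\<close>, since
  there are only \<open>2\<^sup>d\<close> diagonal sign matrices. Shifting, the lamps at \<open>x - y < 0\<close> and \<open>0\<close> coincide,
  and \<open>t\<close> fixes the former and moves the latter to \<open>1\<close>.\<close>
lemma lamp_hom_collapse:
  assumes tau: "bij \<tau>" "\<And>x. x < 0 \<Longrightarrow> \<tau> x = x" "\<tau> 0 = 1"
    and d: "d \<ge> 1" and pi: "\<pi> \<in> hom (lamp_group \<tau>) (unitary_group d)" and eps: "\<epsilon> > 0"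
  shows "hs_dist d (\<pi> (lamp_a 0 \<star> lamp_a 1)) (1\<^sub>m d) \<le> \<epsilon>"
proof -
  interpret group "lamp_group \<tau>" by (rule group_lamp_group[OF tau(1)])
  note hu = hom_unitary[OF is_group pi, unfolded lamp_group_sel]
  have ac: "lamp_a x \<in> carrier (lamp_group \<tau>)" for x
    using lamp_a_ball[OF tau(1)] word_ball_carrier[OF lamp_gens_lamp_group] by blast
  have gc: "lamp_s \<in> carrier (lamp_group \<tau>)" "lamp_t \<tau> \<in> carrier (lamp_group \<tau>)"
    using lamp_gens_lamp_group[of \<tau>] by (auto simp: lamp_gens_def)
  define A where "A x = \<pi> (lamp_a x)" for x
  have AU: "A x \<in> UU d" for x using hu(1)[OF ac] by (simp add: A_def)
  have AM: "A x \<in> MM d" for x using AU by simp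
  have A2: "A x * A x = 1\<^sub>m d" for x
    using hu(2)[OF ac ac, of x x] hu(3) by (simp add: A_def lamp_mult_simps(1))
  have Ac: "A x * A y = A y * A x" for x y
    using hu(2)[OF ac ac, of x y] hu(2)[OF ac ac, of y x] by (simp add: A_def lamp_mult_simps(2)[of x y])
  have gU: "\<pi> lamp_s \<in> UU d" "\<pi> (lamp_t \<tau>) \<in> UU d" using hu(1) gc by auto
  have sA: "\<pi> lamp_s * A x = A (x + 1) * \<pi> lamp_s" for x
    using hu(2)[OF gc(1) ac, of x] hu(2)[OF ac gc(1), of "x + 1"] by (simp add: A_def lamp_mult_simps(3))
  have tA: "\<pi> (lamp_t \<tau>) * A x = A (\<tau> x) * \<pi> (lamp_t \<tau>)" for x
    using hu(2)[OF gc(2) ac, of x] hu(2)[OF ac gc(2), of "\<tau> x"] by (simp add: A_def lamp_mult_simps(4))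
  have shift: "hs_dist d (A (x + 1)) (A (y + 1)) = hs_dist d (A x) (A y)" for x y
    using hs_dist_right[OF gU(1) AM[of "x + 1"] AM[of "y + 1"]] hs_dist_left[OF gU(1) AM[of x] AM[of y]] by (simp add: sA)
  have twist: "hs_dist d (A (\<tau> x)) (A (\<tau> y)) = hs_dist d (A x) (A y)" for x y
    using hs_dist_right[OF gU(2) AM[of "\<tau> x"] AM[of "\<tau> y"]] hs_dist_left[OF gU(2) AM[of x] AM[of y]] by (simp add: tA)
  have shift_nat: "hs_dist d (A (x + int n)) (A (y + int n)) = hs_dist d (A x) (A y)" for x y n
  proof (induction n)
    case (Suc n)
    then show ?case using shift[of "x + int n" "y + int n"] by (simp add: ac_simps)
  qed simp
  have shift_int: "hs_dist d (A (x + z)) (A (y + z)) = hs_dist d (A x) (A y)" for x y z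
    using shift_nat[of x "nat z" y] shift_nat[of "x + z" "nat (- z)" "y + z"] by (cases "z \<ge> 0") auto
  \<comment> \<open>One position more than there are subsets of the index set, so two positions must
    receive the same diagonal signs.\<close>
  define W :: "int set" where "W = {0..<2 ^ d + 1}"
  have W: "finite W" "card W = 2 ^ d + 1" by (simp_all add: W_def nat_add_distrib nat_power_eq)
  \<comment> \<open>The lamps satisfy their relations exactly, so they meet any tolerance. Two
    replacements by diagonal models and the halving of \<epsilon> for the last triangle inequality
    account for the quarter.\<close>
  obtain \<delta> where del: "\<delta> > 0" "approx_diagonalizable W \<delta> (\<epsilon> / 4)"
    using almost_commuting_involutions[OF W(1), of "\<epsilon> / 4"] eps by auto
  obtain V l where V: "V \<in> UU d" and Vl: "\<And>x. x \<in> W \<Longrightarrow> hs_dist d (A x) (uconj V (dsign d l x)) \<le> \<epsilon> / 4"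
  proof (rule approx_diagonalizableD[OF del(2) d, of A])
    show "hs_dist d (A x * A y) (A y * A x) \<le> \<delta>" for x y
      unfolding Ac[of x y] using AM del(1) by simp
  qed (use AU A2 del(1) in auto)
  have "card ((\<lambda>x. {k\<in>{..<d}. x \<in> l k}) ` W) \<le> card (Pow {..<d})"
    by (intro card_mono) auto
  also have "\<dots> < card W" by (simp add: W card_Pow)
  finally have "\<not> inj_on (\<lambda>x. {k\<in>{..<d}. x \<in> l k}) W" by (rule pigeonhole)
  then obtain u v where uv: "u \<in> W" "v \<in> W" "u \<noteq> v" "{k\<in>{..<d}. u \<in> l k} = {k\<in>{..<d}. v \<in> l k}"
    unfolding inj_on_def by blast
  obtain x y where xy: "x \<in> W" "y \<in> W" "x < y" "{k\<in>{..<d}. x \<in> l k} = {k\<in>{..<d}. y \<in> l k}"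
    using that[OF uv(1,2) _ uv(4)] that[OF uv(2,1) _ uv(4)[symmetric]] uv(3) by linarith
  have "dsign d l x = dsign d l y" unfolding dsign_def using xy(4) by (intro dg_cong) (auto simp: lsign_def)
  moreover have "hs_dist d (A x) (A y) \<le> hs_dist d (A x) (uconj V (dsign d l x)) + hs_dist d (uconj V (dsign d l x)) (A y)"
    using AM V by (intro hs_dist_triangle) auto
  moreover have "hs_dist d (uconj V (dsign d l y)) (A y) = hs_dist d (A y) (uconj V (dsign d l y))"
    using AM V by (intro hs_dist_commute) auto
  ultimately have "hs_dist d (A x) (A y) \<le> \<epsilon> / 2" using Vl[OF xy(1)] Vl[OF xy(2)] by simp
  then have near: "hs_dist d (A (x - y)) (A 0) \<le> \<epsilon> / 2" using shift_int[of x "- y" y] by simp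
  have "hs_dist d (A (x - y)) (A 1) = hs_dist d (A (x - y)) (A 0)"
    using twist[of "x - y" 0] tau(2)[of "x - y"] tau(3) xy(3) by simp
  moreover have "hs_dist d (A 0) (A 1) \<le> hs_dist d (A 0) (A (x - y)) + hs_dist d (A (x - y)) (A 1)"
    using AM by (intro hs_dist_triangle)
  ultimately have "hs_dist d (A 0) (A 1) \<le> \<epsilon>" using near hs_dist_commute[OF AM[of 0] AM[of "x - y"]] by simp
  moreover have "hs_dist d (A 0 * A 1) (1\<^sub>m d) = hs_dist d (A 0) (A 1)"
    using hs_dist_right[OF AU[of 1] AM[of 0] AM[of 1]] by (simp add: A2)
  moreover have "\<pi> (lamp_a 0 \<star> lamp_a 1) = A 0 * A 1"
    using hu(2)[OF ac ac] by (simp add: A_def)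
  ultimately show ?thesis by simp
qed

section \<open>Permutation models of finite windows\<close>

lemma permutation_extension:
  assumes W: "finite W" and p: "inj_on p {x\<in>W. p x \<in> W}"
  obtains \<sigma> where "bij_betw \<sigma> W W" "\<And>x. x \<in> W \<Longrightarrow> p x \<in> W \<Longrightarrow> \<sigma> x = p x"
proof -
  let ?A = "{x\<in>W. p x \<in> W}"
  have b1: "bij_betw p ?A (p ` ?A)" using p by (simp add: bij_betw_def)
  have "card (W - ?A) = card (W - p ` ?A)"
    using W card_image[OF p] by (subst (1 2) card_Diff_subset) auto
  then obtain q where b2: "bij_betw q (W - ?A) (W - p ` ?A)"
    using finite_same_card_bij[of "W - ?A" "W - p ` ?A"] W by auto
  define \<sigma> where "\<sigma> x = (if x \<in> ?A then p x else q x)" for x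
  have "bij_betw \<sigma> (?A \<union> (W - ?A)) (p ` ?A \<union> (W - p ` ?A))"
  proof (rule bij_betw_combine)
    show "bij_betw \<sigma> ?A (p ` ?A)" using b1 by (subst bij_betw_cong[where g = p]) (auto simp: \<sigma>_def)
    show "bij_betw \<sigma> (W - ?A) (W - p ` ?A)" using b2 by (subst bij_betw_cong[where g = q]) (auto simp: \<sigma>_def)
  qed auto
  moreover have "?A \<union> (W - ?A) = W" "p ` ?A \<union> (W - p ` ?A) = W" by auto
  ultimately have "bij_betw \<sigma> W W" by simp
  then show ?thesis using that by (auto simp: \<sigma>_def)
qed

text \<open>The basis is indexed by all subsets of the window. The move, completed arbitrarily to a
  permutation \<sigma> of the window, permutes these subsets; compatibility only looks at positions
  where \<sigma> agrees with \<open>p\<close>.\<close>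

lemma permutation_model:
  assumes W: "finite W" and p: "inj_on p {x\<in>W. p x \<in> W}" and l: "bij_betw l {..<d} (Pow W)"
  shows "\<exists>S\<in>UU d. implements W p d l S"
proof -
  obtain \<sigma> where s: "bij_betw \<sigma> W W" "\<And>x. x \<in> W \<Longrightarrow> p x \<in> W \<Longrightarrow> \<sigma> x = p x"
    using permutation_extension[OF W p] by blast
  define \<kappa> where "\<kappa> = the_inv_into {..<d} l \<circ> (image \<sigma> \<circ> l)"
  have k: "bij_betw \<kappa> {..<d} {..<d}" unfolding \<kappa>_def
    using l bij_betw_Pow[OF s(1)] bij_betw_the_inv_into[OF l] by (intro bij_betw_trans[OF bij_betw_trans])
  have lk: "l (\<kappa> k) = \<sigma> ` l k" if "k < d" for k
  proof -
    have "\<sigma> ` l k \<in> Pow W" using bij_betwE[OF l] bij_betwE[OF bij_betw_Pow[OF s(1)]] that by auto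
    then show ?thesis using f_the_inv_into_f_bij_betw[OF l] by (simp add: \<kappa>_def)
  qed
  \<comment> \<open>\<open>row_perm d \<pi> (1\<^sub>m d)\<close> has its nonzero entries at
    \<open>(j, k)\<close> with \<open>\<pi> j = k\<close>, so the inverse of \<kappa> is what sends
    basis vector \<open>k\<close> to \<open>\<kappa> k\<close>.\<close>
  define \<pi> where "\<pi> = the_inv_into {..<d} \<kappa>"
  have pi: "bij_betw \<pi> {..<d} {..<d}" unfolding \<pi>_def by (rule bij_betw_the_inv_into[OF k])
  have kp: "\<kappa> (\<pi> j) = j" "\<pi> j < d" if "j < d" for j
    using f_the_inv_into_f_bij_betw[OF k] bij_betwE[OF pi] that by (auto simp: \<pi>_def)
  show ?thesis
  proof (intro bexI[of _ "row_perm d \<pi> (1\<^sub>m d)"])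
    show "row_perm d \<pi> (1\<^sub>m d) \<in> UU d" by (rule row_perm_UU[OF UU_one pi])
    show "implements W p d l (row_perm d \<pi> (1\<^sub>m d))" unfolding implements_def
    proof (intro allI impI)
      fix j k assume jk: "j < d" "k < d" "row_perm d \<pi> (1\<^sub>m d) $$ (j, k) \<noteq> 0"
      then have "\<pi> j = k" using kp(2)[OF jk(1)] by (auto split: if_splits)
      then have lj: "l j = \<sigma> ` l k" using lk[OF jk(2)] kp(1)[OF jk(1)] by simp
      have lW: "l k \<subseteq> W" using bij_betwE[OF l] jk by auto
      have "x \<in> l k \<longleftrightarrow> p x \<in> l j" if x: "x \<in> W" "p x \<in> W" for x
      proof -
        have "\<sigma> x \<in> \<sigma> ` l k \<longleftrightarrow> x \<in> l k"
          using s(1) lW x by (auto simp: bij_betw_def inj_on_def)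
        then show ?thesis using s(2)[OF x] lj by simp
      qed
      then show "compatible W p (l k) (l j)" unfolding compatible_def by blast
    qed
  qed
qed

lemma lamp_far_models:
  assumes tau: "bij \<tau>" "\<And>x. \<bar>\<tau> x - x\<bar> \<le> 1" and E: "finite E" "E \<subseteq> carrier (lamp_group \<tau>)"
  shows "\<exists>d\<ge>1. \<exists>f. (\<forall>g\<in>E. f g \<in> UU d) \<and>
    (\<forall>g\<in>E. \<forall>h\<in>E. f (g \<star> h) = f g * f h) \<and>
    hs_dist d (f (lamp_a 0 \<star> lamp_a 1)) (1\<^sub>m d) \<ge> 1"
proof -
  interpret group "lamp_group \<tau>" by (rule group_lamp_group[OF tau(1)])
  let ?B = "lamp_ball \<tau>"
  have "\<exists>n. g \<in> ?B n" if "g \<in> E" for g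
  proof -
    have "g \<in> generate (lamp_group \<tau>) (lamp_gens \<tau>)"
      using that E(2) finite_generating_set_lamp[OF tau(1)] unfolding finite_generating_set_def by blast
    then show ?thesis by (rule generate_word_ball[OF lamp_gens_lamp_group])
  qed
  then obtain N where N: "\<And>g. g \<in> E \<Longrightarrow> g \<in> ?B (N g)" by metis
  \<comment> \<open>The 3 is the length bound for the lamp at 1, whose product with the lamp at 0 is
    to be evaluated.\<close>
  define n where "n = Max (insert 3 (N ` E))"
  have n3: "n \<ge> 3" using E(1) by (simp add: n_def)
  have En: "g \<in> ?B n" if "g \<in> E" for g
  proof -
    have "N g \<le> n" using that E(1) by (auto simp: n_def)
    then show ?thesis using word_ball_mono[of "N g" n "lamp_group \<tau>" "lamp_gens \<tau>"] N[OF that] by blast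
  qed
  have an: "lamp_a 0 \<in> ?B n" "lamp_a 1 \<in> ?B n"
    using lamp_a_ball[OF tau(1), of 0] lamp_a_ball[OF tau(1), of 1] n3
      word_ball_mono[of 1 n "lamp_group \<tau>" "lamp_gens \<tau>"] word_ball_mono[of 3 n "lamp_group \<tau>" "lamp_gens \<tau>"]
    by (auto simp: numeral_3_eq_3)
  let ?R = "int (2 * n)"
  define W where "W = {- ?R..?R}"
  have W: "finite W" "0 \<in> W" "1 \<in> W" using n3 by (auto simp: W_def)
  define d where "d = card (Pow W)"
  have d4: "d = 4 * 2 ^ card (W - {0, 1})"
  proof -
    have "card {0, 1 :: int} \<le> card W" using W by (intro card_mono) auto
    moreover have "card (W - {0, 1}) = card W - card {0, 1 :: int}" using W by (intro card_Diff_subset) auto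
    ultimately have cW: "card W = card (W - {0, 1}) + 2" by simp
    show ?thesis unfolding d_def card_Pow[OF W(1)] cW power_add by simp
  qed
  obtain l where l: "bij_betw l {..<d} (Pow W)"
    using ex_bij_betw_nat_finite[of "Pow W"] W by (auto simp: d_def atLeast0LessThan)
  have inj: "inj \<tau>" "inj (\<lambda>x::int. x + 1)" using tau(1) bij_shift by (auto simp: bij_def)
  obtain S T where S: "S \<in> UU d" "implements W (\<lambda>x. x + 1) d l S" and T: "T \<in> UU d" "implements W \<tau> d l T"
    using permutation_model[OF W(1) inj_on_subset[OF inj(1) subset_UNIV] l]
      permutation_model[OF W(1) inj_on_subset[OF inj(2) subset_UNIV] l] by blast
  let ?f = "lamp_rep d l S T"
  have car: "g \<in> carrier wreath" if "g \<in> ?B n" for g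
    using that word_ball_carrier[OF lamp_gens_lamp_group] lamp_group_ambient[OF tau(1)] by blast
  have fm: "?f (g \<star> h) = ?f g * ?f h" if gh: "g \<in> ?B n" "h \<in> ?B n" for g h
    using S(2) T(2) unfolding W_def
    by (intro lamp_rep_mult[OF car[OF gh(1)] car[OF gh(2)] local_at_word_ball[OF tau S(1) T(1) _ _ gh(1)] local_at_word_ball[OF tau S(1) T(1) _ _ gh(2)]]) auto
  let ?D = "dsign d l 0 * dsign d l 1"
  have "1 \<le> hs_dist d ?D (1\<^sub>m d)"
  proof -
    \<comment> \<open>A quarter of all subsets contain 0 but not 1. At each of them the diagonal
      entry is -1, which contributes 4 to the squared distance from the identity; the total is
      already \<open>d\<close>.\<close>
    define Q where "Q = {k\<in>{..<d}. 0 \<in> l k \<and> 1 \<notin> l k}"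
    have "card Q = card {w\<in>Pow W. 0 \<in> w \<and> 1 \<notin> w}"
    proof (rule bij_betw_same_card[of l])
      show "bij_betw l Q {w\<in>Pow W. 0 \<in> w \<and> 1 \<notin> w}"
        unfolding bij_betw_def
      proof
        show "inj_on l Q" using bij_betw_imp_inj_on[OF l] by (rule inj_on_subset) (auto simp: Q_def)
        have "Pow W = l ` {..<d}" using bij_betw_imp_surj_on[OF l] by simp
        then show "l ` Q = {w\<in>Pow W. 0 \<in> w \<and> 1 \<notin> w}" by (auto simp: Q_def)
      qed
    qed
    also have "\<dots> = card (Pow (W - {0, 1}))"
    proof (rule bij_betw_same_card[symmetric, of "insert 0"])
      show "bij_betw (insert 0) (Pow (W - {0, 1})) {w\<in>Pow W. 0 \<in> w \<and> 1 \<notin> w}"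
      proof (rule bij_betw_byWitness[where f' = "\<lambda>w. w - {0}"])
        show "insert 0 ` Pow (W - {0, 1}) \<subseteq> {w\<in>Pow W. 0 \<in> w \<and> 1 \<notin> w}"
        proof (rule image_subsetI)
          fix w assume "w \<in> Pow (W - {0, 1})"
          then have "w \<subseteq> W" "1 \<notin> w" by auto
          then show "insert 0 w \<in> {w\<in>Pow W. 0 \<in> w \<and> 1 \<notin> w}" using W(2) by simp
        qed
        show "(\<lambda>w. w - {0}) ` {w\<in>Pow W. 0 \<in> w \<and> 1 \<notin> w} \<subseteq> Pow (W - {0, 1})"
        proof (rule image_subsetI)
          fix w assume "w \<in> {w\<in>Pow W. 0 \<in> w \<and> 1 \<notin> w}"
          then have "w \<subseteq> W" "1 \<notin> w" by simp_all
          then show "w - {0} \<in> Pow (W - {0, 1})" by auto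
        qed
        show "\<forall>w\<in>Pow (W - {0, 1}). insert 0 w - {0} = w" by auto
        show "\<forall>w\<in>{w\<in>Pow W. 0 \<in> w \<and> 1 \<notin> w}. insert 0 (w - {0}) = w" by (simp add: insert_absorb)
      qed
    qed
    finally have Q: "4 * real (card Q) = d" unfolding d4 using W(1) by (simp add: card_Pow)
    have D: "?D = dg d (\<lambda>k. of_real (lsign (l k) 0 * lsign (l k) 1))" by (simp add: dsign_def dg_mult)
    have "4 * real (card Q) = 4 * (\<Sum>k<d. if 0 \<in> l k \<and> 1 \<notin> l k then 1 else 0)"
      unfolding Q_def by (simp only: of_bool_sum_card)
    also have "\<dots> \<le> sqdist d ?D (1\<^sub>m d)"
      unfolding sum_distrib_left
    proof (rule sum_mono)
      fix i assume "i \<in> {..<d}"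
      then have i: "i < d" by simp
      have "4 * (if 0 \<in> l i \<and> 1 \<notin> l i then 1 else 0) \<le> (cmod (?D $$ (i,i) - 1\<^sub>m d $$ (i,i)))\<^sup>2"
        unfolding D using i by (auto simp: lsign_def)
      also have "\<dots> \<le> (\<Sum>j<d. (cmod (?D $$ (i,j) - 1\<^sub>m d $$ (i,j)))\<^sup>2)"
        using i by (intro member_le_sum[where f = "\<lambda>j. (cmod (?D $$ (i,j) - 1\<^sub>m d $$ (i,j)))\<^sup>2"]) auto
      finally show "4 * (if 0 \<in> l i \<and> 1 \<notin> l i then 1 else 0) \<le> (\<Sum>j<d. (cmod (?D $$ (i,j) - 1\<^sub>m d $$ (i,j)))\<^sup>2)" .
    qed
    finally have "real d \<le> sqdist d ?D (1\<^sub>m d)" unfolding Q .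
    moreover have "?D \<in> MM d" by simp
    ultimately have "1\<^sup>2 \<le> (hs_dist d ?D (1\<^sub>m d))\<^sup>2"
      using d4 by (subst hs_dist_sq) (auto simp: field_simps)
    then show ?thesis by (rule power2_le_imp_le) (simp add: hs_dist_nonneg)
  qed
  moreover have "?f (lamp_a 0 \<star> lamp_a 1) = ?D"
    using fm[OF an] by (simp add: lamp_rep_a)
  ultimately show ?thesis using fm En lamp_rep_UU car d4 by (intro exI[of _ d] conjI exI[of _ ?f]) auto
qed

text \<open>Since the criterion mentions only an element and finite subsets of the carrier, both the
  collapse and the models are carried along the isomorphism to \<open>H\<close>.\<close>

lemma lamp_not_hs_stable:
  assumes tau: "bij \<tau>" "\<And>x. \<bar>\<tau> x - x\<bar> \<le> 1" "\<And>x. x < 0 \<Longrightarrow> \<tau> x = x" "\<tau> 0 = 1"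
    and H: "group H" and h: "h \<in> iso (lamp_group \<tau>) H"
  shows "\<not> hs_stable H"
proof -
  let ?L = "lamp_group \<tau>" and ?b = "lamp_a 0 \<star> lamp_a 1" and ?g = "inv_into (carrier (lamp_group \<tau>)) h"
  interpret L: group ?L by (rule group_lamp_group[OF tau(1)])
  have hom: "h \<in> hom ?L H" and g: "?g \<in> hom H ?L"
    using h L.iso_set_sym[OF h] by (auto simp: iso_def)
  have gh: "?g (h x) = x" if "x \<in> carrier ?L" for x
    using h that by (auto simp: iso_def bij_betw_def)
  have ac: "lamp_a x \<in> carrier ?L" for x
    using lamp_a_ball[OF tau(1)] L.word_ball_carrier[OF lamp_gens_lamp_group] by blast
  have b: "?b \<in> carrier ?L" using L.m_closed[OF ac ac] by simp
  show ?thesis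
  proof (rule group.not_hs_stableI[OF H, of "h ?b"])
    show "h ?b \<in> carrier H" using hom_in_carrier[OF hom b] .
    show "hs_dist d (\<pi> (h ?b)) (1\<^sub>m d) \<le> 1 / 4" if "d \<ge> 1" "\<pi> \<in> hom H (unitary_group d)" for d \<pi>
      using lamp_hom_collapse[OF tau(1,3,4) that(1) Group.hom_compose[OF hom that(2)], of "1 / 4"] by simp
    fix E assume E: "finite E" "E \<subseteq> carrier H"
    have "?g ` E \<subseteq> carrier ?L" using hom_in_carrier[OF g] E(2) by blast
    from lamp_far_models[OF tau(1,2) finite_imageI[OF E(1)] this] obtain d f where d: "d \<ge> 1"
      and f: "\<forall>x\<in>?g ` E. f x \<in> UU d" "\<forall>x\<in>?g ` E. \<forall>y\<in>?g ` E. f (x \<star> y) = f x * f y"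
        "hs_dist d (f ?b) (1\<^sub>m d) \<ge> 1" by blast
    have "?g (x \<otimes>\<^bsub>H\<^esub> y) = ?g x \<star> ?g y" if "x \<in> E" "y \<in> E" for x y
      using hom_mult[OF g] that E(2) by (simp add: subset_iff)
    then show "\<exists>d\<ge>1. \<exists>f. (\<forall>x\<in>E. f x \<in> UU d) \<and>
        (\<forall>x\<in>E. \<forall>y\<in>E. f (x \<otimes>\<^bsub>H\<^esub> y) = f x * f y) \<and> hs_dist d (f (h ?b)) (1\<^sub>m d) \<ge> 1"
      using d f gh[OF b] by (intro exI[of _ d] conjI exI[of _ "f \<circ> ?g"]) auto
  qed
qed

section \<open>Uncountably many isomorphism types\<close>

lemma hom_foldr:
  assumes "group G" "group H" "h \<in> hom G H" "set ws \<subseteq> carrier G"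
  shows "h (foldr (\<otimes>\<^bsub>G\<^esub>) ws \<one>\<^bsub>G\<^esub>) = foldr (\<otimes>\<^bsub>H\<^esub>) (map h ws) \<one>\<^bsub>H\<^esub>"
    and "foldr (\<otimes>\<^bsub>G\<^esub>) ws \<one>\<^bsub>G\<^esub> \<in> carrier G"
proof -
  interpret group_hom G H h using assms by (simp add: group_hom_def group_hom_axioms_def)
  have "h (foldr (\<otimes>\<^bsub>G\<^esub>) ws \<one>\<^bsub>G\<^esub>) = foldr (\<otimes>\<^bsub>H\<^esub>) (map h ws) \<one>\<^bsub>H\<^esub> \<and> foldr (\<otimes>\<^bsub>G\<^esub>) ws \<one>\<^bsub>G\<^esub> \<in> carrier G"
    using assms(4) by (induction ws) auto
  then show "h (foldr (\<otimes>\<^bsub>G\<^esub>) ws \<one>\<^bsub>G\<^esub>) = foldr (\<otimes>\<^bsub>H\<^esub>) (map h ws) \<one>\<^bsub>H\<^esub>"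
    "foldr (\<otimes>\<^bsub>G\<^esub>) ws \<one>\<^bsub>G\<^esub> \<in> carrier G" by auto
qed

lemma word_ball_hom:
  assumes G: "group G" and H: "group H" and h: "h \<in> hom G H" and S: "S \<subseteq> carrier G"
  shows "word_ball H (h ` S) n = h ` word_ball G S n"
proof -
  interpret group_hom G H h using assms by (simp add: group_hom_def group_hom_axioms_def)
  let ?A = "S \<union> m_inv G ` S"
  have A: "?A \<subseteq> carrier G" using S by auto
  have "h ` m_inv G ` S = m_inv H ` h ` S" using S by (auto simp: image_comp intro!: image_cong)
  then have hA: "h ` ?A = h ` S \<union> m_inv H ` h ` S" by (simp add: image_Un)
  have W: "word_ball K T n = (\<lambda>ws. foldr (\<otimes>\<^bsub>K\<^esub>) ws \<one>\<^bsub>K\<^esub>) ` {ws \<in> lists (T \<union> m_inv K ` T). length ws \<le> n}"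
    for K :: "('z, 'y) monoid_scheme" and T
    by (auto simp: word_ball_def in_lists_conv_set image_def subset_iff)
  have "{ws \<in> lists (h ` ?A). length ws \<le> n} = map h ` {ws \<in> lists ?A. length ws \<le> n}"
    unfolding lists_image by auto
  then have "word_ball H (h ` S) n = (\<lambda>ws. foldr (\<otimes>\<^bsub>H\<^esub>) (map h ws) \<one>\<^bsub>H\<^esub>) ` {ws \<in> lists ?A. length ws \<le> n}"
    unfolding W hA[symmetric] by (simp only: image_image)
  also have "\<dots> = (\<lambda>ws. h (foldr (\<otimes>\<^bsub>G\<^esub>) ws \<one>\<^bsub>G\<^esub>)) ` {ws \<in> lists ?A. length ws \<le> n}"
    using hom_foldr(1)[OF G H h] A by (intro image_cong refl) (metis (mono_tags, lifting) in_lists_conv_set mem_Collect_eq subset_iff)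
  finally show ?thesis unfolding W by (simp only: image_image)
qed

lemma finite_generating_set_iso:
  assumes "group G" "group H" "h \<in> iso G H" "finite_generating_set G S"
  shows "finite_generating_set H (h ` S)"
proof -
  interpret group_hom G H h using assms by (simp add: group_hom_def group_hom_axioms_def iso_def)
  show ?thesis using assms(3,4) generate_img[of S]
    by (auto simp: finite_generating_set_def iso_def bij_betw_def)
qed

text \<open>Balls correspond under \<open>h\<close>, so almost representations are pulled back along
  \<open>h\<close> and local representations carried over along its inverse, with the same
  constants.\<close>

lemma locally_hs_stable_wrt_iso:
  assumes G: "group G" and H: "group H" and h: "h \<in> iso G H" and S: "S \<subseteq> carrier G"
    and st: "locally_hs_stable_wrt G S"
  shows "locally_hs_stable_wrt H (h ` S)"
proof -
  have hom: "h \<in> hom G H" and bij: "bij_betw h (carrier G) (carrier H)" using h by (auto simp: iso_def)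
  note ball = word_ball_hom[OF G H hom S]
  have car: "g \<in> carrier G" if "g \<in> word_ball G S n" for g n using group.word_ball_carrier[OF G S] that by blast
  have hm: "h (g \<otimes>\<^bsub>G\<^esub> k) = h g \<otimes>\<^bsub>H\<^esub> h k" if "g \<in> carrier G" "k \<in> carrier G" for g k
    using hom_mult[OF hom] that by simp
  have hinv: "inv_into (carrier G) h (h g) = g" if "g \<in> carrier G" for g
    using bij that by (auto simp: bij_betw_def inv_into_f_f)
  have inj: "h g = h k \<longleftrightarrow> g = k" if "g \<in> carrier G" "k \<in> carrier G" for g k
    using bij that by (auto simp: bij_betw_def inj_on_def)
  have mc: "g \<otimes>\<^bsub>G\<^esub> k \<in> carrier G" if "g \<in> carrier G" "k \<in> carrier G" for g k
    using G that by (simp add: group.is_monoid monoid.m_closed)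
  have mem: "h g \<in> h ` word_ball G S n \<longleftrightarrow> g \<in> word_ball G S n" if "g \<in> carrier G" for g n
    using inj[OF that] car by blast
  have rep: "almost_rep G S n \<delta> d (\<phi> \<circ> h)" if ar: "almost_rep H (h ` S) n \<delta> d \<phi>" for n \<delta> d \<phi>
    unfolding almost_rep_def
  proof (intro conjI ballI impI)
    show "\<phi> \<circ> h \<in> word_ball G S n \<rightarrow> UU d" using ar by (auto simp: almost_rep_def ball)
    fix g k assume gk: "g \<in> word_ball G S n" "k \<in> word_ball G S n" "g \<otimes>\<^bsub>G\<^esub> k \<in> word_ball G S n"
    then have "h g \<otimes>\<^bsub>H\<^esub> h k \<in> h ` word_ball G S n" using hm[OF car[OF gk(1)] car[OF gk(2)]] by (metis imageI)
    then show "hs_dist d ((\<phi> \<circ> h) (g \<otimes>\<^bsub>G\<^esub> k)) ((\<phi> \<circ> h) g * (\<phi> \<circ> h) k) \<le> \<delta>"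
      using ar gk hm[OF car[OF gk(1)] car[OF gk(2)]] by (auto simp: almost_rep_def ball)
  qed
  have loc: "local_rep H (h ` S) r d (f \<circ> inv_into (carrier G) h)" if lr: "local_rep G S r d f" for r d f
    unfolding local_rep_def ball
  proof (intro conjI ballI impI)
    show "f \<circ> inv_into (carrier G) h \<in> h ` word_ball G S r \<rightarrow> UU d"
      using lr car hinv by (auto simp: local_rep_def)
    fix x y assume "x \<in> h ` word_ball G S r" "y \<in> h ` word_ball G S r" and xy: "x \<otimes>\<^bsub>H\<^esub> y \<in> h ` word_ball G S r"
    then obtain g k where gk: "g \<in> word_ball G S r" "k \<in> word_ball G S r" "x = h g" "y = h k" by auto
    have c: "g \<in> carrier G" "k \<in> carrier G" using car gk by auto
    have "g \<otimes>\<^bsub>G\<^esub> k \<in> word_ball G S r" using xy mem[OF mc[OF c]] hm[OF c] gk by simp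
    then have "f (g \<otimes>\<^bsub>G\<^esub> k) = f g * f k" using lr gk by (auto simp: local_rep_def)
    then show "(f \<circ> inv_into (carrier G) h) (x \<otimes>\<^bsub>H\<^esub> y) =
        (f \<circ> inv_into (carrier G) h) x * (f \<circ> inv_into (carrier G) h) y"
      using hinv[OF c(1)] hinv[OF c(2)] hinv[OF mc[OF c]] hm[OF c] gk by simp
  qed
  show ?thesis unfolding locally_hs_stable_wrt_def
  proof (intro allI impI)
    fix \<epsilon> :: real and r :: nat assume "\<epsilon> > 0" "r \<ge> 1"
    then obtain \<delta> n where dn: "\<delta> > 0" "n \<ge> 1" and R: "\<forall>d\<ge>1. \<forall>\<phi>. almost_rep G S n \<delta> d \<phi> \<longrightarrow>
        (\<exists>f. local_rep G S r d f \<and> (\<forall>s\<in>S. hs_dist d (\<phi> s) (f s) < \<epsilon>))"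
      using st unfolding locally_hs_stable_wrt_def by blast
    show "\<exists>\<delta>>0. \<exists>n\<ge>1. \<forall>d\<ge>1. \<forall>\<phi>. almost_rep H (h ` S) n \<delta> d \<phi> \<longrightarrow>
        (\<exists>f. local_rep H (h ` S) r d f \<and> (\<forall>s\<in>h ` S. hs_dist d (\<phi> s) (f s) < \<epsilon>))"
    proof (intro exI[of _ \<delta>] exI[of _ n] conjI allI impI)
      fix d :: nat and \<phi> assume "1 \<le> d" "almost_rep H (h ` S) n \<delta> d \<phi>"
      then obtain f where f: "local_rep G S r d f" "\<forall>s\<in>S. hs_dist d ((\<phi> \<circ> h) s) (f s) < \<epsilon>"
        using R rep by blast
      show "\<exists>f. local_rep H (h ` S) r d f \<and> (\<forall>s\<in>h ` S. hs_dist d (\<phi> s) (f s) < \<epsilon>)"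
        using loc[OF f(1)] f(2) S hinv by (intro exI[of _ "f \<circ> inv_into (carrier G) h"]) auto
    qed (use dn in auto)
  qed
qed

lemma countable_finitely_generated:
  assumes "group G" "finite_generating_set G S"
  shows "countable (carrier G)"
proof -
  interpret group G by fact
  have S: "finite S" "S \<subseteq> carrier G" "carrier G = generate G S" using assms by (auto simp: finite_generating_set_def)
  have "carrier G \<subseteq> (\<Union>n. word_ball G S n)" using generate_word_ball[OF S(2)] S(3) by blast
  moreover have "countable (\<Union>n. word_ball G S n)"
    using finite_word_ball[OF S(1)] by (intro countable_UN) (auto intro: countable_finite)
  ultimately show ?thesis by (rule countable_subset)
qed

text \<open>The nonnegative integers are split into pairs \<open>2 * j\<close>,
  \<open>2 * j + 1\<close>. Pair 0 is always swapped, as the failure of stability requires; pair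
  \<open>k + 1\<close>, with even position \<open>2 * k + 2\<close>, is swapped just if
  \<open>k\<close> belongs to \<theta>. So \<theta> is unrestricted.\<close>

definition block_swap :: "nat set \<Rightarrow> int \<Rightarrow> int" where
  "block_swap \<theta> x = (if 0 \<le> x \<and> (x div 2 = 0 \<or> nat (x div 2) - 1 \<in> \<theta>) then (if even x then x + 1 else x - 1) else x)"

lemma block_swap_idem [simp]: "block_swap \<theta> (block_swap \<theta> x) = x"
proof (cases "0 \<le> x \<and> (x div 2 = 0 \<or> nat (x div 2) - 1 \<in> \<theta>)")
  case True
  show ?thesis
  proof (cases "even x")
    case e: True
    then have "(x + 1) div 2 = x div 2" by simp
    then show ?thesis using True e by (simp add: block_swap_def)
  next
    case o: False
    then have "(x - 1) div 2 = x div 2" "x \<ge> 1" using True by (auto elim!: oddE)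
    then show ?thesis using True o by (simp add: block_swap_def)
  qed
next
  case False
  then have "block_swap \<theta> x = x" unfolding block_swap_def by (rule if_not_P)
  then show ?thesis by simp
qed

lemma bij_block_swap: "bij (block_swap \<theta>)"
  by (rule bij_betw_byWitness[where f' = "block_swap \<theta>"]) auto

lemma block_swap_near: "\<bar>block_swap \<theta> x - x\<bar> \<le> 1"
  by (simp add: block_swap_def)

lemma block_swap_neg: "x < 0 \<Longrightarrow> block_swap \<theta> x = x"
  by (simp add: block_swap_def)

lemma block_swap_0: "block_swap \<theta> 0 = 1"
  by (simp add: block_swap_def)

lemma block_swap_fixed: "block_swap \<theta> (2 * int k + 2) = 2 * int k + 2 \<longleftrightarrow> k \<notin> \<theta>"
proof -
  have "(2 * int k + 2) div 2 = int k + 1" by simp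
  then show ?thesis by (simp add: block_swap_def nat_add_distrib)
qed

text \<open>Reads off from a group marked with images of the three generators at which even positions
  the generator \<open>t\<close> moves the lamp.\<close>
definition decode :: "('g, 'h) monoid_scheme \<Rightarrow> 'g \<times> 'g \<times> 'g \<Rightarrow> nat set" where
  "decode G = (\<lambda>(a, s, t). {k. let b = ((\<lambda>x. s \<otimes>\<^bsub>G\<^esub> x \<otimes>\<^bsub>G\<^esub> inv\<^bsub>G\<^esub> s) ^^ (2 * k + 2)) a in t \<otimes>\<^bsub>G\<^esub> b \<noteq> b \<otimes>\<^bsub>G\<^esub> t})"

text \<open>Conjugation by \<open>s\<close> carries the lamp at 0 along the integers, and
  \<open>t\<close> commutes with the lamp at \<open>x\<close> just if \<tau> fixes \<open>x\<close>.
  Injectivity of \<open>v\<close> makes this visible in the image.\<close>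

lemma decode_lamp_group:
  assumes G: "group G" and v: "v \<in> iso (lamp_group (block_swap \<theta>)) G"
  shows "decode G (v (lamp_a 0), v lamp_s, v (lamp_t (block_swap \<theta>))) = \<theta>"
proof -
  let ?\<tau> = "block_swap \<theta>" and ?L = "lamp_group (block_swap \<theta>)"
  note tau = bij_block_swap[of \<theta>]
  interpret L: group ?L by (rule group_lamp_group[OF tau])
  interpret group_hom ?L G v
    using v G L.is_group by (simp add: group_hom_def group_hom_axioms_def iso_def)
  have ac: "lamp_a x \<in> carrier ?L" for x
    using lamp_a_ball[OF tau] L.word_ball_carrier[OF lamp_gens_lamp_group] by blast
  have gc: "lamp_s \<in> carrier ?L" "lamp_t ?\<tau> \<in> carrier ?L"
    using lamp_gens_lamp_group[of ?\<tau>] by (auto simp: lamp_gens_def)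
  have step: "v lamp_s \<otimes>\<^bsub>G\<^esub> v (lamp_a x) \<otimes>\<^bsub>G\<^esub> inv\<^bsub>G\<^esub> v lamp_s = v (lamp_a (x + 1))" for x
  proof -
    have "v lamp_s \<otimes>\<^bsub>G\<^esub> v (lamp_a x) \<otimes>\<^bsub>G\<^esub> inv\<^bsub>G\<^esub> v lamp_s = v (lamp_s \<otimes>\<^bsub>?L\<^esub> lamp_a x \<otimes>\<^bsub>?L\<^esub> inv\<^bsub>?L\<^esub> lamp_s)"
      using gc(1) ac[of x] by (simp del: lamp_group_sel)
    then show ?thesis by (simp add: lamp_group_inv[OF tau gc(1)] lamp_s_conj)
  qed
  have iter: "((\<lambda>x. v lamp_s \<otimes>\<^bsub>G\<^esub> x \<otimes>\<^bsub>G\<^esub> inv\<^bsub>G\<^esub> v lamp_s) ^^ n) (v (lamp_a 0)) = v (lamp_a (int n))" for n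
    by (induction n) (simp_all add: step add.commute)
  have "v (lamp_t ?\<tau>) \<otimes>\<^bsub>G\<^esub> v (lamp_a x) = v (lamp_a x) \<otimes>\<^bsub>G\<^esub> v (lamp_t ?\<tau>) \<longleftrightarrow> ?\<tau> x = x" for x
  proof -
    have "v (lamp_t ?\<tau>) \<otimes>\<^bsub>G\<^esub> v (lamp_a x) = v (lamp_t ?\<tau> \<star> lamp_a x)"
      "v (lamp_a x) \<otimes>\<^bsub>G\<^esub> v (lamp_t ?\<tau>) = v (lamp_a x \<star> lamp_t ?\<tau>)"
      using hom_mult[OF gc(2) ac[of x]] hom_mult[OF ac[of x] gc(2)] by simp_all
    moreover have "lamp_t ?\<tau> \<star> lamp_a x \<in> carrier ?L" "lamp_a x \<star> lamp_t ?\<tau> \<in> carrier ?L"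
      using L.m_closed[OF gc(2) ac[of x]] L.m_closed[OF ac[of x] gc(2)] by simp_all
    moreover have "inj_on v (carrier ?L)" using v by (auto simp: iso_def bij_betw_def)
    ultimately have "v (lamp_t ?\<tau>) \<otimes>\<^bsub>G\<^esub> v (lamp_a x) = v (lamp_a x) \<otimes>\<^bsub>G\<^esub> v (lamp_t ?\<tau>) \<longleftrightarrow>
        lamp_t ?\<tau> \<star> lamp_a x = lamp_a x \<star> lamp_t ?\<tau>"
      by (simp add: inj_on_eq_iff)
    then show ?thesis by (auto simp: lamp_a_def lamp_t_def fun_eq_iff)
  qed
  then show ?thesis
    unfolding decode_def prod.case Let_def iter
    using block_swap_fixed[of \<theta>] by (auto simp: add.commute)
qed

text \<open>A copy on natural numbers: finitely generated groups are countable, and over a countable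
  type there are only countably many triples to decode.\<close>

definition nat_lamp_group :: "nat set \<Rightarrow> nat monoid" where
  "nat_lamp_group \<theta> = image_group (to_nat_on (carrier (lamp_group (block_swap \<theta>)))) (lamp_group (block_swap \<theta>))"

lemma nat_lamp_group_iso:
  "to_nat_on (carrier (lamp_group (block_swap \<theta>))) \<in> iso (lamp_group (block_swap \<theta>)) (nat_lamp_group \<theta>)"
  "group (nat_lamp_group \<theta>)"
proof -
  let ?L = "lamp_group (block_swap \<theta>)"
  have G: "group ?L" by (rule group_lamp_group[OF bij_block_swap])
  have "countable (carrier ?L)"
    by (rule countable_finitely_generated[OF G finite_generating_set_lamp[OF bij_block_swap]])
  then have inj: "inj_on (to_nat_on (carrier ?L)) (carrier ?L)" by (rule inj_on_to_nat_on)
  show "to_nat_on (carrier ?L) \<in> iso ?L (nat_lamp_group \<theta>)" "group (nat_lamp_group \<theta>)"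
    unfolding nat_lamp_group_def
    using inj_imp_image_group_iso[OF inj] group.inj_imp_image_group_is_group[OF G inj] by auto
qed

lemma nat_lamp_group_properties:
  "generated_by_at_most 4 (nat_lamp_group \<theta>)"
  "locally_hs_stable (nat_lamp_group \<theta>)"
  "\<not> hs_stable (nat_lamp_group \<theta>)"
proof -
  let ?\<tau> = "block_swap \<theta>"
  let ?L = "lamp_group ?\<tau>" and ?N = "nat_lamp_group \<theta>" and ?h = "to_nat_on (carrier (lamp_group (block_swap \<theta>)))"
  note tau = bij_block_swap[of \<theta>]
  have L: "group ?L" by (rule group_lamp_group[OF tau])
  note N = nat_lamp_group_iso(2)[of \<theta>] and h = nat_lamp_group_iso(1)[of \<theta>]
  have gen: "finite_generating_set ?N (?h ` lamp_gens ?\<tau>)"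
    by (rule finite_generating_set_iso[OF L N h finite_generating_set_lamp[OF tau]])
  have "card (?h ` lamp_gens ?\<tau>) \<le> card (lamp_gens ?\<tau>)" by (rule card_image_le) (simp add: lamp_gens_def)
  \<comment> \<open>There are at most three generators, and the bound 4 is an upper bound
    only.\<close>
  also have "\<dots> \<le> 4" unfolding lamp_gens_def by (rule order_trans[OF card_insert_le_m1 order_refl]) (auto intro: order_trans[OF card_insert_le_m1])
  finally show "generated_by_at_most 4 ?N" using gen by (auto simp: generated_by_at_most_def)
  have "locally_hs_stable_wrt ?N (?h ` lamp_gens ?\<tau>)"
    by (rule locally_hs_stable_wrt_iso[OF L N h lamp_gens_lamp_group lamp_locally_stable[OF tau block_swap_near]])
  then show "locally_hs_stable ?N" using gen by (auto simp: locally_hs_stable_def)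
  show "\<not> hs_stable ?N"
    by (rule lamp_not_hs_stable[OF tau block_swap_near block_swap_neg block_swap_0 N h])
qed

text \<open>Every such \<theta> is decoded from some triple of natural numbers, the images of the
  generators under an isomorphism.\<close>

lemma countable_nat_lamp_group_iso:
  assumes G: "group (G :: nat monoid)"
  shows "countable {\<theta>. nat_lamp_group \<theta> \<cong> G}"
proof -
  have "{\<theta>. nat_lamp_group \<theta> \<cong> G} \<subseteq> range (decode G)"
  proof
    fix \<theta> assume "\<theta> \<in> {\<theta>. nat_lamp_group \<theta> \<cong> G}"
    then obtain u where "u \<in> iso (nat_lamp_group \<theta>) G" by (auto simp: is_iso_def)
    then have "u \<circ> to_nat_on (carrier (lamp_group (block_swap \<theta>))) \<in> iso (lamp_group (block_swap \<theta>)) G"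
      using nat_lamp_group_iso(1) iso_set_trans by blast
    from decode_lamp_group[OF G this] show "\<theta> \<in> range (decode G)" by (metis rangeI)
  qed
  then show ?thesis by (rule countable_subset) simp
qed

lemma uncountable_nat_sets: "uncountable (UNIV :: nat set set)"
proof
  assume "countable (UNIV :: nat set set)"
  then have "range (from_nat_into (UNIV :: nat set set)) = UNIV" by (intro range_from_nat_into) auto
  then show False using Cantors_theorem[of "UNIV :: nat set"] by auto
qed

theorem corollary11p8:
  shows "\<exists>\<G> :: nat monoid set.
    uncountable \<G> \<and>
    (\<forall>G\<in>\<G>. group G \<and> generated_by_at_most 4 G \<and> locally_hs_stable G \<and> \<not> hs_stable G) \<and>
    (\<forall>G\<in>\<G>. \<forall>H\<in>\<G>. G \<noteq> H \<longrightarrow> \<not> G \<cong> H)"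
proof -
  \<comment> \<open>A representative of each isomorphism class, so that distinct members of the
    family are not isomorphic.\<close>
  define c where "c \<theta> = (SOME \<theta>'. nat_lamp_group \<theta>' \<cong> nat_lamp_group \<theta>)" for \<theta>
  have c: "nat_lamp_group (c \<theta>) \<cong> nat_lamp_group \<theta>" for \<theta>
    unfolding c_def by (rule someI[of _ \<theta>]) (rule iso_refl)
  note grp = nat_lamp_group_iso(2)
  define \<G> where "\<G> = range (\<lambda>\<theta>. nat_lamp_group (c \<theta>))"
  have unc: "uncountable \<G>"
  proof
    assume "countable \<G>"
    \<comment> \<open>Countably many classes, each arising from countably many sets of naturals,
      would exhaust all sets of naturals.\<close>
    then have "countable (\<Union>G\<in>\<G>. {\<theta>. nat_lamp_group \<theta> \<cong> G})"
      using countable_nat_lamp_group_iso grp by (intro countable_UN) (auto simp: \<G>_def)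
    moreover have "UNIV \<subseteq> (\<Union>G\<in>\<G>. {\<theta>. nat_lamp_group \<theta> \<cong> G})"
      using group.iso_sym[OF grp c] by (auto simp: \<G>_def)
    ultimately show False using uncountable_nat_sets countable_subset by blast
  qed
  have inj: "G = H" if GH: "G \<in> \<G>" "H \<in> \<G>" "G \<cong> H" for G H
  proof -
    obtain \<theta> \<eta> where t: "G = nat_lamp_group (c \<theta>)" "H = nat_lamp_group (c \<eta>)" using GH(1,2) by (auto simp: \<G>_def)
    have iso: "nat_lamp_group \<theta> \<cong> nat_lamp_group \<eta>"
      using iso_trans[OF iso_trans[OF group.iso_sym[OF grp c] GH(3)[unfolded t]] c] .
    \<comment> \<open>Isomorphic groups define the same predicate, so the choice operator returns
      the same representative for both.\<close>
    have "nat_lamp_group \<theta>' \<cong> nat_lamp_group \<theta> \<longleftrightarrow> nat_lamp_group \<theta>' \<cong> nat_lamp_group \<eta>" for \<theta>'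
      using iso_trans iso group.iso_sym[OF grp iso] by blast
    then show ?thesis unfolding t c_def by simp
  qed
  have props: "group G \<and> generated_by_at_most 4 G \<and> locally_hs_stable G \<and> \<not> hs_stable G" if G: "G \<in> \<G>" for G
  proof -
    obtain \<theta> where "G = nat_lamp_group (c \<theta>)" using G unfolding \<G>_def by blast
    then show ?thesis using nat_lamp_group_properties[of "c \<theta>"] grp[of "c \<theta>"] by simp
  qed
  show ?thesis
  proof (intro exI[of _ \<G>] conjI ballI impI)
    show "uncountable \<G>" by (rule unc)
  next
    fix G H assume "G \<in> \<G>" "H \<in> \<G>" "G \<noteq> H"
    then show "\<not> G \<cong> H" using inj by metis
  qed (use props in auto)
qed

end
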